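(* Let $\Gamma$ be the cyclic group of order $2$, let $(\tilde G,\tilde p)$ be a $\mathcal{C}_2$-generic framework in $\mathbb{R}^2$ (where $\mathcal{C}_2=\{\mathrm{id},C_2\}$ and $C_2$ is the rotation by $\pi$ about the origin), and let $(G,\psi,p)$ be its associated $\mathcal{C}_2$-gain framework. Then $(\tilde G,\tilde p)$ is infinitesimally rigid if and only if both of the following hold: (a) there is a spanning subgraph of $(G,\psi)$ which is $(2,0,3,1)$-gain-tight; and (b) there is a spanning subgraph of $(G,\psi)$ which is $(2,2,3,2)$-gain-tight.
   Context: **Frameworks.** A framework in $\mathbb{R}^2$ is a pair $(\tilde G,\tilde p)$ with $\tilde G$ a finite simple graph and $\tilde p:V(\tilde G)\to\mathbb{R}^2$ injective; it is assumed that $\tilde p(V(\tilde G))$ affinely spans $\mathbb{R}^2$. An infinitesimal motion is $m:V(\tilde G)\to\mathbb{R}^2$ with $(\tilde p(u)-\tilde p(v))^T(m(u)-m(v))=0$ for all edges $\{u,v\}$; it is trivial if $m(u)=M\tilde p(u)+t$ for a fixed skew-symmetric $M$ and vector $t$. $(\tilde G,\tilde p)$ is infinitesimally rigid if all its infinitesimal motions are trivial. The rigidity matrix $R(\tilde G,\tilde p)$ has one row per edge, the row of $\{u,v\}$ having $(\tilde p(u)-\tilde p(v))^T$ in the two columns of $u$, $(\tilde p(v)-\tilde p(u))^T$ in the two columns of $v$, and zeros elsewhere. **Symmetry.** $\Gamma=\langle\gamma\rangle$ acts on $\tilde G$ by graph automorphisms, and $\tau:\Gamma\to O(\mathbb{R}^2)$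 is the faithful representation with image $\mathcal{C}_2$. $(\tilde G,\tilde p)$ is $\mathcal{C}_2$-symmetric if $\tau(g)\tilde p(v)=\tilde p(gv)$ for all $g\in\Gamma$, $v\in V(\tilde G)$. It is $\mathcal{C}_2$-generic if it is $\mathcal{C}_2$-symmetric and $\operatorname{rank}R(\tilde G,\tilde p)\ge\operatorname{rank}R(\tilde G,\tilde q)$ for all $\mathcal{C}_2$-symmetric realisations $(\tilde G,\tilde q)$ (same action on $\tilde G$). A vertex is fixed if it is fixed by all of $\Gamma$ (so it is placed at the origin, and there is at most one), free if its stabiliser is trivial. **Quotient gain graph.** $G=\tilde G/\Gamma$ is the multigraph whose vertices and edges are the vertex orbits and edge orbits of $\tilde G$; $V_0(G)$ is the set of orbits of fixed vertices (fixed vertices of $G$) and $\overline{V(G)}$ the set of orbits of free vertices (free vertices of $G$). Choose a representative $v^\star$ of each vertex orbit $v$ and an orientation of each edge of $G$. The gain $\psi(e)\in\Gamma$ of an edge $e=(u,v)$ of $G$ is: the unique $g$ with $\{u^\star,gv^\star\}\in e$ if $u,v$ are both free (for a loop, up to inversion); an arbitrary element of $\Gamma$ if exactly one of $u,v$ is fixed. Put $p(v)=\tilde p(v^\star)$. Then $(G,\psi)$ is a quotient $\Gamma$-gain graph and $(G,\psi,p)$ the $\mathcal{C}_2$-gain framework of $(\tilde G,\tilde p)$. **Sparsity.** For a subgraph $H$ of $G$, $V_0(H)=V(H)\cap V_0(G)$ and $\overline{V(H)}=V(H)\cap\overline{V(G)}$. The gain of a walk is the product of the $\psi(e)^{\pm1}$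 along it, exponent $+1$ if $e$ is traversed along its orientation and $-1$ otherwise. $H$ is balanced if, after deleting all fixed vertices and their incident edges, every cycle (including loops and cycles formed by two parallel edges) has gain $\mathrm{id}$. $(G,\psi)$ is $(2,m,3,l)$-gain-sparse if (1) $|E(H)|\le 2|V(H)|-3$ for every balanced subgraph $H$ with $E(H)\ne\emptyset$, and (2) $|E(H)|\le 2|\overline{V(H)}|+m|V_0(H)|-l$ for every subgraph $H$ with $E(H)\neq\emptyset$. It is $(2,m,3,l)$-gain-tight if moreover $|E(G)|=2|\overline{V(G)}|+m|V_0(G)|-l$. A spanning subgraph has vertex set $V(G)$ and carries the restricted gains. *)

theory Defs
  imports
    "HOL-Analysis.Analysis"
    "HOL-Algebra.Group_Action"
    "HOL-Algebra.Elementary_Groups"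
    "HOL-Library.Function_Algebras"
    "Graph_Theory.Digraph_Component"
begin

section \<open>Frameworks in the plane\<close>

definition simple_graph :: "'v set \<Rightarrow> 'v set set \<Rightarrow> bool" where
  "simple_graph V E \<longleftrightarrow> finite V \<and> (\<forall>e\<in>E. e \<subseteq> V \<and> card e = 2)"

definition framework :: "'v set \<Rightarrow> 'v set set \<Rightarrow> ('v \<Rightarrow> real^2) \<Rightarrow> bool" where
  "framework V E p \<longleftrightarrow> simple_graph V E \<and> inj_on p V \<and> affine hull (p ` V) = UNIV"

definition infinitesimal_motion ::
    "'v set set \<Rightarrow> ('v \<Rightarrow> real^2) \<Rightarrow> ('v \<Rightarrow> real^2) \<Rightarrow> bool" where
  "infinitesimal_motion E p m \<longleftrightarrow> (\<forall>u v. {u, v} \<in> E \<longrightarrow> (p u - p v) \<bullet> (m u - m v) = 0)"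

definition trivial_motion ::
    "'v set \<Rightarrow> ('v \<Rightarrow> real^2) \<Rightarrow> ('v \<Rightarrow> real^2) \<Rightarrow> bool" where
  "trivial_motion V p m \<longleftrightarrow>
     (\<exists>(M :: real^2^2) t. transpose M = - M \<and> (\<forall>u\<in>V. m u = M *v p u + t))"

definition infinitesimally_rigid :: "'v set \<Rightarrow> 'v set set \<Rightarrow> ('v \<Rightarrow> real^2) \<Rightarrow> bool" where
  "infinitesimally_rigid V E p \<longleftrightarrow>
     (\<forall>m. infinitesimal_motion E p m \<longrightarrow> trivial_motion V p m)"

text \<open>
  Rows are indexed by edges \<open>e\<close>, columns by pairs \<open>(w, i)\<close> of a vertex and a coordinate.
  The term \<open>THE x. e = {w, x}\<close> is the other endpoint of \<open>e\<close>.  The rank is the dimension of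
  the row space, taken in the real vector space of all functions on the columns; columns of
  elements outside the vertex set vanish.
\<close>

definition rigidity_matrix ::
    "('v \<Rightarrow> real^2) \<Rightarrow> 'v set \<Rightarrow> 'v \<times> 2 \<Rightarrow> real" where
  "rigidity_matrix p e = (\<lambda>(w, i). if w \<in> e then (p w - p (THE x. e = {w, x})) $ i else 0)"

definition fun_scale :: "real \<Rightarrow> ('c \<Rightarrow> real) \<Rightarrow> 'c \<Rightarrow> real" where
  "fun_scale c f = (\<lambda>x. c * f x)"

lemma vector_space_fun_scale: "vector_space fun_scale"
  by unfold_locales (simp_all add: fun_scale_def fun_eq_iff algebra_simps)

definition rigidity_rank :: "'v set set \<Rightarrow> ('v \<Rightarrow> real^2) \<Rightarrow> nat" where
  "rigidity_rank E p = vector_space.dim fun_scale (rigidity_matrix p ` E)"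


section \<open>Symmetry\<close>

definition graph_action ::
    "'g monoid \<Rightarrow> 'v set \<Rightarrow> 'v set set \<Rightarrow> ('g \<Rightarrow> 'v \<Rightarrow> 'v) \<Rightarrow> bool" where
  "graph_action \<Gamma> V E \<phi> \<longleftrightarrow> group_action \<Gamma> V \<phi> \<and>
     (\<forall>g\<in>carrier \<Gamma>. \<forall>u\<in>V. \<forall>v\<in>V. {u, v} \<in> E \<longleftrightarrow> {\<phi> g u, \<phi> g v} \<in> E)"

definition orthogonal_group :: "(real^2^2) monoid" where
  "orthogonal_group =
     \<lparr>carrier = {A. orthogonal_matrix A}, monoid.mult = (\<lambda>A B. A ** B), one = mat 1\<rparr>"

definition plane_rotation :: "real \<Rightarrow> real^2^2" where
  "plane_rotation \<theta> = vector [vector [cos \<theta>, - sin \<theta>], vector [sin \<theta>, cos \<theta>]]"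

definition C2_representation :: "'g monoid \<Rightarrow> ('g \<Rightarrow> real^2^2) \<Rightarrow> bool" where
  "C2_representation \<Gamma> \<tau> \<longleftrightarrow> \<tau> \<in> hom \<Gamma> orthogonal_group \<and> inj_on \<tau> (carrier \<Gamma>) \<and>
     \<tau> ` carrier \<Gamma> = {mat 1, plane_rotation pi}"

definition symmetric_framework ::
    "'g monoid \<Rightarrow> ('g \<Rightarrow> 'v \<Rightarrow> 'v) \<Rightarrow> ('g \<Rightarrow> real^2^2) \<Rightarrow> 'v set \<Rightarrow> 'v set set \<Rightarrow>
     ('v \<Rightarrow> real^2) \<Rightarrow> bool" where
  "symmetric_framework \<Gamma> \<phi> \<tau> V E p \<longleftrightarrow> framework V E p \<and>
     (\<forall>g\<in>carrier \<Gamma>. \<forall>v\<in>V. \<tau> g *v p v = p (\<phi> g v))"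

definition generic_framework ::
    "'g monoid \<Rightarrow> ('g \<Rightarrow> 'v \<Rightarrow> 'v) \<Rightarrow> ('g \<Rightarrow> real^2^2) \<Rightarrow> 'v set \<Rightarrow> 'v set set \<Rightarrow>
     ('v \<Rightarrow> real^2) \<Rightarrow> bool" where
  "generic_framework \<Gamma> \<phi> \<tau> V E p \<longleftrightarrow> symmetric_framework \<Gamma> \<phi> \<tau> V E p \<and>
     (\<forall>q. symmetric_framework \<Gamma> \<phi> \<tau> V E q \<longrightarrow> rigidity_rank E p \<ge> rigidity_rank E q)"


section \<open>Quotient gain graphs\<close>

definition fixed_orbits :: "'g monoid \<Rightarrow> ('g \<Rightarrow> 'v \<Rightarrow> 'v) \<Rightarrow> 'v set \<Rightarrow> 'v set set" where
  "fixed_orbits \<Gamma> \<phi> V = {orbit \<Gamma> \<phi> v | v. v \<in> V \<and> stabilizer \<Gamma> \<phi> v = carrier \<Gamma>}"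

definition free_orbits :: "'g monoid \<Rightarrow> ('g \<Rightarrow> 'v \<Rightarrow> 'v) \<Rightarrow> 'v set \<Rightarrow> 'v set set" where
  "free_orbits \<Gamma> \<phi> V = {orbit \<Gamma> \<phi> v | v. v \<in> V \<and> stabilizer \<Gamma> \<phi> v = {\<one>\<^bsub>\<Gamma>\<^esub>}}"

text \<open>
  The quotient multigraph, with the chosen orientation, is a digraph whose vertices and arcs
  are the vertex and edge orbits.  The orientation, the representatives \<open>r\<close> and the gains
  \<open>\<psi>\<close> of the edges at fixed vertices are arbitrary admissible choices.
\<close>

definition quotient_gain_graph ::
    "'g monoid \<Rightarrow> ('g \<Rightarrow> 'v \<Rightarrow> 'v) \<Rightarrow> 'v set \<Rightarrow> 'v set set \<Rightarrow> ('v set \<Rightarrow> 'v) \<Rightarrow>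
     ('v set, 'v set set) pre_digraph \<Rightarrow> ('v set set \<Rightarrow> 'g) \<Rightarrow> bool" where
  "quotient_gain_graph \<Gamma> \<phi> V E r G \<psi> \<longleftrightarrow>
     verts G = orbits \<Gamma> V \<phi> \<and>
     arcs G = orbits \<Gamma> E (\<lambda>g e. \<phi> g ` e) \<and>
     (\<forall>e\<in>arcs G. \<exists>u v. {u, v} \<in> e \<and> tail G e = orbit \<Gamma> \<phi> u \<and> head G e = orbit \<Gamma> \<phi> v) \<and>
     (\<forall>v\<in>verts G. r v \<in> v) \<and>
     (\<forall>e\<in>arcs G. \<psi> e \<in> carrier \<Gamma>) \<and>
     (\<forall>e\<in>arcs G. tail G e \<in> free_orbits \<Gamma> \<phi> V \<and> head G e \<in> free_orbits \<Gamma> \<phi> V \<longrightarrow>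
        {r (tail G e), \<phi> (\<psi> e) (r (head G e))} \<in> e)"

definition gain_framework ::
    "'g monoid \<Rightarrow> ('g \<Rightarrow> 'v \<Rightarrow> 'v) \<Rightarrow> 'v set \<Rightarrow> 'v set set \<Rightarrow> ('v \<Rightarrow> real^2) \<Rightarrow>
     ('v set, 'v set set) pre_digraph \<Rightarrow> ('v set set \<Rightarrow> 'g) \<Rightarrow> ('v set \<Rightarrow> real^2) \<Rightarrow> bool" where
  "gain_framework \<Gamma> \<phi> V E p' G \<psi> p \<longleftrightarrow>
     (\<exists>r. quotient_gain_graph \<Gamma> \<phi> V E r G \<psi> \<and> (\<forall>v\<in>verts G. p v = p' (r v)))"


section \<open>Gain sparsity\<close>

text \<open>
  Walks ignore the orientation: a step \<open>(e, True)\<close> traverses the arc \<open>e\<close> from tail to head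
  and \<open>(e, False)\<close> from head to tail.
\<close>

fun step_start :: "('a, 'b) pre_digraph \<Rightarrow> 'b \<times> bool \<Rightarrow> 'a" where
  "step_start G (e, d) = (if d then tail G e else head G e)"

fun step_end :: "('a, 'b) pre_digraph \<Rightarrow> 'b \<times> bool \<Rightarrow> 'a" where
  "step_end G (e, d) = (if d then head G e else tail G e)"

fun gain_walk :: "('a, 'b) pre_digraph \<Rightarrow> 'a \<Rightarrow> ('b \<times> bool) list \<Rightarrow> 'a \<Rightarrow> bool" where
  "gain_walk G u [] v \<longleftrightarrow> u \<in> verts G \<and> u = v"
| "gain_walk G u (s # w) v \<longleftrightarrow>
     fst s \<in> arcs G \<and> step_start G s = u \<and> gain_walk G (step_end G s) w v"

fun walk_gain :: "'g monoid \<Rightarrow> ('b \<Rightarrow> 'g) \<Rightarrow> ('b \<times> bool) list \<Rightarrow> 'g" where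
  "walk_gain \<Gamma> \<psi> [] = \<one>\<^bsub>\<Gamma>\<^esub>"
| "walk_gain \<Gamma> \<psi> ((e, d) # w) =
     (if d then \<psi> e else inv\<^bsub>\<Gamma>\<^esub> (\<psi> e)) \<otimes>\<^bsub>\<Gamma>\<^esub> walk_gain \<Gamma> \<psi> w"

text \<open>
  Loops are the cycles of length one, pairs of parallel edges those of length two; distinctness
  of the arcs excludes going back and forth along one edge.
\<close>

definition gain_cycle :: "('a, 'b) pre_digraph \<Rightarrow> ('b \<times> bool) list \<Rightarrow> bool" where
  "gain_cycle G w \<longleftrightarrow> w \<noteq> [] \<and> (\<exists>u. gain_walk G u w u) \<and>
     distinct (map (step_start G) w) \<and> distinct (map fst w)"

definition balanced ::
    "'g monoid \<Rightarrow> 'a set \<Rightarrow> ('b \<Rightarrow> 'g) \<Rightarrow> ('a, 'b) pre_digraph \<Rightarrow> bool" where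
  "balanced \<Gamma> V0 \<psi> H \<longleftrightarrow>
     (\<forall>w. gain_cycle (H \<restriction> (verts H - V0)) w \<longrightarrow> walk_gain \<Gamma> \<psi> w = \<one>\<^bsub>\<Gamma>\<^esub>)"

text \<open>
  \<open>V0\<close> and \<open>V1\<close> are the sets of fixed and of free vertices of the ambient gain graph;
  \<open>gain_sparse\<close> is \<open>(2, m, 3, l)\<close>-gain-sparsity.
\<close>

definition gain_sparse ::
    "'g monoid \<Rightarrow> 'a set \<Rightarrow> 'a set \<Rightarrow> int \<Rightarrow> int \<Rightarrow> ('a, 'b) pre_digraph \<Rightarrow> ('b \<Rightarrow> 'g) \<Rightarrow> bool" where
  "gain_sparse \<Gamma> V0 V1 m l G \<psi> \<longleftrightarrow>
     (\<forall>H. subgraph H G \<and> balanced \<Gamma> V0 \<psi> H \<and> arcs H \<noteq> {} \<longrightarrow>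
        int (card (arcs H)) \<le> 2 * int (card (verts H)) - 3) \<and>
     (\<forall>H. subgraph H G \<and> arcs H \<noteq> {} \<longrightarrow>
        int (card (arcs H)) \<le>
          2 * int (card (verts H \<inter> V1)) + m * int (card (verts H \<inter> V0)) - l)"

definition gain_tight ::
    "'g monoid \<Rightarrow> 'a set \<Rightarrow> 'a set \<Rightarrow> int \<Rightarrow> int \<Rightarrow> ('a, 'b) pre_digraph \<Rightarrow> ('b \<Rightarrow> 'g) \<Rightarrow> bool" where
  "gain_tight \<Gamma> V0 V1 m l G \<psi> \<longleftrightarrow> gain_sparse \<Gamma> V0 V1 m l G \<psi> \<and>
     int (card (arcs G)) =
       2 * int (card (verts G \<inter> V1)) + m * int (card (verts G \<inter> V0)) - l"

end

theory Submission
  imports Defs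
begin

text \<open>A motion of a framework with half-turn symmetry is the sum of a symmetric and an anti-symmetric
  one.  Each kind is determined by its values on vertex representatives, and each edge orbit \<open>(u, v)\<close>
  of sign \<open>s\<close> (the image of its gain in \<open>{1, -1}\<close>) gives one equation
  \<open>(p u - s p v) \<bullet> (m u - s m v) = 0\<close>, respectively \<open>(p u - s p v) \<bullet> (m u - m v) = 0\<close>.
  The trivial solutions are the rotations, of dimension one, respectively the translations, of
  dimension two; this is the origin of the two counts.  A set of equations can only be independent if
  it is sparse, since subgraphs have at least their trivial motions and balanced subgraphs have those
  of a plane framework.  Conversely, a sparse signed graph is realised independently by induction: take
  away a vertex of degree at most three and realise the rest generically.  If the vertex cannot be put
  back, each two of its three arms are parts of one rigid body in the remaining graph, and the
  subgraphs responsible for this glue to one violating sparsity.  Independence is a generic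
  property, so that one placement serves both counts, and rigidity only depends on the rank of the
  rigidity matrix.\<close>

section \<open>Homogeneous systems and linear pencils\<close>

text \<open>The converse is the hard direction, and it argues with motions. The induction hypothesis
  is strong: a single placement of the smaller vertex set is independent for every sparse graph on
  it (\<open>good\<close>). Hence an edge that no motion of the remaining graph violates cannot be
  added sparsely, and the subgraph that blocks it is tight; tightness in turn makes all its motions
  trivial. When blocks are glued, sparsity of the whole graph leaves a nonzero motion even after the
  glued body has been pinned down, which is absurd. The obstacle is a vertex whose three arms end at
  \<open>q\<close>, \<open>-q\<close> and the origin: two parallel edges of opposite sign, and a
  loop or an edge to the fixed vertex. These points are collinear, so the three bodies need not form
  one. In the symmetric case the loop at the parallel neighbour replaces the missing bar. In the
  anti-symmetric case it suffices that this neighbour moves relative to the fixed vertex. The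
  argument for this breaks down if the neighbour is itself joined to the fixed vertex; then both
  vertices are removed together, which a degree count makes possible.\<close>

lemma homogeneous_system:
  fixes a :: "'e \<Rightarrow> 'c \<Rightarrow> real"
  assumes "finite E" "finite C" "card E < card C"
  shows "\<exists>x. (\<exists>c\<in>C. x c \<noteq> 0) \<and> (\<forall>e\<in>E. (\<Sum>c\<in>C. a e c * x c) = 0)"
  using assms
proof (induction E arbitrary: C a rule: finite_induct)
  case empty
  then have "C \<noteq> {}" by auto
  then show ?case by (intro exI[of _ "\<lambda>_. 1"]) auto
next
  case (insert e E)
  show ?case
  proof (cases "\<forall>c\<in>C. a e c = 0")
    case True
    obtain x where "\<exists>c\<in>C. x c \<noteq> 0" "\<forall>e\<in>E. (\<Sum>c\<in>C. a e c * x c) = 0"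
      using insert.IH[of C a] insert.prems insert.hyps by auto
    with True show ?thesis by (intro exI[of _ x]) auto
  next
    case False
    then obtain d where d: "d \<in> C" "a e d \<noteq> 0" by blast
    define D where "D = C - {d}"
    \<comment> \<open>\<open>b\<close> is the system that remains once equation \<open>e\<close> has
      been solved for the unknown \<open>d\<close>; \<open>y\<close> below restores that
      unknown.\<close>
    define b where "b = (\<lambda>f c. a f c - a f d * a e c / a e d)"
    have D: "finite D" "card E < card D" "C = insert d D" "d \<notin> D"
      using insert.prems insert.hyps d by (auto simp: D_def card_Diff_singleton)
    obtain x where x: "\<exists>c\<in>D. x c \<noteq> 0" "\<forall>e\<in>E. (\<Sum>c\<in>D. b e c * x c) = 0"
      using insert.IH[of D b] D by auto
    define y where "y = x(d := - (\<Sum>c\<in>D. a e c * x c) / a e d)"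
    have sD: "(\<Sum>c\<in>D. h c * y c) = (\<Sum>c\<in>D. h c * x c)" for h
      using D by (intro sum.cong) (auto simp: y_def)
    have s: "(\<Sum>c\<in>C. h c * y c) = (\<Sum>c\<in>D. h c * x c) - h d * (\<Sum>c\<in>D. a e c * x c) / a e d" for h
      using D by (simp add: sD) (simp add: y_def)
    have 1: "(\<Sum>c\<in>C. a e c * y c) = 0" using s[of "a e"] d by simp
    have 2: "(\<Sum>c\<in>C. a f c * y c) = 0" if "f \<in> E" for f
    proof -
      have "(\<Sum>c\<in>D. b f c * x c) = (\<Sum>c\<in>D. a f c * x c) - a f d * (\<Sum>c\<in>D. a e c * x c) / a e d"
        by (simp add: b_def algebra_simps sum_subtractf sum_distrib_left sum_divide_distrib)
      with x that s[of "a f"] show ?thesis by simp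
    qed
    have "\<exists>c\<in>C. y c \<noteq> 0" using x D by (auto simp: y_def)
    with 1 2 show ?thesis by (intro exI[of _ y]) auto
  qed
qed

text \<open>Parameters of singular members of a pencil are reciprocals of eigenvalues, and eigenvectors
  for distinct eigenvalues are independent.\<close>

lemma pencil_kernels_independent:
  fixes B :: "'i \<Rightarrow> 'i \<Rightarrow> real" and W :: "real \<Rightarrow> 'i \<Rightarrow> real"
  assumes "finite T"
    and "\<And>t i. t \<in> T \<Longrightarrow> i \<in> I \<Longrightarrow> W t i + t * (\<Sum>j\<in>I. B i j * W t j) = 0"
    and "\<And>t. t \<in> T \<Longrightarrow> \<exists>i\<in>I. W t i \<noteq> 0"
    and "\<And>i. i \<in> I \<Longrightarrow> (\<Sum>t\<in>T. y t * W t i) = 0"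
  shows "\<forall>t\<in>T. y t = 0"
  using assms
proof (induction T arbitrary: y rule: finite_induct)
  case empty then show ?case by simp
next
  case (insert s T)
  have nz: "t \<noteq> 0" if "t \<in> insert s T" for t
    using insert.prems(1)[of t] insert.prems(2)[OF that] that by auto
  have BW: "(\<Sum>j\<in>I. B i j * W t j) = - W t i / t" if "t \<in> insert s T" "i \<in> I" for t i
    using insert.prems(1)[OF that] nz[OF that(1)] by (simp add: field_simps)
  \<comment> \<open>The relation divided by \<open>s\<close> is added to its image under
    \<open>B\<close>. Each coefficient \<open>y t\<close> turns into
    \<open>y t * (1 / s - 1 / t)\<close>, so the term of \<open>s\<close> drops out and the
    induction hypothesis applies to \<open>T\<close>.\<close>
  have "(\<Sum>t\<in>T. (y t * (1 / s - 1 / t)) * W t i) = 0" if i: "i \<in> I" for i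
  proof -
    have "(\<Sum>j\<in>I. B i j * (\<Sum>t\<in>insert s T. y t * W t j)) = 0"
      using insert.prems(3) by simp
    then have "(\<Sum>t\<in>insert s T. y t * (\<Sum>j\<in>I. B i j * W t j)) = 0"
      by (subst (asm) sum_distrib_left, subst (asm) sum.swap) (simp add: sum_distrib_left mult_ac)
    then have "(\<Sum>t\<in>insert s T. y t * (- W t i / t)) = 0"
      using BW[OF _ i] by simp
    moreover have "(\<Sum>t\<in>insert s T. y t * W t i) / s = 0" using insert.prems(3)[OF i] by simp
    ultimately have "(\<Sum>t\<in>insert s T. y t * W t i / s + y t * (- W t i / t)) = 0"
      unfolding sum.distrib by (simp add: sum_divide_distrib)
    moreover have "y t * W t i / s + y t * (- W t i / t) = (y t * (1 / s - 1 / t)) * W t i" for t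
      by (simp add: algebra_simps)
    ultimately show ?thesis using insert.hyps nz[of s] by simp
  qed
  then have "\<forall>t\<in>T. y t * (1 / s - 1 / t) = 0"
    using insert.prems(1,2) by (intro insert.IH) auto
  then have T0: "\<forall>t\<in>T. y t = 0" using insert.hyps nz by auto
  obtain i where "i \<in> I" "W s i \<noteq> 0" using insert.prems(2)[of s] by auto
  with insert.prems(3)[of i] T0 insert.hyps have "y s = 0" by simp
  with T0 show ?case by simp
qed

text \<open>The pencil \<open>1 + t B\<close> stands in for a determinant polynomial in
  \<open>t\<close>: kernel vectors for \<open>card I + 1\<close> singular parameters would be
  linearly independent in a space of dimension \<open>card I\<close>.\<close>

lemma finite_singular_pencil:
  fixes B :: "'i \<Rightarrow> 'i \<Rightarrow> real"
  assumes I: "finite I"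
  shows "finite {t. \<exists>w. (\<exists>i\<in>I. w i \<noteq> 0) \<and> (\<forall>i\<in>I. w i + t * (\<Sum>j\<in>I. B i j * w j) = 0)}"
    (is "finite ?S")
proof (rule ccontr)
  assume "infinite ?S"
  then obtain T where T: "T \<subseteq> ?S" "finite T" "card T = Suc (card I)"
    using infinite_arbitrarily_large by blast
  then have "\<forall>t\<in>T. \<exists>w. (\<exists>i\<in>I. w i \<noteq> 0) \<and> (\<forall>i\<in>I. w i + t * (\<Sum>j\<in>I. B i j * w j) = 0)"
    by blast
  then obtain W where W: "\<And>t. t \<in> T \<Longrightarrow> (\<exists>i\<in>I. W t i \<noteq> 0)"
    "\<And>t i. t \<in> T \<Longrightarrow> i \<in> I \<Longrightarrow> W t i + t * (\<Sum>j\<in>I. B i j * W t j) = 0"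
    by metis
  obtain y where y: "\<exists>t\<in>T. y t \<noteq> 0" "\<forall>i\<in>I. (\<Sum>t\<in>T. W t i * y t) = 0"
    using homogeneous_system[OF I T(2), of "\<lambda>i t. W t i"] T(3) by auto
  have "\<forall>t\<in>T. y t = 0"
    by (rule pencil_kernels_independent[OF T(2) W(2) W(1)]) (use y(2) in \<open>simp_all add: mult.commute\<close>)
  with y(1) show False by blast
qed

lemma card_times_two: "card (X \<times> (UNIV :: 2 set)) = 2 * card X"
  by (simp add: card_cartesian_product)

lemma homogeneous_system_plane:
  fixes h :: "'e \<Rightarrow> 'a \<Rightarrow> real^2"
  assumes "finite E" "finite X" "card E < 2 * card X"
  shows "\<exists>m. (\<exists>u\<in>X. m u \<noteq> 0) \<and> (\<forall>e\<in>E. (\<Sum>u\<in>X. h e u \<bullet> m u) = 0)"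
proof -
  obtain x where x: "\<exists>c\<in>X \<times> (UNIV :: 2 set). x c \<noteq> 0"
    "\<forall>e\<in>E. (\<Sum>c\<in>X \<times> (UNIV :: 2 set). (h e (fst c) $ snd c) * x c) = 0"
    using homogeneous_system[of E "X \<times> (UNIV :: 2 set)" "\<lambda>e c. h e (fst c) $ snd c"] assms
    by (auto simp: card_times_two)
  define m where "m = (\<lambda>u. (\<chi> i. x (u, i)) :: real^2)"
  have "(\<Sum>u\<in>X. h e u \<bullet> m u) = 0" if "e \<in> E" for e
    using bspec[OF x(2) that]
    by (simp add: inner_vec_def m_def sum.cartesian_product case_prod_unfold)
  moreover have "\<exists>u\<in>X. m u \<noteq> 0" using x(1) by (auto simp: m_def vec_eq_iff)
  ultimately show ?thesis by blast
qed

section \<open>Rows of signed graphs\<close>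

text \<open>The third component of an edge is its sign.  The flag \<open>A\<close> is \<open>False\<close> for symmetric and \<open>True\<close>
  for anti-symmetric motions.\<close>

type_synonym 'a sedge = "'a \<times> 'a \<times> real"

text \<open>The copy of \<open>v\<close> reached by a gain of sign \<open>s\<close> lies at
  \<open>s\<close> times the position of \<open>v\<close>. Its velocity is \<open>s\<close> times
  that of \<open>v\<close> in a symmetric motion and the same in an anti-symmetric one.\<close>

definition chi :: "bool \<Rightarrow> real \<Rightarrow> real" where
  "chi A s = (if A then 1 else s)"

fun erow :: "bool \<Rightarrow> ('a \<Rightarrow> real^2) \<Rightarrow> ('a \<Rightarrow> real^2) \<Rightarrow> 'a sedge \<Rightarrow> real" where
  "erow A p m (u, v, s) = (p u - s *\<^sub>R p v) \<bullet> (m u - chi A s *\<^sub>R m v)"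

fun ends :: "'a sedge \<Rightarrow> 'a set" where
  "ends (u, v, s) = {u, v}"

definition VF :: "'a sedge set \<Rightarrow> 'a set" where
  "VF F = (\<Union>e\<in>F. ends e)"

text \<open>The coefficient vector of the functional \<open>erow\<close>. Two conditional terms are
  added, instead of being separated by cases, so that both contributions of a loop accumulate at its
  vertex.\<close>

fun erowv :: "bool \<Rightarrow> ('a \<Rightarrow> real^2) \<Rightarrow> 'a sedge \<Rightarrow> 'a \<Rightarrow> real^2" where
  "erowv A p (u, v, s) = (\<lambda>w. (if w = u then p u - s *\<^sub>R p v else 0) +
     (if w = v then - chi A s *\<^sub>R (p u - s *\<^sub>R p v) else 0))"

definition indep :: "bool \<Rightarrow> ('a \<Rightarrow> real^2) \<Rightarrow> 'a sedge set \<Rightarrow> bool" where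
  "indep A p F \<longleftrightarrow> (\<forall>w. (\<forall>m. (\<Sum>e\<in>F. w e * erow A p m e) = 0) \<longrightarrow> (\<forall>e\<in>F. w e = 0))"

lemma finite_ends [simp]: "finite (ends e)"
  by (cases e) auto

lemma finite_VF [simp]: "finite F \<Longrightarrow> finite (VF F)"
  by (simp add: VF_def)

lemma VF_mono: "F \<subseteq> G \<Longrightarrow> VF F \<subseteq> VF G"
  by (auto simp: VF_def)

lemma VF_Un [simp]: "VF (F \<union> G) = VF F \<union> VF G"
  by (auto simp: VF_def)

lemma VF_insert [simp]: "VF (insert e F) = ends e \<union> VF F"
  by (auto simp: VF_def)

lemma VF_empty [simp]: "VF {} = {}"
  by (auto simp: VF_def)

lemma ends_subset_VF: "e \<in> F \<Longrightarrow> ends e \<subseteq> VF F"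
  by (auto simp: VF_def)

lemma erow_eq_sum:
  assumes "finite X" "ends e \<subseteq> X"
  shows "erow A p m e = (\<Sum>w\<in>X. erowv A p e w \<bullet> m w)"
proof -
  obtain u v s where e: "e = (u, v, s)" by (cases e)
  have "(\<Sum>w\<in>X. erowv A p e w \<bullet> m w) =
      (\<Sum>w\<in>X. (if w = u then (p u - s *\<^sub>R p v) \<bullet> m w else 0) +
        (if w = v then (- chi A s *\<^sub>R (p u - s *\<^sub>R p v)) \<bullet> m w else 0))"
    unfolding e by (intro sum.cong) (auto simp: inner_add_left)
  also have "\<dots> = (p u - s *\<^sub>R p v) \<bullet> m u + (- chi A s *\<^sub>R (p u - s *\<^sub>R p v)) \<bullet> m v"
    using assms unfolding e by (simp add: sum.distrib)
  finally show ?thesis by (simp add: e inner_diff_right)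
qed

lemma erow_cong:
  "(\<And>u. u \<in> ends e \<Longrightarrow> m u = m' u) \<Longrightarrow> erow A p m e = erow A p m' e"
  by (cases e) simp

lemma erow_cong_pos:
  "(\<And>u. u \<in> ends e \<Longrightarrow> p u = p' u) \<Longrightarrow> erow A p m e = erow A p' m e"
  by (cases e) simp

lemma erow_zero [simp]: "erow A p (\<lambda>u. 0) e = 0"
  by (cases e) simp

lemma erow_add: "erow A p (\<lambda>u. m u + m' u) e = erow A p m e + erow A p m' e"
  by (cases e) (simp add: inner_add_right inner_diff_right scaleR_add_right)

lemma erow_scale: "erow A p (\<lambda>u. c *\<^sub>R m u) e = c * erow A p m e"
  by (cases e) (simp add: inner_diff_right algebra_simps)

lemma erow_sum: "erow A p (\<lambda>u. \<Sum>j\<in>J. c j *\<^sub>R m j u) e = (\<Sum>j\<in>J. c j * erow A p (m j) e)"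
  by (induction J rule: infinite_finite_induct) (simp_all add: erow_add erow_scale)

text \<open>Rows are affine in the parameter of a line of placements. This is what turns
  independence along a line into a question about a linear pencil.\<close>

lemma erow_line: "erow A (\<lambda>u. p u + t *\<^sub>R (q u - p u)) m e =
    erow A p m e + t * (erow A q m e - erow A p m e)"
  by (cases e) (simp add: inner_diff_right inner_diff_left inner_add_left algebra_simps)

lemma indep_empty [simp]: "indep A p {}"
  by (simp add: indep_def)

lemma indepI:
  assumes "\<And>w e. (\<And>m. (\<Sum>e\<in>F. w e * erow A p m e) = 0) \<Longrightarrow> e \<in> F \<Longrightarrow> w e = 0"
  shows "indep A p F"
  using assms unfolding indep_def by metis

lemma indepD:
  "indep A p F \<Longrightarrow> (\<And>m. (\<Sum>e\<in>F. w e * erow A p m e) = 0) \<Longrightarrow> e \<in> F \<Longrightarrow> w e = 0"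
  unfolding indep_def by metis

lemma indep_subset:
  assumes "indep A p F" "G \<subseteq> F" "finite F"
  shows "indep A p G"
proof (rule indepI)
  fix w e assume w: "\<And>m. (\<Sum>e\<in>G. w e * erow A p m e) = 0" and e: "e \<in> G"
  define w' where "w' = (\<lambda>e. if e \<in> G then w e else 0)"
  have "(\<Sum>e\<in>F. w' e * erow A p m e) = 0" for m
  proof -
    have "(\<Sum>e\<in>F. w' e * erow A p m e) = (\<Sum>e\<in>G. w' e * erow A p m e)"
      using assms by (intro sum.mono_neutral_right) (auto simp: w'_def)
    then show ?thesis using w by (simp add: w'_def)
  qed
  then have "w' e = 0" using indepD[OF assms(1)] e assms(2) by blast
  then show "w e = 0" using e by (simp add: w'_def)
qed

lemma indep_cong_pos:
  assumes "\<And>u. u \<in> VF F \<Longrightarrow> p u = p' u"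
  shows "indep A p F \<longleftrightarrow> indep A p' F"
proof -
  have "erow A p m e = erow A p' m e" if "e \<in> F" for m e
    using that assms by (intro erow_cong_pos) (auto simp: VF_def)
  then show ?thesis unfolding indep_def by simp
qed

text \<open>A relation between rows and motions has to split, since rows and motions are orthogonal.\<close>

lemma motions_dependent:
  fixes \<mu> :: "nat \<Rightarrow> 'a \<Rightarrow> real^2"
  assumes F: "finite F" "indep A p F" and X: "finite X" "VF F \<subseteq> X"
    and mu: "\<And>j e. j < k \<Longrightarrow> e \<in> F \<Longrightarrow> erow A p (\<mu> j) e = 0"
    and card: "2 * card X < card F + k"
  shows "\<exists>y. (\<exists>j<k. y j \<noteq> 0) \<and> (\<forall>u\<in>X. (\<Sum>j<k. y j *\<^sub>R \<mu> j u) = 0)"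
proof -
  have ends: "ends e \<subseteq> X" if "e \<in> F" for e using that X by (auto simp: VF_def)
  \<comment> \<open>Rows and motions are both vectors with \<open>2 * card X\<close> coordinates and
    together outnumber these; \<open>x\<close> holds the coefficients of a relation between them,
    \<open>w\<close> on the rows and \<open>y\<close> on the motions.\<close>
  define h where "h = (\<lambda>(u, i :: 2) (c :: 'a sedge + nat).
    case c of Inl e \<Rightarrow> erowv A p e u $ i | Inr j \<Rightarrow> \<mu> j u $ i)"
  obtain x where x: "\<exists>c\<in>F <+> {..<k}. x c \<noteq> 0"
      "\<forall>ui\<in>X \<times> UNIV. (\<Sum>c\<in>F <+> {..<k}. h ui c * x c) = 0"
    using homogeneous_system[of "X \<times> (UNIV :: 2 set)" "F <+> {..<k}" h] F X card
    by (auto simp: card_times_two card_Plus)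
  define w where "w = (\<lambda>e. x (Inl e))"
  define y where "y = (\<lambda>j. x (Inr j))"
  define v where "v = (\<lambda>u. \<Sum>j<k. y j *\<^sub>R \<mu> j u)"
  have sum0: "(\<Sum>e\<in>F. w e *\<^sub>R erowv A p e u) + v u = 0" if "u \<in> X" for u
  proof (subst vec_eq_iff, intro allI)
    fix i
    have "(\<Sum>c\<in>F <+> {..<k}. h (u, i) c * x c) = 0" using x(2) that by auto
    then show "((\<Sum>e\<in>F. w e *\<^sub>R erowv A p e u) + v u) $ i = (0 :: real^2) $ i"
      using F by (simp add: sum.Plus h_def w_def y_def v_def sum_component mult.commute)
  qed
  have neg: "(\<Sum>e\<in>F. w e *\<^sub>R erowv A p e u) = - v u" if "u \<in> X" for u
    using sum0[OF that] by (simp only: eq_neg_iff_add_eq_0)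
  have comb: "(\<Sum>e\<in>F. w e * erow A p m e) = - (\<Sum>u\<in>X. v u \<bullet> m u)" for m
  proof -
    have "(\<Sum>e\<in>F. w e * erow A p m e) = (\<Sum>e\<in>F. \<Sum>u\<in>X. (w e *\<^sub>R erowv A p e u) \<bullet> m u)"
      using ends X by (intro sum.cong) (auto simp: erow_eq_sum[of X] sum_distrib_left)
    also have "\<dots> = (\<Sum>u\<in>X. (\<Sum>e\<in>F. w e *\<^sub>R erowv A p e u) \<bullet> m u)"
      by (subst sum.swap) (simp add: inner_sum_left)
    also have "\<dots> = (\<Sum>u\<in>X. - v u \<bullet> m u)"
      by (intro sum.cong refl) (simp only: neg)
    finally show ?thesis by (simp add: sum_negf)
  qed
  \<comment> \<open>\<open>v\<close> is a motion, being a combination of motions, and also minus a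
    combination of rows; hence it is orthogonal to itself.\<close>
  have "erow A p v e = 0" if "e \<in> F" for e
    using mu that by (simp add: v_def erow_sum)
  with comb[of v] have "(\<Sum>u\<in>X. v u \<bullet> v u) = 0" by simp
  then have v0: "v u = 0" if "u \<in> X" for u
    using X that by (subst (asm) sum_nonneg_eq_0_iff) auto
  have "\<exists>j<k. y j \<noteq> 0"
  proof (rule ccontr)
    assume "\<not> (\<exists>j<k. y j \<noteq> 0)"
    with x(1) obtain e where "e \<in> F" "w e \<noteq> 0" by (auto simp: w_def y_def)
    moreover have "(\<Sum>e\<in>F. w e * erow A p m e) = 0" for m using comb v0 by simp
    ultimately show False using indepD[OF F(2)] by blast
  qed
  with v0 show ?thesis unfolding v_def by blast
qed

text \<open>The motion is sought in the span of the rows, where the rows other than \<open>e\<close>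
  give one equation fewer than there are unknowns. If the solution annihilated \<open>e\<close> too,
  it would be orthogonal to the span in which it lies, hence zero, against independence.\<close>

lemma dual_motion:
  assumes F: "finite F" "indep A p F" and e: "e \<in> F"
  shows "\<exists>m. erow A p m e = 1 \<and> (\<forall>f\<in>F - {e}. erow A p m f = 0)"
proof -
  have X: "finite (VF F)" using F by simp
  have "card (F - {e}) < card F" by (rule card_Diff1_less[OF F(1) e])
  then obtain y where y: "\<exists>f\<in>F. y f \<noteq> 0"
      "\<forall>g\<in>F - {e}. (\<Sum>f\<in>F. erow A p (erowv A p f) g * y f) = 0"
    using homogeneous_system[OF _ F(1), of "F - {e}" "\<lambda>g f. erow A p (erowv A p f) g"] F(1) by blast
  define m where "m = (\<lambda>u. \<Sum>f\<in>F. y f *\<^sub>R erowv A p f u)"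
  have m: "erow A p m g = (\<Sum>f\<in>F. erow A p (erowv A p f) g * y f)" for g
    by (simp only: m_def erow_sum mult.commute)
  have m0: "erow A p m g = 0" if "g \<in> F - {e}" for g using m y(2) that by simp
  have comb: "(\<Sum>f\<in>F. y f * erow A p m' f) = (\<Sum>u\<in>VF F. m u \<bullet> m' u)" for m'
  proof -
    have "(\<Sum>f\<in>F. y f * erow A p m' f) = (\<Sum>f\<in>F. \<Sum>u\<in>VF F. (y f *\<^sub>R erowv A p f u) \<bullet> m' u)"
      using X by (intro sum.cong) (auto simp: erow_eq_sum[OF X ends_subset_VF] sum_distrib_left)
    then show ?thesis by (subst (asm) sum.swap) (simp add: m_def inner_sum_left)
  qed
  have "erow A p m e \<noteq> 0"
  proof
    assume "erow A p m e = 0"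
    then have "erow A p m f = 0" if "f \<in> F" for f using m0 that by (cases "f = e") auto
    with comb[of m] have "(\<Sum>u\<in>VF F. m u \<bullet> m u) = 0" by simp
    then have "m u = 0" if "u \<in> VF F" for u
      using X that by (subst (asm) sum_nonneg_eq_0_iff) auto
    then have "(\<Sum>f\<in>F. y f * erow A p m' f) = 0" for m' using comb by simp
    then have "\<forall>f\<in>F. y f = 0" using indepD[OF F(2), of y] by blast
    with y(1) show False by blast
  qed
  then show ?thesis
    using m0 by (intro exI[of _ "\<lambda>u. (1 / erow A p m e) *\<^sub>R m u"]) (auto simp: erow_scale)
qed

lemma dependent_row_vanishes:
  assumes F: "finite F" "indep A p F" and "\<not> indep A p (insert e F)"
    and m: "\<And>f. f \<in> F \<Longrightarrow> erow A p m f = 0"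
  shows "erow A p m e = 0"
proof -
  have e: "e \<notin> F" using assms by (auto simp: insert_absorb)
  obtain w g where w: "\<And>m. (\<Sum>f\<in>insert e F. w f * erow A p m f) = 0"
      and g: "g \<in> insert e F" "w g \<noteq> 0"
    using assms(3) unfolding indep_def by blast
  have w': "w e * erow A p m e + (\<Sum>f\<in>F. w f * erow A p m f) = 0" for m
    using w[of m] F e by simp
  have "w e \<noteq> 0"
  proof
    assume "w e = 0"
    with w' have "\<And>m. (\<Sum>f\<in>F. w f * erow A p m f) = 0" by simp
    then have "\<forall>f\<in>F. w f = 0" using indepD[OF F(2)] by blast
    with g \<open>w e = 0\<close> show False by auto
  qed
  with w'[of m] m show ?thesis by simp
qed

lemma indep_insertI:
  assumes F: "finite F" "indep A p F"
    and m: "\<And>f. f \<in> F \<Longrightarrow> erow A p m f = 0" "erow A p m e \<noteq> 0"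
  shows "indep A p (insert e F)"
proof (rule ccontr)
  assume "\<not> indep A p (insert e F)"
  from dependent_row_vanishes[OF F this m(1)] m(2) show False by simp
qed

lemma ex_maximal_indep:
  assumes "finite T"
  shows "\<exists>B\<subseteq>T. indep A p B \<and>
    (\<forall>m. (\<forall>f\<in>B. erow A p m f = 0) \<longrightarrow> (\<forall>f\<in>T. erow A p m f = 0))"
proof -
  let ?P = "\<lambda>B. B \<subseteq> T \<and> indep A p B"
  have "?P {}" by simp
  moreover have "\<forall>B. ?P B \<longrightarrow> card B \<le> card T" using assms by (simp add: card_mono)
  ultimately obtain B where B: "?P B" and max: "\<And>C. ?P C \<Longrightarrow> card C \<le> card B"
    using ex_has_greatest_nat[of ?P "{}" card "Suc (card T)"] by (auto simp: less_Suc_eq_le)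
  have fB: "finite B" using B assms finite_subset by blast
  have "erow A p m f = 0" if "\<forall>f\<in>B. erow A p m f = 0" "f \<in> T" for m f
  proof (rule ccontr)
    assume r: "erow A p m f \<noteq> 0"
    then have nin: "f \<notin> B" using that(1) by blast
    have "indep A p (insert f B)"
      using B that(1) r by (intro indep_insertI[OF fB]) auto
    then have "card (insert f B) \<le> card B" using B that(2) by (intro max) simp
    then show False using nin fB by simp
  qed
  with B show ?thesis by blast
qed

section \<open>Genericity along lines\<close>

text \<open>A substitute for Zariski openness that only speaks of lines: it suffices for realising
  several properties at once, and it can be verified by counting singular parameters or roots of a
  quadratic.\<close>

definition line_generic :: "(('a \<Rightarrow> real^2) \<Rightarrow> bool) \<Rightarrow> bool" where
  "line_generic Q \<longleftrightarrow> (\<forall>p q. Q p \<longrightarrow> finite {t. \<not> Q (\<lambda>u. p u + t *\<^sub>R (q u - p u))})"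

text \<open>Evaluated at the dual motions for \<open>p\<close>, the rows form the identity matrix at
  \<open>t = 0\<close> and \<open>1 + t B\<close> along the line. A stress at \<open>t\<close> is a
  kernel vector of this matrix, so \<open>t\<close> is one of finitely many singular
  parameters.\<close>

lemma line_generic_indep: "finite F \<Longrightarrow> line_generic (\<lambda>p. indep A p F)"
  unfolding line_generic_def
proof (intro allI impI)
  fix p q :: "'a \<Rightarrow> real^2" assume F: "finite F" and ind: "indep A p F"
  have "\<forall>e\<in>F. \<exists>m. erow A p m e = 1 \<and> (\<forall>f\<in>F - {e}. erow A p m f = 0)"
    using dual_motion[OF F ind] by blast
  then obtain D where D: "\<And>e. e \<in> F \<Longrightarrow> erow A p (D e) e = 1"
      "\<And>e f. e \<in> F \<Longrightarrow> f \<in> F \<Longrightarrow> f \<noteq> e \<Longrightarrow> erow A p (D e) f = 0"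
    by (metis Diff_iff empty_iff insert_iff)
  define B where "B = (\<lambda>e f. erow A q (D e) f - erow A p (D e) f)"
  let ?l = "\<lambda>t u. p u + t *\<^sub>R (q u - p u)"
  have "{t. \<not> indep A (?l t) F} \<subseteq>
    {t. \<exists>w. (\<exists>i\<in>F. w i \<noteq> 0) \<and> (\<forall>i\<in>F. w i + t * (\<Sum>j\<in>F. B i j * w j) = 0)}"
  proof
    fix t assume "t \<in> {t. \<not> indep A (?l t) F}"
    then obtain w where w: "\<And>m. (\<Sum>e\<in>F. w e * erow A (?l t) m e) = 0" "\<exists>e\<in>F. w e \<noteq> 0"
      unfolding indep_def by auto
    have "w e + t * (\<Sum>j\<in>F. B e j * w j) = 0" if e: "e \<in> F" for e
    proof -
      have "(\<Sum>f\<in>F. w f * erow A p (D e) f) = (\<Sum>f\<in>F. if f = e then w e else 0)"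
        using D e by (intro sum.cong) auto
      then have "(\<Sum>f\<in>F. w f * erow A p (D e) f) = w e" using F e by simp
      moreover have "(\<Sum>f\<in>F. w f * erow A p (D e) f) + t * (\<Sum>f\<in>F. B e f * w f) = 0"
        using w(1)[of "D e"] unfolding erow_line
        by (simp add: B_def sum_distrib_left sum.distrib[symmetric] algebra_simps)
      ultimately show ?thesis by simp
    qed
    with w(2) show "t \<in> {t. \<exists>w. (\<exists>i\<in>F. w i \<noteq> 0) \<and> (\<forall>i\<in>F. w i + t * (\<Sum>j\<in>F. B i j * w j) = 0)}"
      by blast
  qed
  then show "finite {t. \<not> indep A (?l t) F}"
    using finite_singular_pencil[OF F] finite_subset by blast
qed

text \<open>On the line from a placement for the earlier properties to one for the new property,
  each property fails at finitely many points only. Vertices of \<open>Z\<close> are at the origin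
  at both ends and hence on the whole line.\<close>

lemma line_generic_common:
  assumes "finite I"
    and "\<And>i. i \<in> I \<Longrightarrow> line_generic (Q i)"
    and "\<And>i. i \<in> I \<Longrightarrow> \<exists>p. (\<forall>z\<in>Z. p z = 0) \<and> Q i p"
  shows "\<exists>p. (\<forall>z\<in>Z. p z = (0 :: real^2)) \<and> (\<forall>i\<in>I. Q i p)"
  using assms
proof (induction I rule: finite_induct)
  case empty
  show ?case by (intro exI[of _ "\<lambda>_. 0"]) auto
next
  case (insert i I)
  obtain p where p: "\<forall>z\<in>Z. p z = 0" "\<forall>j\<in>I. Q j p"
    using insert.IH[OF insert.prems] by (meson insertI2)
  obtain q where q: "\<forall>z\<in>Z. q z = 0" "Q i q" using insert.prems(2)[OF insertI1] by blast
  let ?l = "\<lambda>p q t u. p u + t *\<^sub>R (q u - p u)"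
  have "finite {t. \<not> Q j (?l p q t)}" if "j \<in> I" for j
    using insert.prems(1)[of j] that p unfolding line_generic_def by blast
  then have fin1: "finite (\<Union>j\<in>I. {t. \<not> Q j (?l p q t)})" using insert.hyps by blast
  have "finite {t. \<not> Q i (?l q p t)}"
    using insert.prems(1)[of i] q unfolding line_generic_def by blast
  \<comment> \<open>The new property is known at the end \<open>q\<close> of the line, so its
    exceptional parameters are counted from \<open>q\<close> and reflected by
    \<open>1 - t\<close>.\<close>
  then have "finite ((\<lambda>t. 1 - t) ` {t. \<not> Q i (?l q p t)})" by blast
  moreover have "?l q p (1 - t) = ?l p q t" for t by (auto simp: algebra_simps)
  then have "{t. \<not> Q i (?l p q t)} \<subseteq> (\<lambda>t. 1 - t) ` {t. \<not> Q i (?l q p t)}"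
    by (auto intro!: image_eqI[of _ _ "1 - _"])
  ultimately have "finite {t. \<not> Q i (?l p q t)}" using finite_subset by blast
  with fin1 have "finite ({t. \<not> Q i (?l p q t)} \<union> (\<Union>j\<in>I. {t. \<not> Q j (?l p q t)}))" by blast
  then obtain t where "t \<notin> {t. \<not> Q i (?l p q t)} \<union> (\<Union>j\<in>I. {t. \<not> Q j (?l p q t)})"
    using ex_new_if_finite infinite_UNIV_char_0 by blast
  then have "\<forall>j\<in>insert i I. Q j (?l p q t)" by blast
  moreover have "\<forall>z\<in>Z. ?l p q t z = 0" using p q by simp
  ultimately show ?case by (intro exI[of _ "?l p q t"] conjI)
qed

section \<open>Plane geometry: determinants, the quarter turn, and pinned motions\<close>

definition det2 :: "real^2 \<Rightarrow> real^2 \<Rightarrow> real" where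
  "det2 x y = x $ 1 * y $ 2 - x $ 2 * y $ 1"

lemma finite_quadratic_roots:
  fixes a b c :: real
  assumes "a \<noteq> 0 \<or> b \<noteq> 0 \<or> c \<noteq> 0"
  shows "finite {t. a + t * b + t\<^sup>2 * c = 0}"
proof -
  have "finite {t. poly [:a, b, c:] t = 0}"
    using assms by (intro poly_roots_finite) auto
  then show ?thesis by (simp add: power2_eq_square algebra_simps)
qed

lemma line_generic_combination: "line_generic (\<lambda>p. a *\<^sub>R p u - b *\<^sub>R p v \<noteq> 0)"
  unfolding line_generic_def
proof (intro allI impI)
  fix p q :: "'a \<Rightarrow> real^2"
  let ?f = "\<lambda>p. a *\<^sub>R p u - b *\<^sub>R p v"
  let ?l = "\<lambda>t u. p u + t *\<^sub>R (q u - p u)"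
  assume "?f p \<noteq> 0"
  then obtain i where i: "?f p $ i \<noteq> 0" by (auto simp: vec_eq_iff)
  have eq: "?f (?l t) $ i = ?f p $ i + t * (?f q - ?f p) $ i + t\<^sup>2 * 0" for t
    by (simp add: algebra_simps)
  have "{t. \<not> ?f (?l t) \<noteq> 0} \<subseteq> {t. ?f p $ i + t * (?f q - ?f p) $ i + t\<^sup>2 * 0 = 0}"
  proof (intro subsetI CollectI)
    fix t assume "t \<in> {t. \<not> ?f (?l t) \<noteq> 0}"
    then have "?f (?l t) = 0" by simp
    then have "?f (?l t) $ i = 0" by (simp only: zero_index)
    then show "?f p $ i + t * (?f q - ?f p) $ i + t\<^sup>2 * 0 = 0" by (simp only: eq)
  qed
  moreover have "finite {t. ?f p $ i + t * (?f q - ?f p) $ i + t\<^sup>2 * 0 = 0}"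
    by (rule finite_quadratic_roots) (use i in simp)
  ultimately show "finite {t. \<not> ?f (?l t) \<noteq> 0}" by (rule finite_subset)
qed

lemma line_generic_nonzero: "line_generic (\<lambda>p. p u \<noteq> (0 :: real^2))"
  using line_generic_combination[of 1 u 0 u] by simp

lemma line_generic_det2:
  "line_generic (\<lambda>p. det2 (a *\<^sub>R p u - b *\<^sub>R p v) (c *\<^sub>R p w - d *\<^sub>R p x) \<noteq> 0)"
  unfolding line_generic_def
proof (intro allI impI)
  fix p q :: "'a \<Rightarrow> real^2"
  let ?f = "\<lambda>p. a *\<^sub>R p u - b *\<^sub>R p v" and ?g = "\<lambda>p. c *\<^sub>R p w - d *\<^sub>R p x"
  assume nz: "det2 (?f p) (?g p) \<noteq> 0"
  let ?l = "\<lambda>t u. p u + t *\<^sub>R (q u - p u)"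
  let ?F = "?f q - ?f p" and ?G = "?g q - ?g p"
  have f: "?f (?l t) = ?f p + t *\<^sub>R ?F" "?g (?l t) = ?g p + t *\<^sub>R ?G" for t
    by (simp_all add: algebra_simps)
  have "det2 (?f (?l t)) (?g (?l t)) = det2 (?f p) (?g p) +
      t * (det2 ?F (?g p) + det2 (?f p) ?G) + t\<^sup>2 * det2 ?F ?G" for t
    unfolding f by (simp add: det2_def power2_eq_square algebra_simps)
  then show "finite {t. \<not> det2 (?f (?l t)) (?g (?l t)) \<noteq> 0}"
    using finite_quadratic_roots[of "det2 (?f p) (?g p)"] nz by simp
qed

text \<open>The quarter turn, that is, the velocity field of the infinitesimal rotation about the
  origin.\<close>

definition rotJ :: "real^2 \<Rightarrow> real^2" where
  "rotJ x = vector [- x $ 2, x $ 1]"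

lemma rotJ_nth [simp]: "rotJ x $ 1 = - x $ 2" "rotJ x $ 2 = x $ 1"
  by (simp_all add: rotJ_def)

lemma inner_2: "(x :: real^2) \<bullet> y = x $ 1 * y $ 1 + x $ 2 * y $ 2"
  by (simp add: inner_vec_def sum_2)

lemma vec_eq_2: "(x :: real^2) = y \<longleftrightarrow> x $ 1 = y $ 1 \<and> x $ 2 = y $ 2"
  by (simp add: vec_eq_iff forall_2)

lemma rotJ_linear:
  "rotJ (x + y) = rotJ x + rotJ y" "rotJ (x - y) = rotJ x - rotJ y" "rotJ (c *\<^sub>R x) = c *\<^sub>R rotJ x"
  "rotJ (- x) = - rotJ x" "rotJ 0 = 0"
  by (simp_all add: vec_eq_2)

lemma rotJ_inner: "x \<bullet> rotJ x = 0" "rotJ x \<bullet> x = 0" "rotJ x \<bullet> rotJ y = x \<bullet> y"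
  by (simp_all add: inner_2)

lemma rotJ_eq_0 [simp]: "rotJ x = 0 \<longleftrightarrow> x = 0"
  by (auto simp: vec_eq_2)

lemma axis_inner: "axis (i :: 2) 1 \<bullet> (x :: real^2) = x $ i"
  by (simp add: inner_axis' )

lemma det2_0 [simp]: "det2 0 x = 0" "det2 x 0 = 0"
  by (simp_all add: det2_def)

lemma det2_self [simp]: "det2 x x = 0"
  by (simp add: det2_def)

lemma det2_linear:
  "det2 (x + y) z = det2 x z + det2 y z" "det2 (x - y) z = det2 x z - det2 y z"
  "det2 (c *\<^sub>R x) z = c * det2 x z" "det2 (- x) z = - det2 x z"
  "det2 z (x + y) = det2 z x + det2 z y" "det2 z (x - y) = det2 z x - det2 z y"
  "det2 z (c *\<^sub>R x) = c * det2 z x" "det2 z (- x) = - det2 z x"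
  by (simp_all add: det2_def algebra_simps)

lemma det2_indep:
  assumes "det2 x y \<noteq> 0" "a *\<^sub>R x + b *\<^sub>R y = 0"
  shows "a = 0 \<and> b = 0"
proof -
  have "det2 (a *\<^sub>R x + b *\<^sub>R y) y = 0" "det2 x (a *\<^sub>R x + b *\<^sub>R y) = 0" using assms(2) by simp_all
  then show ?thesis using assms(1) by (simp add: det2_linear)
qed

lemma det2_span: "det2 x y \<noteq> 0 \<Longrightarrow> span {x, y} = UNIV"
proof -
  assume d: "det2 x y \<noteq> 0"
  have "w \<in> span {x, y}" for w
  proof -
    \<comment> \<open>Cramer's rule.\<close>
    have "(det2 x y) *\<^sub>R w = det2 w y *\<^sub>R x + det2 x w *\<^sub>R y"
      by (simp add: vec_eq_2 det2_def algebra_simps)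
    then have "inverse (det2 x y) *\<^sub>R (det2 x y *\<^sub>R w) =
      inverse (det2 x y) *\<^sub>R (det2 w y *\<^sub>R x + det2 x w *\<^sub>R y)" by (rule arg_cong)
    then have "w = inverse (det2 x y) *\<^sub>R (det2 w y *\<^sub>R x + det2 x w *\<^sub>R y)"
      using d by simp
    moreover have "inverse (det2 x y) *\<^sub>R (det2 w y *\<^sub>R x + det2 x w *\<^sub>R y) \<in> span {x, y}"
      by (intro span_mul span_add span_base) simp_all
    ultimately show ?thesis by (rule ssubst)
  qed
  then show ?thesis by (simp only: set_eq_iff UNIV_I simp_thms)
qed

text \<open>Each pair in \<open>xs\<close> pins a vertex in one direction. Later contradictions have
  this form: as many pins as there are independent trivial motions force a rigid body to rest, while
  the count still provides a nonzero motion.\<close>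

lemma homogeneous_motion:
  assumes "finite U" "finite X" "VF U \<subseteq> X" "length xs + card U < 2 * card X"
    and "\<And>a d. (a, d) \<in> set xs \<Longrightarrow> a \<in> X"
  shows "\<exists>m. (\<exists>u\<in>X. m u \<noteq> 0) \<and> (\<forall>f\<in>U. erow A p m f = 0) \<and> (\<forall>(a, d)\<in>set xs. d \<bullet> m a = 0)"
proof -
  define h where "h = (\<lambda>c u. case c of Inl e \<Rightarrow> erowv A p e u
    | Inr (a, d) \<Rightarrow> (if u = a then d else 0))"
  have "card (U <+> set xs) < 2 * card X"
    using assms(4) card_length[of xs] card_Plus[OF assms(1) finite_set[of xs]] by linarith
  then obtain m where m: "\<exists>u\<in>X. m u \<noteq> 0" "\<And>c. c \<in> U <+> set xs \<Longrightarrow> (\<Sum>u\<in>X. h c u \<bullet> m u) = 0"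
    using homogeneous_system_plane[OF finite_Plus[OF assms(1) finite_set] assms(2), of xs h] by metis
  have "erow A p m f = 0" if "f \<in> U" for f
  proof -
    have "ends f \<subseteq> X" using assms(3) that by (auto simp: VF_def)
    then show ?thesis using m(2)[OF InlI[OF that]] assms(2) by (simp add: erow_eq_sum[of X] h_def)
  qed
  moreover have "d \<bullet> m a = 0" if "(a, d) \<in> set xs" for a d
  proof -
    have "(\<Sum>u\<in>X. h (Inr (a, d)) u \<bullet> m u) = (\<Sum>u\<in>X. if u = a then d \<bullet> m u else 0)"
      by (intro sum.cong) (auto simp: h_def)
    then show ?thesis using m(2)[OF InrI[OF that]] assms(2) assms(5)[OF that] by simp
  qed
  ultimately show ?thesis using m(1) by blast
qed

section \<open>Sparse signed graphs\<close>

text \<open>Balance is witnessed by a switching function instead of being tested on cycles. Edges at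
  \<open>Z\<close> are unconstrained because fixed vertices are deleted before cycles are
  inspected.\<close>

definition potential :: "'a set \<Rightarrow> ('a \<Rightarrow> real) \<Rightarrow> 'a sedge set \<Rightarrow> bool" where
  "potential Z \<sigma> F \<longleftrightarrow> (\<forall>x. \<sigma> x = 1 \<or> \<sigma> x = -1) \<and>
     (\<forall>(u, v, s)\<in>F. u \<notin> Z \<longrightarrow> v \<notin> Z \<longrightarrow> s = \<sigma> u * \<sigma> v)"

definition bal :: "'a set \<Rightarrow> 'a sedge set \<Rightarrow> bool" where
  "bal Z F \<longleftrightarrow> (\<exists>\<sigma>. potential Z \<sigma> F)"

definition lam :: "bool \<Rightarrow> nat" where
  "lam A = (if A then 2 else 1)"

definition signed :: "'a sedge set \<Rightarrow> bool" where
  "signed E \<longleftrightarrow> (\<forall>(u, v, s)\<in>E. s = 1 \<or> s = -1)"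

text \<open>Only one weight per vertex occurs. For anti-symmetric motions the fixed vertex counts 2
  like any other; for symmetric ones it has disappeared, its edges having become loops at their free
  ends, and this encodes the weight 0.\<close>

definition sgsparse :: "bool \<Rightarrow> 'a set \<Rightarrow> 'a sedge set \<Rightarrow> bool" where
  "sgsparse A Z E \<longleftrightarrow> finite E \<and> signed E \<and> (\<forall>F\<subseteq>E. F \<noteq> {} \<longrightarrow>
     card F + lam A \<le> 2 * card (VF F) \<and> (bal Z F \<longrightarrow> card F + 3 \<le> 2 * card (VF F)))"

lemma sgsparse_subset: "sgsparse A Z E \<Longrightarrow> F \<subseteq> E \<Longrightarrow> sgsparse A Z F"
  unfolding sgsparse_def signed_def by (meson finite_subset order_trans subsetD)

lemma sgsparse_signed: "sgsparse A Z E \<Longrightarrow> (u, v, s) \<in> E \<Longrightarrow> s = 1 \<or> s = -1"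
  unfolding sgsparse_def signed_def by blast

lemma sgsparse_finite: "sgsparse A Z E \<Longrightarrow> finite E"
  unfolding sgsparse_def by blast

lemma sgsparse_lam: "sgsparse A Z E \<Longrightarrow> F \<subseteq> E \<Longrightarrow> F \<noteq> {} \<Longrightarrow> card F + lam A \<le> 2 * card (VF F)"
  unfolding sgsparse_def by blast

lemma sgsparse_bal: "sgsparse A Z E \<Longrightarrow> F \<subseteq> E \<Longrightarrow> F \<noteq> {} \<Longrightarrow> bal Z F \<Longrightarrow> card F + 3 \<le> 2 * card (VF F)"
  unfolding sgsparse_def by blast

lemma potential_pm: "potential Z \<sigma> F \<Longrightarrow> \<sigma> x = 1 \<or> \<sigma> x = -1"
  unfolding potential_def by blast

lemma potential_edge:
  "potential Z \<sigma> F \<Longrightarrow> (u, v, s) \<in> F \<Longrightarrow> u \<notin> Z \<Longrightarrow> v \<notin> Z \<Longrightarrow> s = \<sigma> u * \<sigma> v"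
  unfolding potential_def by blast

lemma potential_subset: "potential Z \<sigma> F \<Longrightarrow> G \<subseteq> F \<Longrightarrow> potential Z \<sigma> G"
  unfolding potential_def by blast

lemma bal_subset: "bal Z F \<Longrightarrow> G \<subseteq> F \<Longrightarrow> bal Z G"
  unfolding bal_def using potential_subset by blast

lemma potential_uminus: "potential Z \<sigma> F \<Longrightarrow> potential Z (\<lambda>x. - \<sigma> x) F"
  unfolding potential_def by fastforce

text \<open>Switching by \<open>\<sigma>\<close> turns a balanced graph into one with all signs \<open>1\<close>; \<open>tmot\<close> is a trivial
  motion transported back.  Under \<open>glob\<close> it is a motion whether or not \<open>\<sigma>\<close> fits the signs.\<close>

definition tmot :: "bool \<Rightarrow> ('a \<Rightarrow> real) \<Rightarrow> ('a \<Rightarrow> real^2) \<Rightarrow> real^2 \<Rightarrow> real \<Rightarrow> 'a \<Rightarrow> real^2" where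
  "tmot A \<sigma> p t c u = chi A (\<sigma> u) *\<^sub>R (t + (c * \<sigma> u) *\<^sub>R rotJ (p u))"

definition glob :: "bool \<Rightarrow> real^2 \<Rightarrow> real \<Rightarrow> bool" where
  "glob A t c \<longleftrightarrow> (if A then c = 0 else t = 0)"

lemma tmot_eq:
  assumes "\<sigma> u = 1 \<or> \<sigma> u = -1"
  shows "tmot A \<sigma> p t c u = (if A then t + (c * \<sigma> u) *\<^sub>R rotJ (p u) else \<sigma> u *\<^sub>R t + c *\<^sub>R rotJ (p u))"
  using assms by (auto simp: tmot_def chi_def algebra_simps)

text \<open>\<open>Z\<close> is for the fixed vertex, placed at the origin.  It cannot move symmetrically, so it only
  occurs with anti-symmetric motions.\<close>

locale signed_setting =
  fixes A :: bool and Z :: "'a set"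
  assumes Z_unique: "\<And>x y. x \<in> Z \<Longrightarrow> y \<in> Z \<Longrightarrow> x = y"
    and Z_sym: "\<not> A \<Longrightarrow> Z = {}"
begin

lemma tmot_row_bal:
  assumes pot: "potential Z \<sigma> F" and s: "signed F" and p: "\<forall>z\<in>Z. p z = 0" and e: "e \<in> F"
  shows "erow A p (tmot A \<sigma> p t c) e = 0"
proof -
  obtain u v s where e': "e = (u, v, s)" by (cases e)
  have s1: "s = 1 \<or> s = -1" using s e e' by (auto simp: signed_def)
  note pm = potential_pm[OF pot]
  show ?thesis
  proof (cases "u \<in> Z \<or> v \<in> Z")
    case True
    then have A using Z_sym by auto
    then have "p u = 0 \<or> p v = 0" using True p by auto
    then show ?thesis using \<open>A\<close>
      by (elim disjE) (simp_all add: e' tmot_def chi_def inner_2)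
  next
    case False
    then have "s = \<sigma> u * \<sigma> v" using potential_edge[OF pot] e e' by auto
    then show ?thesis using pm[of u] pm[of v]
      by (elim disjE; cases A) (simp_all add: e' tmot_def chi_def inner_2 algebra_simps)
  qed
qed

lemma tmot_row_glob:
  assumes s: "signed F" and e: "e \<in> F" and g: "glob A t c" and pm: "\<And>x. \<sigma> x = 1 \<or> \<sigma> x = -1"
  shows "erow A p (tmot A \<sigma> p t c) e = 0"
proof -
  obtain u v s where e': "e = (u, v, s)" by (cases e)
  have s1: "s = 1 \<or> s = -1" using s e e' by (auto simp: signed_def)
  show ?thesis using g s1
    by (elim disjE; cases A)
      (simp_all add: e' tmot_eq[of \<sigma>, OF pm] glob_def chi_def inner_2 algebra_simps)
qed

text \<open>The rows leave room for \<open>lam A\<close> independent motions. Hence \<open>m\<close>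
  and the \<open>lam A\<close> global trivial motions satisfy a relation, and \<open>m\<close>
  occurs in it because the trivial ones are independent; for the rotation this uses a vertex
  \<open>a\<close> away from the origin.\<close>

lemma tight_motions_glob:
  assumes F: "finite F" "indep A p F" "signed F" and X: "finite X" "VF F \<subseteq> X"
    and card: "card F + lam A = 2 * card X"
    and m: "\<forall>f\<in>F. erow A p m f = 0"
    and pm: "\<And>x. \<sigma> x = 1 \<or> \<sigma> x = -1"
    and a: "a \<in> X" "\<not> A \<Longrightarrow> p a \<noteq> 0"
  shows "\<exists>t c. glob A t c \<and> (\<forall>u\<in>X. m u = tmot A \<sigma> p t c u)"
proof (cases A)
  case True
  define \<mu> where "\<mu> = (\<lambda>j::nat. if j = 0 then tmot A \<sigma> p (axis 1 1) 0
    else if j = 1 then tmot A \<sigma> p (axis 2 1) 0 else m)"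
  have mu0: "erow A p (\<mu> j) e = 0" if "e \<in> F" for j e
    using tmot_row_glob[OF F(3) that _ pm, of _ 0] True bspec[OF m that] by (simp add: \<mu>_def glob_def)
  have "\<exists>y. (\<exists>j<3. y j \<noteq> 0) \<and> (\<forall>u\<in>X. (\<Sum>j<3. y j *\<^sub>R \<mu> j u) = 0)"
    by (rule motions_dependent[OF F(1,2) X mu0]) (use card True in \<open>simp_all add: lam_def\<close>)
  then obtain y where y: "\<exists>j<3. y j \<noteq> 0" "\<forall>u\<in>X. (\<Sum>j<3. y j *\<^sub>R \<mu> j u) = 0"
    by metis
  have y': "y 0 *\<^sub>R axis 1 1 + y 1 *\<^sub>R axis 2 1 + y 2 *\<^sub>R m u = 0" if "u \<in> X" for u
    using bspec[OF y(2) that] True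
    by (simp add: \<mu>_def tmot_def chi_def eval_nat_numeral add.assoc)
  have c: "y 0 + y 2 * m u $ 1 = 0" "y 1 + y 2 * m u $ 2 = 0" if "u \<in> X" for u
    using y'[OF that] by (simp_all add: vec_eq_2 axis_def)
  have "y 2 \<noteq> 0"
  proof
    assume "y 2 = 0"
    with c[OF a(1)] have "y 0 = 0" "y 1 = 0" by simp_all
    with y(1) \<open>y 2 = 0\<close> show False by (auto simp: eval_nat_numeral less_Suc_eq)
  qed
  have "m u = vector [- y 0 / y 2, - y 1 / y 2]" if "u \<in> X" for u
    using c[OF that] \<open>y 2 \<noteq> 0\<close> by (simp add: vec_eq_2 field_simps)
  then show ?thesis using True
    by (intro exI[of _ "vector [- y 0 / y 2, - y 1 / y 2]"] exI[of _ 0]) (auto simp: glob_def tmot_def chi_def)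
next
  case False
  define \<mu> where "\<mu> = (\<lambda>j::nat. if j = 0 then tmot A \<sigma> p 0 1 else m)"
  have mu0: "erow A p (\<mu> j) e = 0" if "e \<in> F" for j e
    using tmot_row_glob[OF F(3) that _ pm, of 0] False bspec[OF m that] by (simp add: \<mu>_def glob_def)
  have "\<exists>y. (\<exists>j<2. y j \<noteq> 0) \<and> (\<forall>u\<in>X. (\<Sum>j<2. y j *\<^sub>R \<mu> j u) = 0)"
    by (rule motions_dependent[OF F(1,2) X mu0]) (use card False in \<open>simp_all add: lam_def\<close>)
  then obtain y where y: "\<exists>j<2. y j \<noteq> 0" "\<forall>u\<in>X. (\<Sum>j<2. y j *\<^sub>R \<mu> j u) = 0"
    by metis
  have y': "y 0 *\<^sub>R rotJ (p u) + y 1 *\<^sub>R m u = 0" if "u \<in> X" for u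
    using bspec[OF y(2) that] False pm[of u]
    by (auto simp: \<mu>_def tmot_def chi_def eval_nat_numeral)
  have "y 1 \<noteq> 0"
  proof
    assume "y 1 = 0"
    with y'[OF a(1)] a(2) False have "y 0 = 0" by simp
    with y(1) \<open>y 1 = 0\<close> show False by (auto simp: eval_nat_numeral less_Suc_eq)
  qed
  have "m u = (- y 0 / y 1) *\<^sub>R rotJ (p u)" if "u \<in> X" for u
    using y'[OF that] \<open>y 1 \<noteq> 0\<close> by (simp add: vec_eq_2 field_simps)
  then show ?thesis using False
    by (intro exI[of _ 0] exI[of _ "- y 0 / y 1"]) (auto simp: glob_def tmot_eq[of \<sigma>, OF pm])
qed

text \<open>A balanced graph has three trivial motions, two translations and a rotation. They are
  independent since the switched positions of \<open>a\<close> and \<open>b\<close> differ, so the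
  relation forced by the count must involve \<open>m\<close>.\<close>

lemma tight_motions_bal:
  assumes F: "finite F" "indep A p F" "signed F" and X: "finite X" "VF F \<subseteq> X"
    and card: "card F + 3 = 2 * card X"
    and m: "\<forall>f\<in>F. erow A p m f = 0"
    and pot: "potential Z \<sigma> F" and p: "\<forall>z\<in>Z. p z = 0"
    and ab: "a \<in> X" "b \<in> X" "\<sigma> a *\<^sub>R p a \<noteq> \<sigma> b *\<^sub>R p b"
  shows "\<exists>t c. \<forall>u\<in>X. m u = tmot A \<sigma> p t c u"
proof -
  note pm = potential_pm[OF pot]
  define \<mu> where "\<mu> = (\<lambda>j::nat. if j = 0 then tmot A \<sigma> p (axis 1 1) 0
    else if j = 1 then tmot A \<sigma> p (axis 2 1) 0 else if j = 2 then tmot A \<sigma> p 0 1 else m)"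
  have mu0: "erow A p (\<mu> j) e = 0" if "e \<in> F" for j e
    using tmot_row_bal[OF pot F(3) p that] bspec[OF m that] by (simp add: \<mu>_def)
  have "\<exists>y. (\<exists>j<4. y j \<noteq> 0) \<and> (\<forall>u\<in>X. (\<Sum>j<4. y j *\<^sub>R \<mu> j u) = 0)"
    by (rule motions_dependent[OF F(1,2) X mu0]) (use card in \<open>simp_all add: lam_def\<close>)
  then obtain y where y: "\<exists>j<4. y j \<noteq> 0" "\<forall>u\<in>X. (\<Sum>j<4. y j *\<^sub>R \<mu> j u) = 0"
    by metis
  define t :: "real^2" where "t = vector [y 0, y 1]"
  have y': "tmot A \<sigma> p t (y 2) u + y 3 *\<^sub>R m u = 0" if "u \<in> X" for u
    using bspec[OF y(2) that] 
    by (simp add: \<mu>_def tmot_def eval_nat_numeral vec_eq_2 t_def axis_def algebra_simps)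
  have "y 3 \<noteq> 0"
  proof
    assume y3: "y 3 = 0"
    have 0: "t + (y 2 * \<sigma> u) *\<^sub>R rotJ (p u) = 0" if "u \<in> X" for u
      using y'[OF that] y3 pm[of u] by (auto simp: tmot_def chi_def split: if_splits)
    have "y 2 *\<^sub>R rotJ (\<sigma> a *\<^sub>R p a - \<sigma> b *\<^sub>R p b) =
        (t + (y 2 * \<sigma> a) *\<^sub>R rotJ (p a)) - (t + (y 2 * \<sigma> b) *\<^sub>R rotJ (p b))"
      by (simp add: rotJ_linear algebra_simps)
    then have "y 2 *\<^sub>R rotJ (\<sigma> a *\<^sub>R p a - \<sigma> b *\<^sub>R p b) = 0"
      using 0[OF ab(1)] 0[OF ab(2)] by simp
    then have y2: "y 2 = 0" using ab(3) by simp
    with 0[OF ab(1)] have "y 0 = 0" "y 1 = 0" by (simp_all add: t_def vec_eq_2)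
    with y(1) y2 y3 show False by (auto simp: eval_nat_numeral less_Suc_eq)
  qed
  have "m u = tmot A \<sigma> p ((- 1 / y 3) *\<^sub>R t) (- y 2 / y 3) u" if "u \<in> X" for u
    using y'[OF that] \<open>y 3 \<noteq> 0\<close> by (simp add: tmot_def vec_eq_2 field_simps)
  then show ?thesis by blast
qed

end

section \<open>Extending a realisation by one vertex\<close>

definition oth :: "'a \<Rightarrow> 'a sedge \<Rightarrow> 'a" where
  "oth w e = (case e of (u, v, s) \<Rightarrow> if u = w then v else u)"

definition sg :: "'a sedge \<Rightarrow> real" where
  "sg e = snd (snd e)"

text \<open>Seen from its end \<open>w\<close>, an edge asks \<open>p w - arm_pos\<close> to be orthogonal to \<open>m w - arm_mot\<close>,
  up to a factor.  A loop (which only occurs for symmetric motions) acts as a bar to the origin.\<close>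

definition arm_pos :: "'a \<Rightarrow> ('a \<Rightarrow> real^2) \<Rightarrow> 'a sedge \<Rightarrow> real^2" where
  "arm_pos w p e = (if oth w e = w then 0 else sg e *\<^sub>R p (oth w e))"

definition arm_mot :: "bool \<Rightarrow> 'a \<Rightarrow> ('a \<Rightarrow> real^2) \<Rightarrow> 'a sedge \<Rightarrow> real^2" where
  "arm_mot A w m e = (if oth w e = w then 0 else chi A (sg e) *\<^sub>R m (oth w e))"

lemma oth_simps: "oth w (u, v, s) = (if u = w then v else u)"
  by (simp add: oth_def)

lemma sg_simps [simp]: "sg (u, v, s) = s"
  by (simp add: sg_def)

lemma ends_oth: "w \<in> ends e \<Longrightarrow> ends e = {w, oth w e}"
  by (cases e) (auto simp: oth_simps)

lemma oth_in_ends: "w \<in> ends e \<Longrightarrow> oth w e \<in> ends e"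
  by (cases e) (auto simp: oth_simps)

lemma erow_arm:
  assumes w: "w \<in> ends e" and s: "sg e = 1 \<or> sg e = -1"
    and loop: "oth w e = w \<Longrightarrow> \<not> A \<and> sg e = -1"
  shows "\<exists>\<kappa>. \<kappa> \<noteq> 0 \<and> (\<forall>p m. erow A p m e =
    \<kappa> * ((p w - arm_pos w p e) \<bullet> (m w - arm_mot A w m e)))"
proof -
  obtain u v s' where e: "e = (u, v, s')" by (cases e)
  have s': "s' = 1 \<or> s' = -1" using s e by simp
  consider (loop) "u = w" "v = w" | (out) "u = w" "v \<noteq> w" | (inw) "u \<noteq> w" "v = w"
    using w e by auto
  then show ?thesis
  proof cases
    case loop
    then have "\<not> A" "s' = -1" using assms(3) e by (auto simp: oth_simps)
    \<comment> \<open>Both factors of the row are doubled at a loop of sign -1, so the row is four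
      times the condition of a bar to the origin.\<close>
    with loop show ?thesis
      by (intro exI[of _ 4]) (simp add: e oth_simps arm_pos_def arm_mot_def chi_def inner_2 algebra_simps)
  next
    case out
    then show ?thesis by (intro exI[of _ 1]) (simp add: e oth_simps arm_pos_def arm_mot_def)
  next
    case inw
    then have "erow A p m e = (s' * chi A s') *
        ((p w - arm_pos w p e) \<bullet> (m w - arm_mot A w m e))" for p m
      using s' by (elim disjE; cases A)
        (simp_all add: e oth_simps arm_pos_def arm_mot_def chi_def inner_2 algebra_simps)
    moreover have "s' * chi A s' \<noteq> 0" using s' by (auto simp: chi_def)
    ultimately show ?thesis by blast
  qed
qed

lemma arm_cong:
  "(\<And>u. u \<noteq> w \<Longrightarrow> p u = p' u) \<Longrightarrow> arm_pos w p e = arm_pos w p' e"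
  by (simp add: arm_pos_def)

text \<open>A stress of the extended graph is tested on motions that move \<open>w\<close> alone,
  which says that the arms are in equilibrium at \<open>w\<close>, and on motions that respect
  \<open>K\<close>, which involves only the velocities of the far ends. \<open>key\<close> demands
  that no nonzero weights on the arms pass both tests.\<close>

lemma indep_extend:
  assumes E: "finite E" and K: "K = {e \<in> E. w \<notin> ends e}" and D: "D = {e \<in> E. w \<in> ends e}"
    and arm: "\<And>e. e \<in> D \<Longrightarrow> sg e = 1 \<or> sg e = -1"
      "\<And>e. e \<in> D \<Longrightarrow> oth w e = w \<Longrightarrow> \<not> A \<and> sg e = -1"
    and indK: "indep A p K"
    and key: "\<And>l. (\<Sum>e\<in>D. l e *\<^sub>R (x - arm_pos w p e)) = 0 \<Longrightarrow>
      (\<And>m. \<forall>f\<in>K. erow A p m f = 0 \<Longrightarrow> (\<Sum>e\<in>D. l e * ((x - arm_pos w p e) \<bullet> arm_mot A w m e)) = 0) \<Longrightarrow>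
      \<forall>e\<in>D. l e = 0"
  shows "indep A (p(w := x)) E"
proof (rule indepI)
  fix \<omega> e0 assume om: "\<And>m. (\<Sum>e\<in>E. \<omega> e * erow A (p(w := x)) m e) = 0" and e0: "e0 \<in> E"
  let ?p = "p(w := x)"
  have fin: "finite K" "finite D" "K \<inter> D = {}" "E = K \<union> D" using E K D by auto
  have "\<forall>e\<in>D. \<exists>\<kappa>. \<kappa> \<noteq> 0 \<and> (\<forall>p m. erow A p m e =
      \<kappa> * ((p w - arm_pos w p e) \<bullet> (m w - arm_mot A w m e)))"
  proof
    fix e assume e: "e \<in> D"
    then have "w \<in> ends e" using D by simp
    from erow_arm[OF this arm(1)[OF e] arm(2)[OF e]]
    show "\<exists>\<kappa>. \<kappa> \<noteq> 0 \<and> (\<forall>p m. erow A p m e =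
      \<kappa> * ((p w - arm_pos w p e) \<bullet> (m w - arm_mot A w m e)))" by simp
  qed
  from bchoice[OF this] obtain \<kappa> where kk: "\<forall>e\<in>D. \<kappa> e \<noteq> 0 \<and> (\<forall>p m. erow A p m e =
      \<kappa> e * ((p w - arm_pos w p e) \<bullet> (m w - arm_mot A w m e)))" ..
  have k0: "\<kappa> e \<noteq> 0" if "e \<in> D" for e using kk that by simp
  have k: "erow A p m e = \<kappa> e * ((p w - arm_pos w p e) \<bullet> (m w - arm_mot A w m e))"
    if "e \<in> D" for e p m using kk that by simp
  define l where "l = (\<lambda>e. \<omega> e * \<kappa> e)"
  have pos: "arm_pos w ?p e = arm_pos w p e" for e by (rule arm_cong) simp
  have rK: "erow A ?p m f = erow A p m f" if "f \<in> K" for m f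
    using that K by (intro erow_cong_pos) auto
  have tot: "(\<Sum>f\<in>K. \<omega> f * erow A p m f) +
      (\<Sum>e\<in>D. l e * ((x - arm_pos w p e) \<bullet> (m w - arm_mot A w m e))) = 0" for m
  proof -
    have "(\<Sum>e\<in>E. \<omega> e * erow A ?p m e) =
        (\<Sum>f\<in>K. \<omega> f * erow A ?p m f) + (\<Sum>e\<in>D. \<omega> e * erow A ?p m e)"
      unfolding fin(4) using fin by (intro sum.union_disjoint) auto
    also have "(\<Sum>f\<in>K. \<omega> f * erow A ?p m f) = (\<Sum>f\<in>K. \<omega> f * erow A p m f)"
      by (intro sum.cong refl) (simp add: rK)
    also have "(\<Sum>e\<in>D. \<omega> e * erow A ?p m e) =
        (\<Sum>e\<in>D. l e * ((x - arm_pos w p e) \<bullet> (m w - arm_mot A w m e)))"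
      by (intro sum.cong refl) (simp add: k pos l_def)
    finally show ?thesis unfolding om by (rule sym)
  qed
  \<comment> \<open>The test motion moves only \<open>w\<close>, by the resultant itself, so the
    resultant has norm zero.\<close>
  have vec: "(\<Sum>e\<in>D. l e *\<^sub>R (x - arm_pos w p e)) = 0" (is "?V = 0")
  proof -
    define m where "m = (\<lambda>u. if u = w then ?V else 0)"
    have "erow A p m f = 0" if "f \<in> K" for f
    proof -
      have "erow A p m f = erow A p (\<lambda>_. 0) f"
        using that K by (intro erow_cong) (auto simp: m_def)
      then show ?thesis by simp
    qed
    moreover have "arm_mot A w m e = 0" for e by (simp add: arm_mot_def m_def)
    ultimately have "(\<Sum>e\<in>D. l e * ((x - arm_pos w p e) \<bullet> ?V)) = 0"
      using tot[of m] by (simp add: m_def)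
    then have "?V \<bullet> ?V = 0" by (subst inner_sum_left) simp
    then show ?thesis by simp
  qed
  have l0: "\<forall>e\<in>D. l e = 0"
  proof (rule key[OF vec])
    fix m assume m: "\<forall>f\<in>K. erow A p m f = 0"
    have "(\<Sum>e\<in>D. l e * ((x - arm_pos w p e) \<bullet> (m w - arm_mot A w m e))) = 0"
      using tot[of m] m by simp
    moreover have "(\<Sum>e\<in>D. l e * ((x - arm_pos w p e) \<bullet> m w)) = 0"
      using arg_cong[OF vec, of "\<lambda>v. v \<bullet> m w"] by (simp add: inner_sum_left)
    ultimately show "(\<Sum>e\<in>D. l e * ((x - arm_pos w p e) \<bullet> arm_mot A w m e)) = 0"
      by (simp add: inner_diff_right right_diff_distrib sum_subtractf)
  qed
  have "\<forall>f\<in>K. \<omega> f = 0"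
  proof
    fix f assume "f \<in> K"
    have "(\<Sum>f\<in>K. \<omega> f * erow A p m f) = 0" for m using tot[of m] l0 by simp
    then show "\<omega> f = 0" using indepD[OF indK] \<open>f \<in> K\<close> by blast
  qed
  moreover have "\<omega> e = 0" if "e \<in> D" for e
    using bspec[OF l0 that] k0[OF that] by (simp add: l_def)
  ultimately show "\<omega> e0 = 0" using e0 fin(4) by blast
qed

section \<open>Loops, parallel edges and general position in sparse graphs\<close>

context signed_setting
begin

text \<open>On a single vertex the count allows \<open>2 - lam A\<close> edges, which excludes loops
  for anti-symmetric motions; a loop of sign 1 would be balanced and exceed
  \<open>2 - 3\<close>.\<close>

lemma sgsparse_loop:
  assumes E: "sgsparse A Z E" and e: "(u, u, s) \<in> E"
  shows "\<not> A \<and> s = -1"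
proof -
  have 1: "1 + lam A \<le> 2" using sgsparse_lam[OF E, of "{(u, u, s)}"] e by simp
  then have nA: "\<not> A" by (auto simp: lam_def split: if_splits)
  have "s \<noteq> 1"
  proof
    assume "s = 1"
    then have "bal Z {(u, u, s)}" unfolding bal_def potential_def by (intro exI[of _ "\<lambda>_. 1"]) auto
    then show False using sgsparse_bal[OF E, of "{(u, u, s)}"] e by simp
  qed
  then show ?thesis using nA sgsparse_signed[OF E e] by simp
qed

lemma sgsparse_arm:
  assumes E: "sgsparse A Z E" and e: "e \<in> E" "w \<in> ends e"
  shows "sg e = 1 \<or> sg e = -1" "oth w e = w \<Longrightarrow> \<not> A \<and> sg e = -1"
proof -
  obtain u v s where e': "e = (u, v, s)" by (cases e)
  show "sg e = 1 \<or> sg e = -1" using sgsparse_signed[OF E] e e' by auto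
  show "\<not> A \<and> sg e = -1" if "oth w e = w"
    using sgsparse_loop[OF E, of w s] e that by (auto simp: e' oth_simps split: if_splits)
qed

text \<open>Two edges on two vertices violate the balanced bound, so the pair must be unbalanced.
  This forces opposite signs, and a far end outside \<open>Z\<close> because edges at
  \<open>Z\<close> do not affect balance.\<close>

lemma sgsparse_parallel:
  assumes E: "sgsparse A Z E" and e: "e \<in> E" "w \<in> ends e" and f: "f \<in> E" "w \<in> ends f"
    and ne: "e \<noteq> f" and eq: "oth w e = oth w f" and w: "w \<notin> Z"
  shows "oth w e \<noteq> w \<and> oth w e \<notin> Z \<and> sg f = - sg e"
proof (rule conjI)
  show a: "oth w e \<noteq> w"
  proof
    assume "oth w e = w"
    then have "e = (w, w, -1)" "f = (w, w, -1)"
      using sgsparse_arm(2)[OF E e] sgsparse_arm(2)[OF E f] e(2) f(2) eq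
      by (cases e; cases f; auto simp: oth_simps split: if_splits)+
    with ne show False by simp
  qed
  let ?a = "oth w e"
  have V: "VF {e, f} = {w, ?a}" using ends_oth[OF e(2)] ends_oth[OF f(2)] eq by auto
  have nb: "\<not> bal Z {e, f}"
  proof
    assume "bal Z {e, f}"
    then have "card {e, f} + 3 \<le> 2 * card {w, ?a}"
      using sgsparse_bal[OF E, of "{e, f}"] e f V by auto
    then show False using ne a by simp
  qed
  have pm: "sg e = 1 \<or> sg e = -1" "sg f = 1 \<or> sg f = -1"
    using sgsparse_arm(1)[OF E] e f by auto
  have "bal Z {e, f}" if "?a \<in> Z \<or> sg f = sg e"
    unfolding bal_def potential_def
    using that pm e(2) f(2) eq a
    by (intro exI[of _ "\<lambda>x. if x = ?a then sg e else 1"])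
      (cases e; cases f; auto simp: oth_simps split: if_splits)
  with nb have "?a \<notin> Z" "sg f \<noteq> sg e" by auto
  with pm show "?a \<notin> Z \<and> sg f = - sg e" by auto
qed

text \<open>The last two conditions exclude that two free points are collinear with the origin, and
  that three of them, each possibly replaced by its half-turn image, are collinear.\<close>

definition genpos :: "('a \<Rightarrow> real^2) \<Rightarrow> 'a set \<Rightarrow> bool" where
  "genpos p X \<longleftrightarrow> (\<forall>z\<in>Z. p z = 0) \<and> (\<forall>u\<in>X - Z. p u \<noteq> 0) \<and>
     (\<forall>u\<in>X - Z. \<forall>v\<in>X - Z. u \<noteq> v \<longrightarrow> det2 (p u) (p v) \<noteq> 0) \<and>
     (\<forall>u\<in>X - Z. \<forall>v\<in>X - Z. \<forall>w\<in>X - Z. u \<noteq> v \<longrightarrow> u \<noteq> w \<longrightarrow> v \<noteq> w \<longrightarrow>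
        (\<forall>a\<in>{1,-1}. \<forall>b\<in>{1,-1}. \<forall>c\<in>{1,-1}.
          det2 (a *\<^sub>R p u - c *\<^sub>R p w) (b *\<^sub>R p v - c *\<^sub>R p w) \<noteq> 0))"

text \<open>One placement serves all sparse graphs on \<open>X\<close> at once. Thus a failure of
  independence on \<open>X\<close> can be traced back to a failure of sparsity, whatever edge is
  added.\<close>

definition good :: "('a \<Rightarrow> real^2) \<Rightarrow> 'a set \<Rightarrow> bool" where
  "good p X \<longleftrightarrow> genpos p X \<and> (\<forall>E. sgsparse A Z E \<longrightarrow> VF E \<subseteq> X \<longrightarrow> indep A p E)"

lemma genposD:
  assumes "genpos p X"
  shows "z \<in> Z \<Longrightarrow> p z = 0" "u \<in> X \<Longrightarrow> u \<notin> Z \<Longrightarrow> p u \<noteq> 0"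
    "u \<in> X \<Longrightarrow> u \<notin> Z \<Longrightarrow> v \<in> X \<Longrightarrow> v \<notin> Z \<Longrightarrow> u \<noteq> v \<Longrightarrow> det2 (p u) (p v) \<noteq> 0"
proof -
  note c = assms[unfolded genpos_def]
  note * = c[THEN conjunct1] c[THEN conjunct2, THEN conjunct1]
    c[THEN conjunct2, THEN conjunct2, THEN conjunct1]
  show "z \<in> Z \<Longrightarrow> p z = 0" "u \<in> X \<Longrightarrow> u \<notin> Z \<Longrightarrow> p u \<noteq> 0" using *(1,2) by simp_all
  show "u \<in> X \<Longrightarrow> u \<notin> Z \<Longrightarrow> v \<in> X \<Longrightarrow> v \<notin> Z \<Longrightarrow> u \<noteq> v \<Longrightarrow> det2 (p u) (p v) \<noteq> 0"
    by (rule *(3)[rule_format]) simp_all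
qed

lemma genpos_triple:
  assumes "genpos p X" "u \<in> X - Z" "v \<in> X - Z" "w \<in> X - Z" "u \<noteq> v" "u \<noteq> w" "v \<noteq> w"
    "a = 1 \<or> a = -1" "b = 1 \<or> b = -1" "c = 1 \<or> c = -1"
  shows "det2 (a *\<^sub>R p u - c *\<^sub>R p w) (b *\<^sub>R p v - c *\<^sub>R p w) \<noteq> 0"
proof -
  have *: "\<forall>u\<in>X - Z. \<forall>v\<in>X - Z. \<forall>w\<in>X - Z. u \<noteq> v \<longrightarrow> u \<noteq> w \<longrightarrow> v \<noteq> w \<longrightarrow>
        (\<forall>a\<in>{1,-1}. \<forall>b\<in>{1,-1}. \<forall>c\<in>{1,-1}.
          det2 (a *\<^sub>R p u - c *\<^sub>R p w) (b *\<^sub>R p v - c *\<^sub>R p w) \<noteq> 0)"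
    using assms(1) unfolding genpos_def by (elim conjE)
  show ?thesis by (rule *[rule_format, OF assms(2-7)]) (use assms(8-10) in simp_all)
qed

lemma goodD: "good p X \<Longrightarrow> genpos p X" "good p X \<Longrightarrow> sgsparse A Z E \<Longrightarrow> VF E \<subseteq> X \<Longrightarrow> indep A p E"
  by (simp_all add: good_def)

lemma finite_sgsparse_sets: "finite X \<Longrightarrow> finite {E. sgsparse A Z E \<and> VF E \<subseteq> X}"
proof -
  assume X: "finite X"
  have "E \<subseteq> X \<times> X \<times> {1, -1}" if "sgsparse A Z E" "VF E \<subseteq> X" for E
  proof
    fix e assume e: "e \<in> E"
    obtain u v s where e': "e = (u, v, s)" by (cases e)
    have "ends e \<subseteq> X" using ends_subset_VF[OF e] that(2) by blast
    then show "e \<in> X \<times> X \<times> {1, -1}" using sgsparse_signed[OF that(1)] e e' by auto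
  qed
  then have "{E. sgsparse A Z E \<and> VF E \<subseteq> X} \<subseteq> Pow (X \<times> X \<times> {1, -1})" by auto
  then show ?thesis by (rule finite_subset) (simp add: X)
qed

text \<open>There are finitely many conditions, each line-generic and each satisfiable on its own:
  the determinants by placing one or two vertices on the axes and the others at the origin,
  independence by \<open>ex\<close>.\<close>

lemma ex_good:
  assumes X: "finite X"
    and ex: "\<And>E. sgsparse A Z E \<Longrightarrow> VF E \<subseteq> X \<Longrightarrow> \<exists>p. (\<forall>z\<in>Z. p z = 0) \<and> indep A p E"
  shows "\<exists>p. good p X"
proof -
  let ?Y = "X - Z"
  define Q1 where "Q1 = (\<lambda>u (p :: 'a \<Rightarrow> real^2). p u \<noteq> 0)"
  \<comment> \<open>The coefficients 1 and 0 bring the determinant into the form of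
    \<open>line_generic_det2\<close>.\<close>
  define Q2 where "Q2 = (\<lambda>u v (p :: 'a \<Rightarrow> real^2).
    det2 (1 *\<^sub>R p u - 0 *\<^sub>R p u) (1 *\<^sub>R p v - 0 *\<^sub>R p v) \<noteq> 0)"
  define Q3 where "Q3 = (\<lambda>u v w a b c (p :: 'a \<Rightarrow> real^2).
    det2 (a *\<^sub>R p u - c *\<^sub>R p w) (b *\<^sub>R p v - c *\<^sub>R p w) \<noteq> 0)"
  define PM :: "real set" where "PM = {1, -1}"
  define Q4 where "Q4 = (\<lambda>E (p :: 'a \<Rightarrow> real^2). indep A p E)"
  define I1 where "I1 = Q1 ` ?Y"
  define I2 where "I2 = (\<lambda>(u, v). Q2 u v) ` {(u, v). u \<in> ?Y \<and> v \<in> ?Y \<and> u \<noteq> v}"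
  define I3 where "I3 = (\<lambda>(u, v, w, a, b, c). Q3 u v w a b c) `
      {(u, v, w, a, b, c). u \<in> ?Y \<and> v \<in> ?Y \<and> w \<in> ?Y \<and> u \<noteq> v \<and> u \<noteq> w \<and> v \<noteq> w \<and>
        a \<in> PM \<and> b \<in> PM \<and> c \<in> PM}"
  define I4 where "I4 = Q4 ` {E. sgsparse A Z E \<and> VF E \<subseteq> X}"
  have "finite {(u, v). u \<in> ?Y \<and> v \<in> ?Y \<and> u \<noteq> v}"
    by (rule finite_subset[of _ "?Y \<times> ?Y"]) (use X in auto)
  moreover have "finite {(u, v, w, a :: real, b :: real, c :: real). u \<in> ?Y \<and> v \<in> ?Y \<and> w \<in> ?Y \<and>
      u \<noteq> v \<and> u \<noteq> w \<and> v \<noteq> w \<and> a \<in> PM \<and> b \<in> PM \<and> c \<in> PM}"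
    by (rule finite_subset[of _ "?Y \<times> ?Y \<times> ?Y \<times> PM \<times> PM \<times> PM"]) (use X in \<open>auto simp: PM_def\<close>)
  ultimately have fin: "finite (I1 \<union> I2 \<union> I3 \<union> I4)"
    using X finite_sgsparse_sets[OF X] unfolding I1_def I2_def I3_def I4_def by simp
  have lg: "line_generic Q" if "Q \<in> I1 \<union> I2 \<union> I3 \<union> I4" for Q
    using that
  proof (elim UnE)
    assume "Q \<in> I1" then show ?thesis using line_generic_nonzero by (auto simp: I1_def Q1_def)
  next
    assume "Q \<in> I2"
    then obtain u v where "Q = Q2 u v" by (auto simp: I2_def)
    then show ?thesis unfolding Q2_def by (simp only: line_generic_det2)
  next
    assume "Q \<in> I3"
    then obtain u v w a b c where "Q = Q3 u v w a b c" by (auto simp: I3_def)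
    then show ?thesis unfolding Q3_def by (simp only: line_generic_det2)
  next
    assume "Q \<in> I4"
    then obtain E where "Q = Q4 E" "finite E" using sgsparse_finite by (auto simp: I4_def)
    then show ?thesis unfolding Q4_def by (simp only: line_generic_indep)
  qed
  have sat: "\<exists>p. (\<forall>z\<in>Z. p z = 0) \<and> Q p" if "Q \<in> I1 \<union> I2 \<union> I3 \<union> I4" for Q
    using that
  proof (elim UnE)
    assume "Q \<in> I1"
    then obtain u where u: "u \<in> ?Y" "Q = Q1 u" unfolding I1_def by blast
    have "Q1 u (\<lambda>x. if x = u then axis 1 1 else 0)" by (simp add: Q1_def)
    moreover have "\<forall>z\<in>Z. (if z = u then axis 1 1 else (0 :: real^2)) = 0" using u by auto
    ultimately show ?thesis
      unfolding u(2) by (intro exI[of _ "\<lambda>x. if x = u then axis 1 1 else 0"] conjI)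
  next
    assume "Q \<in> I2"
    then obtain u v where "u \<in> ?Y" "v \<in> ?Y" "u \<noteq> v" "Q = Q2 u v" by (auto simp: I2_def)
    then show ?thesis
      by (intro exI[of _ "\<lambda>x. if x = u then axis 1 1 else if x = v then axis 2 1 else 0"])
        (auto simp: Q2_def det2_def axis_def)
  next
    assume "Q \<in> I3"
    then obtain u v w a b c where "u \<in> ?Y" "v \<in> ?Y" "w \<in> ?Y" "u \<noteq> v" "u \<noteq> w" "v \<noteq> w"
      "a \<in> PM" "b \<in> PM" "Q = Q3 u v w a b c"
      by (auto simp: I3_def)
    then show ?thesis
      by (intro exI[of _ "\<lambda>x. if x = u then axis 1 1 else if x = v then axis 2 1 else 0"])
        (auto simp: Q3_def det2_def axis_def PM_def)
  next
    assume "Q \<in> I4"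
    then obtain E where "Q = Q4 E" "sgsparse A Z E" "VF E \<subseteq> X" by (auto simp: I4_def)
    then show ?thesis using ex[of E] by (simp add: Q4_def)
  qed
  have "\<exists>p. (\<forall>z\<in>Z. p z = 0) \<and> (\<forall>Q\<in>I1 \<union> I2 \<union> I3 \<union> I4. Q p)"
    by (rule line_generic_common[OF fin, where Q = "\<lambda>Q. Q"]) (simp_all only: lg sat)
  then obtain p where p: "\<forall>z\<in>Z. p z = 0" "\<forall>Q\<in>I1 \<union> I2 \<union> I3 \<union> I4. Q p"
    by (elim exE conjE)
  have 1: "p u \<noteq> 0" if "u \<in> ?Y" for u
  proof -
    have "Q1 u \<in> I1" unfolding I1_def using that by blast
    then have "Q1 u p" using p(2) by blast
    then show ?thesis by (simp add: Q1_def)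
  qed
  have 2: "det2 (p u) (p v) \<noteq> 0" if "u \<in> ?Y" "v \<in> ?Y" "u \<noteq> v" for u v
  proof -
    have "Q2 u v \<in> I2" unfolding I2_def by (rule image_eqI[of _ _ "(u, v)"]) (use that in simp_all)
    then have "Q2 u v p" using p(2) by blast
    then show ?thesis by (simp add: Q2_def)
  qed
  have 3: "det2 (a *\<^sub>R p u - c *\<^sub>R p w) (b *\<^sub>R p v - c *\<^sub>R p w) \<noteq> 0"
    if "u \<in> ?Y" "v \<in> ?Y" "w \<in> ?Y" "u \<noteq> v" "u \<noteq> w" "v \<noteq> w" "a \<in> {1,-1}" "b \<in> {1,-1}" "c \<in> {1,-1}"
    for u v w a b c
  proof -
    have "Q3 u v w a b c \<in> I3"
      unfolding I3_def by (rule image_eqI[of _ _ "(u, v, w, a, b, c)"]) (use that in \<open>simp_all add: PM_def\<close>)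
    then have "Q3 u v w a b c p" using p(2) by blast
    then show ?thesis unfolding Q3_def .
  qed
  have 4: "indep A p E" if "sgsparse A Z E" "VF E \<subseteq> X" for E
  proof -
    have "Q4 E \<in> I4" unfolding I4_def using that by blast
    then have "Q4 E p" using p(2) by blast
    then show ?thesis by (simp only: Q4_def)
  qed
  have "genpos p X" unfolding genpos_def
  proof (intro conjI)
    show "\<forall>u\<in>?Y. p u \<noteq> 0" using 1 by blast
    show "\<forall>u\<in>?Y. \<forall>v\<in>?Y. u \<noteq> v \<longrightarrow> det2 (p u) (p v) \<noteq> 0" using 2 by blast
    show "\<forall>u\<in>?Y. \<forall>v\<in>?Y. \<forall>w\<in>?Y. u \<noteq> v \<longrightarrow> u \<noteq> w \<longrightarrow> v \<noteq> w \<longrightarrow>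
        (\<forall>a\<in>{1,-1}. \<forall>b\<in>{1,-1}. \<forall>c\<in>{1,-1}.
          det2 (a *\<^sub>R p u - c *\<^sub>R p w) (b *\<^sub>R p v - c *\<^sub>R p w) \<noteq> 0)"
      by (intro ballI impI 3)
  qed (rule p(1))
  with 4 show ?thesis unfolding good_def by blast
qed

end

section \<open>Blocks\<close>

text \<open>The bar between the far ends of two arms at \<open>w\<close>, as in the reversal of a
  vertex split of an edge. A loop ends at the origin, and a bar from a vertex to the origin is
  represented by the loop of sign -1 at that vertex.\<close>

definition virt :: "'a \<Rightarrow> 'a sedge \<Rightarrow> 'a sedge \<Rightarrow> 'a sedge" where
  "virt w e f = (if oth w e = w then (oth w f, oth w f, -1)
     else if oth w f = w then (oth w e, oth w e, -1) else (oth w e, oth w f, sg e * sg f))"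

lemma virt_erow:
  assumes e: "sg e = 1 \<or> sg e = -1" "oth w e = w \<Longrightarrow> \<not> A"
    and f: "sg f = 1 \<or> sg f = -1" "oth w f = w \<Longrightarrow> \<not> A"
    and n: "\<not> (oth w e = w \<and> oth w f = w)"
  shows "\<exists>\<kappa>. \<kappa> \<noteq> 0 \<and> (\<forall>p m. (arm_pos w p e - arm_pos w p f) \<bullet> (arm_mot A w m e - arm_mot A w m f)
    = \<kappa> * erow A p m (virt w e f))"
proof -
  consider "oth w e = w" "oth w f \<noteq> w" | "oth w e \<noteq> w" "oth w f = w" | "oth w e \<noteq> w" "oth w f \<noteq> w"
    using n by blast
  then show ?thesis
  proof cases
    case 1
    \<comment> \<open>The factor 1/4 compensates the doubling of both factors in the row of a
      loop.\<close>
    then show ?thesis using e(2) f(1)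
      by (intro exI[of _ "1/4"]) (auto simp: virt_def arm_pos_def arm_mot_def chi_def inner_2 algebra_simps)
  next
    case 2
    then show ?thesis using f(2) e(1)
      by (intro exI[of _ "1/4"]) (auto simp: virt_def arm_pos_def arm_mot_def chi_def inner_2 algebra_simps)
  next
    case 3
    have "(arm_pos w p e - arm_pos w p f) \<bullet> (arm_mot A w m e - arm_mot A w m f)
      = (sg e * chi A (sg e)) * erow A p m (virt w e f)" for p m
      using 3 e(1) f(1) by (elim disjE; cases A)
        (simp_all add: virt_def arm_pos_def arm_mot_def chi_def inner_2 algebra_simps)
    moreover have "sg e * chi A (sg e) \<noteq> 0" using e(1) by (auto simp: chi_def)
    ultimately show ?thesis by (intro exI[of _ "sg e * chi A (sg e)"]) simp
  qed
qed

text \<open>A trivial motion that is not global has a nonzero rotation part (for \<open>A\<close>)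
  or translation part (otherwise), and this part carries the sign. So the motion reveals the
  switching at every vertex off the origin, and potentials of overlapping blocks can be
  compared.\<close>

lemma tmot_inj:
  assumes "\<not> glob A t c" "p u \<noteq> 0" "\<sigma> u = 1 \<or> \<sigma> u = -1" "\<sigma>' u = 1 \<or> \<sigma>' u = -1"
    and "tmot A \<sigma> p t c u = tmot A \<sigma>' p t c u"
  shows "\<sigma> u = \<sigma>' u"
proof (cases A)
  case True
  then have "(c * \<sigma> u) *\<^sub>R rotJ (p u) = (c * \<sigma>' u) *\<^sub>R rotJ (p u)"
    using assms(5) by (simp add: tmot_eq assms(3,4))
  then show ?thesis using assms(1,2) True by (simp add: glob_def)
next
  case False
  then have "\<sigma> u *\<^sub>R t = \<sigma>' u *\<^sub>R t"
    using assms(5) by (simp add: tmot_eq assms(3,4))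
  then show ?thesis using assms(1) False by (simp add: glob_def)
qed

context signed_setting
begin

text \<open>If \<open>K\<close> with \<open>x\<close> were sparse, its rows would be independent by
  \<open>good\<close>, and a dual motion would violate \<open>x\<close> alone, against
  \<open>van\<close>. So sparsity fails on a set containing \<open>x\<close>; without
  \<open>x\<close> that set attains equality, counted on all its vertices and the ends of
  \<open>x\<close>. If \<open>x\<close> is already in \<open>K\<close>, the set of \<open>x\<close>
  alone serves.\<close>

lemma blocked:
  assumes K: "sgsparse A Z K" "VF K \<subseteq> X" and p: "good p X"
    and x: "x = (a, b, s)" "s = 1 \<or> s = -1" "a \<in> X" "b \<in> X" "a = b \<Longrightarrow> a \<notin> Z \<and> s = -1"
    and van: "\<And>m. \<forall>f\<in>K. erow A p m f = 0 \<Longrightarrow> erow A p m x = 0"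
  shows "\<exists>F\<subseteq>K. card F + lam A = 2 * card (VF (insert x F)) \<or>
    (bal Z (insert x F) \<and> card F + 3 = 2 * card (VF (insert x F)))"
proof (cases "x \<in> K")
  case True
  \<comment> \<open>\<open>x\<close> alone is tight: a loop has \<open>1 + 1 = 2 * 1\<close>, a
    proper edge \<open>1 + 3 = 2 * 2\<close>.\<close>
  show ?thesis
  proof (cases "a = b")
    case True
    then have "\<not> A" using sgsparse_loop[OF K(1), of a s] \<open>x \<in> K\<close> x by simp
    then show ?thesis using \<open>x \<in> K\<close> True by (intro exI[of _ "{x}"]) (simp add: lam_def x)
  next
    case False
    have "bal Z {x}" unfolding bal_def potential_def
      by (intro exI[of _ "\<lambda>u. if u = a then s else 1"]) (use False x in auto)
    then show ?thesis using \<open>x \<in> K\<close> False by (intro exI[of _ "{x}"]) (simp add: x)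
  qed
next
  case False
  have fin: "finite K" using K(1) by (rule sgsparse_finite)
  have sgn: "signed (insert x K)" using K(1) x(1,2) by (auto simp: signed_def sgsparse_def)
  have nsp: "\<not> sgsparse A Z (insert x K)"
  proof
    assume sp: "sgsparse A Z (insert x K)"
    have "VF (insert x K) \<subseteq> X" using K(2) x by simp
    then have "indep A p (insert x K)" by (rule goodD(2)[OF p sp])
    then have "\<exists>m. erow A p m x = 1 \<and> (\<forall>f\<in>insert x K - {x}. erow A p m f = 0)"
      using fin by (intro dual_motion) simp_all
    then obtain m where "erow A p m x = 1" "\<forall>f\<in>insert x K - {x}. erow A p m f = 0"
      by (elim exE conjE)
    then show False using van[of m] False by auto
  qed
  obtain F' where F': "F' \<subseteq> insert x K" "F' \<noteq> {}"
    "\<not> (card F' + lam A \<le> 2 * card (VF F') \<and> (bal Z F' \<longrightarrow> card F' + 3 \<le> 2 * card (VF F')))"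
    using nsp sgn fin unfolding sgsparse_def by auto
  have xF': "x \<in> F'"
  proof (rule ccontr)
    assume "x \<notin> F'"
    then have "F' \<subseteq> K" using F'(1) by blast
    then show False using F'(2,3) sgsparse_lam[OF K(1)] sgsparse_bal[OF K(1)] by blast
  qed
  define F where "F = F' - {x}"
  have FK: "F \<subseteq> K" "F' = insert x F" "x \<notin> F" "finite F"
    using F'(1) xF' fin finite_subset[of F K] by (auto simp: F_def)
  have cF: "card F' = Suc (card F)" using FK by simp
  show ?thesis
  proof (cases "F = {}")
    case True
    have V: "VF F' = {a, b}" using FK(2) True x by simp
    have ab: "a = b"
    proof (rule ccontr)
      assume "a \<noteq> b"
      then show False using F'(3) cF True V by (auto simp: lam_def split: if_splits)
    qed
    have nb: "\<not> bal Z F'"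
    proof
      assume "bal Z F'"
      then obtain \<sigma> where s: "potential Z \<sigma> F'" unfolding bal_def ..
      have "s = \<sigma> a * \<sigma> a" using potential_edge[OF s, of a a s] xF' x ab by simp
      then show False using potential_pm[OF s, of a] x(5)[OF ab] by auto
    qed
    have "\<not> (1 + lam A \<le> 2)" using F'(3) nb cF True V ab by simp
    \<comment> \<open>Only a loop in the anti-symmetric case remains. The empty set then counts as
      tight on its vertex, \<open>0 + 2 = 2 * 1\<close>.\<close>
    then show ?thesis using True V FK(2) ab by (intro exI[of _ "{}"]) (auto simp: lam_def split: if_splits)
  next
    case False
    have le: "card (VF F) \<le> card (VF F')" using FK by (intro card_mono) auto
    have 1: "card F + lam A \<le> 2 * card (VF F')" using sgsparse_lam[OF K(1) FK(1) False] le by linarith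
    have 2: "card F + 3 \<le> 2 * card (VF F')" if "bal Z F'"
    proof -
      have "bal Z F" by (rule bal_subset[OF that]) (simp add: FK(2) subset_insertI)
      then show ?thesis using sgsparse_bal[OF K(1) FK(1) False] le by linarith
    qed
    \<comment> \<open>\<open>F\<close> obeys the bounds on these vertices and \<open>F'\<close>,
      with one edge more, breaks one of them; this leaves only equality.\<close>
    have "card F + lam A = 2 * card (VF F') \<or> (bal Z F' \<and> card F + 3 = 2 * card (VF F'))"
      using F'(3) cF 1 2 by linarith
    then show ?thesis using FK by (intro exI[of _ F]) simp
  qed
qed

text \<open>The factor \<open>chi A (sg g)\<close> of the arm undoes the switching at its far end
  when \<open>\<sigma>\<close> there equals the sign of the arm. At a vertex of \<open>Z\<close> the
  rotation part vanishes, and a global motion looks the same under any switching.\<close>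

lemma arm_tmot:
  assumes gl: "glob A t c \<or> (oth w g \<noteq> w \<and> (oth w g \<in> Z \<or> \<sigma> (oth w g) = sg g))"
    and m: "oth w g \<noteq> w \<Longrightarrow> m (oth w g) = tmot A \<sigma> p t c (oth w g)"
    and pm: "\<And>x. \<sigma> x = 1 \<or> \<sigma> x = -1" and s: "sg g = 1 \<or> sg g = -1"
    and loop: "oth w g = w \<Longrightarrow> \<not> A" and p: "\<forall>z\<in>Z. p z = 0"
  shows "arm_mot A w m g = t + c *\<^sub>R rotJ (arm_pos w p g)"
proof (cases "oth w g = w")
  case True
  then show ?thesis using gl loop by (simp add: glob_def arm_mot_def arm_pos_def rotJ_linear)
next
  case False
  note m' = m[OF False]
  have a: "arm_mot A w m g = chi A (sg g) *\<^sub>R tmot A \<sigma> p t c (oth w g)"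
    using False m' by (simp add: arm_mot_def)
  have q: "arm_pos w p g = sg g *\<^sub>R p (oth w g)" using False by (simp add: arm_pos_def)
  consider "glob A t c" | "oth w g \<in> Z" | "\<sigma> (oth w g) = sg g" using gl by blast
  then show ?thesis
  proof cases
    case 1
    then show ?thesis unfolding a q using s
      by (cases A) (auto simp: glob_def chi_def tmot_eq[of \<sigma>, OF pm] rotJ_linear)
  next
    case 2
    then have "A" "p (oth w g) = 0" using Z_sym p by auto
    then show ?thesis unfolding a q by (simp add: chi_def tmot_def rotJ_linear)
  next
    case 3
    then show ?thesis unfolding a q using s by (auto simp: tmot_def chi_def rotJ_linear)
  qed
qed

text \<open>A potential normalised at \<open>w\<close>: with the value 1 at \<open>w\<close> it also
  fits the two arms, neither of which is a loop.\<close>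

definition block_pot :: "'a \<Rightarrow> 'a sedge \<Rightarrow> 'a sedge \<Rightarrow> ('a \<Rightarrow> real) \<Rightarrow> 'a sedge set \<Rightarrow> bool" where
  "block_pot w e f \<sigma> F \<longleftrightarrow> potential Z \<sigma> F \<and>
     (\<forall>g\<in>{e, f}. oth w g \<noteq> w \<and> (oth w g \<in> Z \<or> \<sigma> (oth w g) = sg g))"

text \<open>A block moves the arms \<open>e\<close> and \<open>f\<close> at \<open>w\<close> as parts of one rigid body.\<close>

definition is_block where
  "is_block p w K X e f F \<sigma> Y \<longleftrightarrow> F \<subseteq> K \<and> finite Y \<and> VF F \<subseteq> Y \<and> Y \<subseteq> X \<and>
     (\<forall>x. \<sigma> x = 1 \<or> \<sigma> x = -1) \<and> (\<forall>g\<in>{e, f}. oth w g \<noteq> w \<longrightarrow> oth w g \<in> Y) \<and>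
     (\<forall>m. (\<forall>k\<in>F. erow A p m k = 0) \<longrightarrow>
        (\<exists>t c. (\<forall>g\<in>{e, f}. arm_mot A w m g = t + c *\<^sub>R rotJ (arm_pos w p g)) \<and>
           (\<forall>u\<in>Y. m u = tmot A \<sigma> p t c u) \<and> (block_pot w e f \<sigma> F \<or> glob A t c)))"

text \<open>By \<open>van\<close> the bar \<open>virt w e f\<close> is respected by every motion of
  \<open>K\<close>, hence blocked by a tight subgraph. Tightness makes all motions of the subgraph
  trivial, and its vertices together with the ends of the bar contain the far ends of both
  arms.\<close>

lemma ex_block:
  assumes E: "sgsparse A Z E" and e: "e \<in> E" "w \<in> ends e" and f: "f \<in> E" "w \<in> ends f"
    and ne: "e \<noteq> f" and w: "w \<notin> Z" and K: "K = {e \<in> E. w \<notin> ends e}" "VF K \<subseteq> X"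
    and p: "good p X" and X: "oth w e = w \<or> oth w e \<in> X" "oth w f = w \<or> oth w f \<in> X"
    and van: "\<And>m. \<forall>k\<in>K. erow A p m k = 0 \<Longrightarrow>
      (arm_pos w p e - arm_pos w p f) \<bullet> (arm_mot A w m e - arm_mot A w m f) = 0"
  shows "\<exists>F \<sigma> Y. is_block p w K X e f F \<sigma> Y"
proof -
  let ?a = "oth w e" and ?b = "oth w f"
  note se = sgsparse_arm[OF E e] and sf = sgsparse_arm[OF E f]
  note par = sgsparse_parallel[OF E e f ne _ w]
  have nl: "\<not> (?a = w \<and> ?b = w)" using par by auto
  have nZ: "\<not> (?a \<in> Z \<and> ?b \<in> Z)" using Z_unique[of ?a ?b] par by auto
  obtain a b s where x: "virt w e f = (a, b, s)" by (cases "virt w e f")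
  have xs: "s = 1 \<or> s = -1" using x se(1) sf(1) by (auto simp: virt_def split: if_splits)
  have xX: "a \<in> X" "b \<in> X" using x X nl by (auto simp: virt_def split: if_splits)
  have xl: "a \<notin> Z \<and> s = -1" if "a = b"
  proof (cases "?a = w \<or> ?b = w")
    case True
    then have "\<not> A" using se(2) sf(2) by blast
    then show ?thesis using x True Z_sym by (auto simp: virt_def split: if_splits)
  next
    case False
    then have "?a = ?b" "a = ?a" "s = sg e * sg f" using x that by (auto simp: virt_def)
    then show ?thesis using par se(1) by auto
  qed
  have Kp: "sgsparse A Z K" using sgsparse_subset[OF E] K by simp
  have "\<exists>\<kappa>. \<kappa> \<noteq> 0 \<and> (\<forall>p m. (arm_pos w p e - arm_pos w p f) \<bullet> (arm_mot A w m e - arm_mot A w m f)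
    = \<kappa> * erow A p m (virt w e f))"
    by (rule virt_erow) (use se sf nl in blast)+
  then obtain \<kappa> where kap: "\<kappa> \<noteq> 0" "\<forall>p m. (arm_pos w p e - arm_pos w p f) \<bullet>
      (arm_mot A w m e - arm_mot A w m f) = \<kappa> * erow A p m (virt w e f)" by (elim exE conjE)
  have vanx: "erow A p m (virt w e f) = 0" if "\<forall>k\<in>K. erow A p m k = 0" for m
    using van[OF that] kap by simp
  from blocked[OF Kp K(2) p x xs xX xl vanx]
  obtain F where F: "F \<subseteq> K" "card F + lam A = 2 * card (VF (insert (virt w e f) F)) \<or>
    (bal Z (insert (virt w e f) F) \<and> card F + 3 = 2 * card (VF (insert (virt w e f) F)))" by metis
  define Y where "Y = VF (insert (virt w e f) F)"
  have finF: "finite F" using F(1) sgsparse_finite[OF Kp] finite_subset by blast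
  have Fp: "sgsparse A Z F" using sgsparse_subset[OF Kp F(1)] .
  have VFX: "VF F \<subseteq> X" using VF_mono[OF F(1)] K(2) by blast
  have ind: "indep A p F" by (rule goodD(2)[OF p Fp VFX])
  have sgF: "signed F" using Fp by (simp add: sgsparse_def)
  have Y: "finite Y" "VF F \<subseteq> Y" "Y \<subseteq> X" "a \<in> Y" "b \<in> Y" using finF xX VFX x by (auto simp: Y_def)
  have YO: "\<forall>g\<in>{e, f}. oth w g \<noteq> w \<longrightarrow> oth w g \<in> Y"
    using x Y by (auto simp: virt_def split: if_splits)
  note gp = goodD(1)[OF p]
  have p0: "\<forall>z\<in>Z. p z = 0" using genposD(1)[OF gp] by blast
  have sg: "sg g = 1 \<or> sg g = -1" "oth w g = w \<Longrightarrow> \<not> A" if "g \<in> {e, f}" for g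
    using that se sf by auto
  show ?thesis
  proof (cases "card F + lam A = 2 * card Y")
    case True
    \<comment> \<open>The motions of a globally tight subgraph are global, so the constant switching
      describes them and the signs of the arms need not match it.\<close>
    have "is_block p w K X e f F (\<lambda>_. 1) Y"
      unfolding is_block_def
    proof (intro conjI allI impI)
      fix m assume m: "\<forall>k\<in>F. erow A p m k = 0"
      have "\<exists>t c. glob A t c \<and> (\<forall>u\<in>Y. m u = tmot A (\<lambda>_. 1) p t c u)"
      proof (rule tight_motions_glob[OF finF ind sgF Y(1,2) True m _ Y(4)])
        assume "\<not> A"
        then show "p a \<noteq> 0" using genposD(2)[OF gp xX(1)] Z_sym by simp
      qed simp
      then obtain t c where tc: "glob A t c" "\<forall>u\<in>Y. m u = tmot A (\<lambda>_. 1) p t c u" by (elim exE conjE)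
      have "arm_mot A w m g = t + c *\<^sub>R rotJ (arm_pos w p g)" if "g \<in> {e, f}" for g
        by (rule arm_tmot[where \<sigma> = "\<lambda>_. 1"]) (use that tc YO sg[OF that] p0 in auto)
      then show "\<exists>t c. (\<forall>g\<in>{e, f}. arm_mot A w m g = t + c *\<^sub>R rotJ (arm_pos w p g)) \<and>
           (\<forall>u\<in>Y. m u = tmot A (\<lambda>_. 1) p t c u) \<and> (block_pot w e f (\<lambda>_. 1) F \<or> glob A t c)"
        using tc by (intro exI[of _ t] exI[of _ c] conjI ballI disjI2) simp_all
    qed (use F Y YO in auto)
    then show ?thesis by (intro exI)
  next
    case False
    then have b: "bal Z (insert (virt w e f) F)" "card F + 3 = 2 * card Y" using F(2) by (auto simp: Y_def)
    then obtain \<sigma>0 where s0: "potential Z \<sigma>0 (insert (virt w e f) F)" unfolding bal_def by (elim exE)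
    have "a \<noteq> b"
    proof
      assume ab: "a = b"
      then have "s = \<sigma>0 a * \<sigma>0 a" using potential_edge[OF s0, of a a s] x xl by simp
      then show False using potential_pm[OF s0, of a] xl[OF ab] by auto
    qed
    then have ol: "?a \<noteq> w" "?b \<noteq> w" and ab: "a = ?a" "b = ?b" "s = sg e * sg f" "?a \<noteq> ?b"
      using x by (auto simp: virt_def split: if_splits)
    \<comment> \<open>The negative of a potential is a potential. \<open>\<epsilon>\<close> selects
      the one that agrees with the sign of \<open>e\<close> at its far end, or with that of
      \<open>f\<close> if the far end of \<open>e\<close> is in \<open>Z\<close>; by
      \<open>nZ\<close> not both far ends are.\<close>
    define \<epsilon> where "\<epsilon> = (if ?a \<notin> Z then \<sigma>0 ?a * sg e else \<sigma>0 ?b * sg f)"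
    have eps: "\<epsilon> = 1 \<or> \<epsilon> = -1"
      using potential_pm[OF s0, of ?a] potential_pm[OF s0, of ?b] se(1) sf(1) by (auto simp: \<epsilon>_def)
    define \<sigma> where "\<sigma> = (\<lambda>u. \<epsilon> * \<sigma>0 u)"
    have pot: "potential Z \<sigma> (insert (virt w e f) F)"
      using eps s0 potential_uminus[OF s0] unfolding \<sigma>_def by (elim disjE) simp_all
    have potF: "potential Z \<sigma> F" by (rule potential_subset[OF pot]) blast
    note pm = potential_pm[OF pot]
    have sea: "?a \<in> Z \<or> \<sigma> ?a = sg e"
      using potential_pm[OF s0, of ?a] by (auto simp: \<sigma>_def \<epsilon>_def)
    have sfb: "?b \<in> Z \<or> \<sigma> ?b = sg f"
    proof (cases "?a \<in> Z")
      case True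
      then show ?thesis using potential_pm[OF s0, of ?b] by (auto simp: \<sigma>_def \<epsilon>_def)
    next
      case False
      show ?thesis
      proof (rule disjCI)
        assume "\<not> \<sigma> ?b = sg f"
        show "?b \<in> Z"
        proof (rule ccontr)
          assume "?b \<notin> Z"
          then have "sg e * sg f = \<sigma> ?a * \<sigma> ?b" using potential_edge[OF pot, of ?a ?b s] False x ab by simp
          then show False using sea False \<open>\<not> \<sigma> ?b = sg f\<close> se(1) by auto
        qed
      qed
    qed
    have dist: "\<sigma> ?a *\<^sub>R p ?a \<noteq> \<sigma> ?b *\<^sub>R p ?b"
    proof (cases "?a \<in> Z \<or> ?b \<in> Z")
      case True
      then have "(p ?a = 0 \<and> p ?b \<noteq> 0) \<or> (p ?a \<noteq> 0 \<and> p ?b = 0)"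
        using nZ p0 genposD(2)[OF gp] xX ab by metis
      then show ?thesis using pm[of ?a] pm[of ?b] by auto
    next
      case F: False
      then have d: "det2 (p ?a) (p ?b) \<noteq> 0" using genposD(3)[OF gp] xX ab by simp
      show ?thesis
      proof
        assume "\<sigma> ?a *\<^sub>R p ?a = \<sigma> ?b *\<^sub>R p ?b"
        then have "\<sigma> ?a *\<^sub>R p ?a + (- \<sigma> ?b) *\<^sub>R p ?b = 0" by simp
        then show False using det2_indep[OF d] pm[of ?a] by fastforce
      qed
    qed
    have bp: "block_pot w e f \<sigma> F" unfolding block_pot_def using potF sea sfb ol by simp
    have "is_block p w K X e f F \<sigma> Y"
      unfolding is_block_def
    proof (intro conjI allI impI)
      fix m assume m: "\<forall>k\<in>F. erow A p m k = 0"
      have "\<exists>t c. \<forall>u\<in>Y. m u = tmot A \<sigma> p t c u"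
        by (rule tight_motions_bal[OF finF ind sgF Y(1,2) b(2) m potF p0 _ _ dist]) (use Y ab in simp_all)
      then obtain t c where tc: "\<forall>u\<in>Y. m u = tmot A \<sigma> p t c u" by (elim exE)
      have "arm_mot A w m g = t + c *\<^sub>R rotJ (arm_pos w p g)" if "g \<in> {e, f}" for g
        by (rule arm_tmot[where \<sigma> = \<sigma>]) (use that tc YO sg[OF that] p0 sea sfb ol pm in auto)
      then show "\<exists>t c. (\<forall>g\<in>{e, f}. arm_mot A w m g = t + c *\<^sub>R rotJ (arm_pos w p g)) \<and>
           (\<forall>u\<in>Y. m u = tmot A \<sigma> p t c u) \<and> (block_pot w e f \<sigma> F \<or> glob A t c)"
        using tc bp by (intro exI[of _ t] exI[of _ c] conjI ballI disjI1) simp_all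
    next
      fix x show "\<sigma> x = 1 \<or> \<sigma> x = -1" by (rule pm)
    qed (use F Y YO in auto)
    then show ?thesis by (intro exI)
  qed
qed

lemma is_blockD:
  assumes "is_block p w K X e f F \<sigma> Y"
  shows "F \<subseteq> K" "finite Y" "VF F \<subseteq> Y" "Y \<subseteq> X" "\<sigma> x = 1 \<or> \<sigma> x = -1"
    "g \<in> {e, f} \<Longrightarrow> oth w g \<noteq> w \<Longrightarrow> oth w g \<in> Y"
  using assms by (auto simp: is_block_def)

lemma is_block_motion:
  assumes "is_block p w K X e f F \<sigma> Y" "\<forall>k\<in>F. erow A p m k = 0"
  obtains t c where "arm_mot A w m e = t + c *\<^sub>R rotJ (arm_pos w p e)"
    "arm_mot A w m f = t + c *\<^sub>R rotJ (arm_pos w p f)"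
    "\<forall>u\<in>Y. m u = tmot A \<sigma> p t c u" "block_pot w e f \<sigma> F \<or> glob A t c"
proof -
  have "\<exists>t c. (\<forall>g\<in>{e, f}. arm_mot A w m g = t + c *\<^sub>R rotJ (arm_pos w p g)) \<and>
           (\<forall>u\<in>Y. m u = tmot A \<sigma> p t c u) \<and> (block_pot w e f \<sigma> F \<or> glob A t c)"
    using assms unfolding is_block_def by simp
  then show ?thesis using that by (elim exE conjE) simp
qed

text \<open>Three infinitesimal rigid motions, one for each side of a proper triangle, that
  prescribe the same velocities at its corners are equal: the differences of velocities around the
  triangle add up to zero, and two sides are linearly independent.\<close>

lemma affine_arms:
  assumes d: "det2 (q1 - q3) (q2 - q3) \<noteq> 0"
    and a12: "a1 = t + c *\<^sub>R rotJ q1" "a2 = t + c *\<^sub>R rotJ q2"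
    and a23: "a2 = t' + c' *\<^sub>R rotJ q2" "a3 = t' + c' *\<^sub>R rotJ q3"
    and a13: "a1 = t'' + c'' *\<^sub>R rotJ q1" "a3 = t'' + c'' *\<^sub>R rotJ q3"
  shows "t' = t" "c' = c" "t'' = t" "c'' = c"
proof -
  have *: "a1 - a2 = rotJ (c *\<^sub>R (q1 - q2))" by (simp add: a12 rotJ_linear algebra_simps)
  have **: "a2 - a3 = rotJ (c' *\<^sub>R (q2 - q3))" by (simp add: a23 rotJ_linear algebra_simps)
  have ***: "a1 - a3 = rotJ (c'' *\<^sub>R (q1 - q3))" by (simp add: a13 rotJ_linear algebra_simps)
  have "rotJ ((c - c'') *\<^sub>R (q1 - q3) + (c' - c) *\<^sub>R (q2 - q3)) =
      rotJ (c *\<^sub>R (q1 - q2)) + rotJ (c' *\<^sub>R (q2 - q3)) - rotJ (c'' *\<^sub>R (q1 - q3))"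
    by (simp add: rotJ_linear algebra_simps)
  also have "\<dots> = (a1 - a2) + (a2 - a3) - (a1 - a3)" by (simp only: * ** ***)
  also have "\<dots> = 0" by simp
  finally have "(c - c'') *\<^sub>R (q1 - q3) + (c' - c) *\<^sub>R (q2 - q3) = 0" by simp
  from det2_indep[OF d this] show c: "c' = c" "c'' = c" by simp_all
  show "t' = t" "t'' = t" using a12(2) a23(1) a12(1) a13(1) c by simp_all
qed

text \<open>The arms form a proper triangle, so every motion of the union \<open>U\<close> moves the
  three blocks by one and the same \<open>t\<close>, \<open>c\<close>. The global count leaves such
  a motion that is not global; it shows that the potentials of the blocks agree. Then
  \<open>U\<close> with the arms is balanced, and the stronger balanced count leaves a nonzero
  motion with three pins, which must vanish.\<close>

lemma three_blocks:
  assumes E: "sgsparse A Z E" and w: "w \<notin> Z" and D: "{e \<in> E. w \<in> ends e} = {e1, e2, e3}"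
    and dist: "e1 \<noteq> e2" "e1 \<noteq> e3" "e2 \<noteq> e3"
    and K: "K = {e \<in> E. w \<notin> ends e}" and p: "good p X" and wX: "w \<notin> X"
    and B12: "is_block p w K X e1 e2 F12 \<sigma>12 Y12"
    and B23: "is_block p w K X e2 e3 F23 \<sigma>23 Y23"
    and B13: "is_block p w K X e1 e3 F13 \<sigma>13 Y13"
    and det: "det2 (arm_pos w p e1 - arm_pos w p e3) (arm_pos w p e2 - arm_pos w p e3) \<noteq> 0"
  shows False
proof -
  let ?D = "{e1, e2, e3}"
  define U where "U = F12 \<union> F23 \<union> F13"
  define Y where "Y = Y12 \<union> Y23 \<union> Y13"
  note b12 = is_blockD[OF B12] and b23 = is_blockD[OF B23] and b13 = is_blockD[OF B13]
  have DE: "g \<in> E" "w \<in> ends g" if "g \<in> ?D" for g using that D by blast+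
  have UK: "U \<subseteq> K" using b12(1) b23(1) b13(1) by (simp add: U_def)
  have finK: "finite K" using sgsparse_finite[OF E] K by simp
  have finU: "finite U" using UK finK finite_subset by blast
  have finY: "finite Y" using b12(2) b23(2) b13(2) by (simp add: Y_def)
  have VU: "VF U \<subseteq> Y" using b12(3) b23(3) b13(3) by (auto simp: U_def Y_def)
  have YX: "Y \<subseteq> X" using b12(4) b23(4) b13(4) by (simp add: Y_def)
  have wY: "w \<notin> Y" using YX wX by blast
  have oY: "oth w g = w \<or> oth w g \<in> Y" if "g \<in> ?D" for g
    using that b12(6)[of e1] b12(6)[of e2] b23(6)[of e3] by (auto simp: Y_def)
  have UDE: "U \<union> ?D \<subseteq> E" using UK K DE(1) by auto
  have dj: "U \<inter> ?D = {}" using UK K DE(2) by blast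
  have cD: "card (U \<union> ?D) = card U + 3" using dj finU dist by (subst card_Un_disjoint) auto
  have VD: "VF (U \<union> ?D) \<subseteq> insert w Y"
    using VU ends_oth[OF DE(2)] oY by (auto simp: VF_def)
  have cV: "card (VF (U \<union> ?D)) \<le> Suc (card Y)"
    using card_mono[OF _ VD] finY wY by simp
  \<comment> \<open>The three arms add three edges but only the vertex \<open>w\<close>, worth 2;
    removing them makes the inequality strict.\<close>
  have lamle: "card U + lam A < 2 * card Y"
    using sgsparse_lam[OF E UDE] cD cV by simp
  note gp = goodD(1)[OF p]
  have p0: "\<forall>z\<in>Z. p z = 0" using genposD(1)[OF gp] by blast
  have S: "\<exists>t c. (\<forall>g\<in>?D. arm_mot A w m g = t + c *\<^sub>R rotJ (arm_pos w p g)) \<and>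
      (\<forall>u\<in>Y12. m u = tmot A \<sigma>12 p t c u) \<and> (\<forall>u\<in>Y23. m u = tmot A \<sigma>23 p t c u) \<and>
      (\<forall>u\<in>Y13. m u = tmot A \<sigma>13 p t c u) \<and>
      ((block_pot w e1 e2 \<sigma>12 F12 \<and> block_pot w e2 e3 \<sigma>23 F23 \<and> block_pot w e1 e3 \<sigma>13 F13) \<or> glob A t c)"
    if m: "\<forall>k\<in>U. erow A p m k = 0" for m
  proof -
    have m12: "\<forall>k\<in>F12. erow A p m k = 0" and m23: "\<forall>k\<in>F23. erow A p m k = 0"
      and m13: "\<forall>k\<in>F13. erow A p m k = 0" using m by (simp_all add: U_def)
    obtain t c where 12: "arm_mot A w m e1 = t + c *\<^sub>R rotJ (arm_pos w p e1)"
      "arm_mot A w m e2 = t + c *\<^sub>R rotJ (arm_pos w p e2)"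
      "\<forall>u\<in>Y12. m u = tmot A \<sigma>12 p t c u" "block_pot w e1 e2 \<sigma>12 F12 \<or> glob A t c"
      by (rule is_block_motion[OF B12 m12])
    obtain t' c' where 23: "arm_mot A w m e2 = t' + c' *\<^sub>R rotJ (arm_pos w p e2)"
      "arm_mot A w m e3 = t' + c' *\<^sub>R rotJ (arm_pos w p e3)"
      "\<forall>u\<in>Y23. m u = tmot A \<sigma>23 p t' c' u" "block_pot w e2 e3 \<sigma>23 F23 \<or> glob A t' c'"
      by (rule is_block_motion[OF B23 m23])
    obtain t'' c'' where 13: "arm_mot A w m e1 = t'' + c'' *\<^sub>R rotJ (arm_pos w p e1)"
      "arm_mot A w m e3 = t'' + c'' *\<^sub>R rotJ (arm_pos w p e3)"
      "\<forall>u\<in>Y13. m u = tmot A \<sigma>13 p t'' c'' u" "block_pot w e1 e3 \<sigma>13 F13 \<or> glob A t'' c''"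
      by (rule is_block_motion[OF B13 m13])
    note eq = affine_arms[OF det 12(1,2) 23(1,2) 13(1,2)]
    have "\<forall>g\<in>?D. arm_mot A w m g = t + c *\<^sub>R rotJ (arm_pos w p g)"
      using 12(1,2) 23(2) eq(1,2) by simp
    then show ?thesis using 12(3,4) 23(3,4) 13(3,4) unfolding eq
      by (intro exI[of _ t] exI[of _ c] conjI; blast?)
  qed
  have SY: "\<exists>\<sigma>. (\<forall>x. \<sigma> x = 1 \<or> \<sigma> x = -1) \<and> m u = tmot A \<sigma> p t c u"
    if "u \<in> Y" "\<forall>u\<in>Y12. m u = tmot A \<sigma>12 p t c u" "\<forall>u\<in>Y23. m u = tmot A \<sigma>23 p t c u"
      "\<forall>u\<in>Y13. m u = tmot A \<sigma>13 p t c u" for m t c u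
  proof -
    have "u \<in> Y12 \<or> u \<in> Y23 \<or> u \<in> Y13" using that(1) by (auto simp: Y_def)
    then show ?thesis
    proof (elim disjE)
      assume "u \<in> Y12" then show ?thesis using that(2) b12(5) by (intro exI[of _ \<sigma>12]) simp
    next
      assume "u \<in> Y23" then show ?thesis using that(3) b23(5) by (intro exI[of _ \<sigma>23]) simp
    next
      assume "u \<in> Y13" then show ?thesis using that(4) b13(5) by (intro exI[of _ \<sigma>13]) simp
    qed
  qed
  have zero: "tmot A \<sigma> p 0 0 u = 0" for \<sigma> u by (simp add: tmot_def)
  have nl: "\<not> (oth w e1 = w \<and> oth w e2 = w)"
    using sgsparse_parallel[OF E DE[of e1] DE[of e2] dist(1) _ w] by auto
  then obtain a where a: "a \<in> Y" using oY[of e1] oY[of e2] by auto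
  have ex: "\<exists>m t c. (\<forall>k\<in>U. erow A p m k = 0) \<and> (\<forall>u\<in>Y12. m u = tmot A \<sigma>12 p t c u) \<and>
      (\<forall>u\<in>Y23. m u = tmot A \<sigma>23 p t c u) \<and> (\<forall>u\<in>Y13. m u = tmot A \<sigma>13 p t c u) \<and>
      (block_pot w e1 e2 \<sigma>12 F12 \<and> block_pot w e2 e3 \<sigma>23 F23 \<and> block_pot w e1 e3 \<sigma>13 F13) \<and>
      \<not> glob A t c"
  proof -
    \<comment> \<open>One pin for each independent global motion. A global motion with these pins at
      \<open>a\<close> vanishes everywhere, so the nonzero motion obtained is not global.\<close>
    define xs where "xs = (if A then [(a, axis 1 1), (a, axis 2 1)] else [(a, rotJ (p a))])"
    have "length xs + card U < 2 * card Y" using lamle by (auto simp: xs_def lam_def split: if_splits)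
    then have "\<exists>m. (\<exists>u\<in>Y. m u \<noteq> 0) \<and> (\<forall>f\<in>U. erow A p m f = 0) \<and> (\<forall>(a, d)\<in>set xs. d \<bullet> m a = 0)"
      by (rule homogeneous_motion[OF finU finY VU]) (use a in \<open>auto simp: xs_def split: if_splits\<close>)
    then obtain m where m: "\<exists>u\<in>Y. m u \<noteq> 0" "\<forall>f\<in>U. erow A p m f = 0" "\<forall>(a, d)\<in>set xs. d \<bullet> m a = 0"
      by (elim exE conjE)
    from S[OF m(2)] obtain t c where tc: "\<forall>u\<in>Y12. m u = tmot A \<sigma>12 p t c u" "\<forall>u\<in>Y23. m u = tmot A \<sigma>23 p t c u"
      "\<forall>u\<in>Y13. m u = tmot A \<sigma>13 p t c u"
      "(block_pot w e1 e2 \<sigma>12 F12 \<and> block_pot w e2 e3 \<sigma>23 F23 \<and> block_pot w e1 e3 \<sigma>13 F13) \<or> glob A t c"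
      by (elim exE conjE)
    have "\<not> glob A t c"
    proof
      assume gl: "glob A t c"
      from SY[OF a tc(1-3)] obtain \<sigma> where s: "\<forall>x. \<sigma> x = 1 \<or> \<sigma> x = -1" "m a = tmot A \<sigma> p t c a"
        by (elim exE conjE)
      have "t = 0 \<and> c = 0"
      proof (cases A)
        case True
        then have "c = 0" "m a = t" using gl s by (simp_all add: glob_def tmot_def chi_def)
        then show ?thesis using m(3) True by (simp add: xs_def axis_inner vec_eq_2)
      next
        case False
        then have "t = 0" "m a = c *\<^sub>R rotJ (p a)" using gl s tmot_eq[of \<sigma> a] by (simp_all add: glob_def)
        moreover have "p a \<noteq> 0" using genposD(2)[OF gp] a YX Z_sym[OF False] by blast
        ultimately show ?thesis using m(3) False by (simp add: xs_def rotJ_inner)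
      qed
      then have "m u = 0" if "u \<in> Y" for u using SY[OF that tc(1-3)] zero by auto
      then show False using m(1) by blast
    qed
    then show ?thesis using m(2) tc by (intro exI[of _ m] exI[of _ t] exI[of _ c]) simp
  qed
  then obtain m0 t0 c0 where m0: "\<forall>u\<in>Y12. m0 u = tmot A \<sigma>12 p t0 c0 u"
      "\<forall>u\<in>Y23. m0 u = tmot A \<sigma>23 p t0 c0 u" "\<forall>u\<in>Y13. m0 u = tmot A \<sigma>13 p t0 c0 u" "\<not> glob A t0 c0"
      and bp: "block_pot w e1 e2 \<sigma>12 F12" "block_pot w e2 e3 \<sigma>23 F23" "block_pot w e1 e3 \<sigma>13 F13"
    by (elim exE conjE)
  have nz: "p u \<noteq> 0" if "u \<in> Y" "u \<notin> Z" for u using genposD(2)[OF gp] that YX by blast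
  \<comment> \<open>The common potential, with the value 1 at \<open>w\<close> to match
    \<open>block_pot\<close>. Outside \<open>Z\<close> the motion \<open>m0\<close> forces the three
    potentials to agree on overlaps, so the order of the cases is immaterial there.\<close>
  define \<sigma> where "\<sigma> = (\<lambda>u. if u = w then 1 else if u \<in> Y12 then \<sigma>12 u
    else if u \<in> Y23 then \<sigma>23 u else \<sigma>13 u)"
  have pm: "\<sigma> x = 1 \<or> \<sigma> x = -1" for x using b12(5)[of x] b23(5)[of x] b13(5)[of x] by (simp add: \<sigma>_def)
  have a12: "\<sigma> u = \<sigma>12 u" if "u \<in> Y12" for u using that wY by (auto simp: \<sigma>_def Y_def)
  have a23: "\<sigma> u = \<sigma>23 u" if "u \<in> Y23" "u \<notin> Z" for u
  proof (cases "u \<in> Y12")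
    case True
    have "\<sigma>12 u = \<sigma>23 u"
      by (rule tmot_inj[OF m0(4), of p u])
        (use True that m0 nz[of u] b12(5)[of u] b23(5)[of u] in \<open>auto simp: Y_def\<close>)
    then show ?thesis using a12[OF True] by simp
  next
    case False
    then show ?thesis using that wY by (auto simp: \<sigma>_def Y_def)
  qed
  have a13: "\<sigma> u = \<sigma>13 u" if "u \<in> Y13" "u \<notin> Z" for u
  proof -
    have "\<sigma>12 u = \<sigma>13 u" if "u \<in> Y12"
      by (rule tmot_inj[OF m0(4), of p u])
        (use \<open>u \<in> Y13\<close> \<open>u \<notin> Z\<close> that m0 nz[of u] b12(5)[of u] b13(5)[of u] in \<open>auto simp: Y_def\<close>)
    moreover have "\<sigma>23 u = \<sigma>13 u" if "u \<in> Y23"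
      by (rule tmot_inj[OF m0(4), of p u])
        (use \<open>u \<in> Y13\<close> \<open>u \<notin> Z\<close> that m0 nz[of u] b23(5)[of u] b13(5)[of u] in \<open>auto simp: Y_def\<close>)
    ultimately show ?thesis using that wY by (auto simp: \<sigma>_def Y_def)
  qed
  have sD: "oth w g \<noteq> w \<and> (oth w g \<in> Z \<or> \<sigma> (oth w g) = sg g)" if "g \<in> ?D" for g
  proof -
    have "oth w e1 \<noteq> w \<and> (oth w e1 \<in> Z \<or> \<sigma> (oth w e1) = sg e1)"
      using bp(1) b12(6)[of e1] a12 by (simp add: block_pot_def)
    moreover have "oth w e2 \<noteq> w \<and> (oth w e2 \<in> Z \<or> \<sigma> (oth w e2) = sg e2)"
      using bp(1) b12(6)[of e2] a12 by (simp add: block_pot_def)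
    moreover have "oth w e3 \<noteq> w \<and> (oth w e3 \<in> Z \<or> \<sigma> (oth w e3) = sg e3)"
      using bp(2) b23(6)[of e3] a23[of "oth w e3"] by (cases "oth w e3 \<in> Z") (simp_all add: block_pot_def)
    ultimately show ?thesis using that by blast
  qed
  have edge: "s = \<sigma> u * \<sigma> v" if "(u, v, s) \<in> U \<union> ?D" "u \<notin> Z" "v \<notin> Z" for u v s
    using that(1)
  proof (elim UnE)
    assume "(u, v, s) \<in> U"
    then consider "(u, v, s) \<in> F12" | "(u, v, s) \<in> F23" | "(u, v, s) \<in> F13" by (auto simp: U_def)
    then show ?thesis
    proof cases
      case 1
      then have "u \<in> Y12" "v \<in> Y12" using b12(3) ends_subset_VF by fastforce+
      then show ?thesis using potential_edge[of Z \<sigma>12 F12] bp(1) 1 that a12 by (auto simp: block_pot_def)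
    next
      case 2
      then have "u \<in> Y23" "v \<in> Y23" using b23(3) ends_subset_VF by fastforce+
      then show ?thesis using potential_edge[of Z \<sigma>23 F23] bp(2) 2 that a23 by (auto simp: block_pot_def)
    next
      case 3
      then have "u \<in> Y13" "v \<in> Y13" using b13(3) ends_subset_VF by fastforce+
      then show ?thesis using potential_edge[of Z \<sigma>13 F13] bp(3) 3 that a13 by (auto simp: block_pot_def)
    qed
  next
    assume g: "(u, v, s) \<in> ?D"
    have w1: "\<sigma> w = 1" by (simp add: \<sigma>_def)
    have "w = u \<or> w = v" using DE(2)[OF g] by auto
    then show ?thesis using sD[OF g] that(2,3) w1 by (auto simp: oth_simps split: if_splits)
  qed
  have "potential Z \<sigma> (U \<union> ?D)" unfolding potential_def
    by (intro conjI allI pm) (use edge in blast)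
  then have "bal Z (U \<union> ?D)" unfolding bal_def by (intro exI[of _ \<sigma>])
  then have "card (U \<union> ?D) + 3 \<le> 2 * card (VF (U \<union> ?D))"
    by (intro sgsparse_bal[OF E UDE]) auto
  then have le: "card U + 3 < 2 * card Y" using cD cV by linarith
  let ?a1 = "oth w e1" and ?a2 = "oth w e2"
  let ?dq = "arm_pos w p e2 - arm_pos w p e1"
  have aY: "?a1 \<in> Y" "?a2 \<in> Y" using sD[of e1] sD[of e2] oY[of e1] oY[of e2] by auto
  \<comment> \<open>The far end of the first arm is held fixed, and that of the second is kept from
    rotating about it: three pins against three trivial motions.\<close>
  define xs where "xs = [(?a1, axis 1 1), (?a1, axis 2 1), (?a2, rotJ ?dq)]"
  have "length xs + card U < 2 * card Y" using le by (simp add: xs_def)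
  then have "\<exists>m. (\<exists>u\<in>Y. m u \<noteq> 0) \<and> (\<forall>f\<in>U. erow A p m f = 0) \<and> (\<forall>(a, d)\<in>set xs. d \<bullet> m a = 0)"
    by (rule homogeneous_motion[OF finU finY VU]) (use aY in \<open>auto simp: xs_def\<close>)
  then obtain m where m: "\<exists>u\<in>Y. m u \<noteq> 0" "\<forall>f\<in>U. erow A p m f = 0" "\<forall>(a, d)\<in>set xs. d \<bullet> m a = 0"
    by (elim exE conjE)
  from S[OF m(2)] obtain t c where tc: "\<forall>g\<in>?D. arm_mot A w m g = t + c *\<^sub>R rotJ (arm_pos w p g)"
    "\<forall>u\<in>Y12. m u = tmot A \<sigma>12 p t c u" "\<forall>u\<in>Y23. m u = tmot A \<sigma>23 p t c u"
    "\<forall>u\<in>Y13. m u = tmot A \<sigma>13 p t c u"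
    by (elim exE conjE)
  have "m ?a1 = 0" using m(3) by (simp add: xs_def axis_inner vec_eq_2)
  then have "arm_mot A w m e1 = 0" by (simp add: arm_mot_def)
  then have 1: "t + c *\<^sub>R rotJ (arm_pos w p e1) = 0" using bspec[OF tc(1), of e1] by simp
  have "rotJ ?dq \<bullet> m ?a2 = 0" using m(3) by (simp add: xs_def)
  then have "rotJ ?dq \<bullet> arm_mot A w m e2 = 0" by (simp add: arm_mot_def)
  then have "rotJ ?dq \<bullet> (t + c *\<^sub>R rotJ (arm_pos w p e2)) = 0" using tc(1) by simp
  moreover have "t + c *\<^sub>R rotJ (arm_pos w p e2) = c *\<^sub>R rotJ ?dq"
    using 1 by (simp add: rotJ_linear scaleR_diff_right algebra_simps eq_neg_iff_add_eq_0)
  ultimately have "c * (rotJ ?dq \<bullet> rotJ ?dq) = 0" by simp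
  moreover have "?dq \<noteq> 0" using det by auto
  ultimately have c0: "c = 0" by simp
  then have "t = 0" using 1 by simp
  then have "m u = 0" if "u \<in> Y" for u using SY[OF that tc(2-4)] zero c0 by auto
  then show False using m(1) by blast
qed

end

section \<open>Realising sparse signed graphs\<close>

lemma ex_two_directions:
  fixes p d :: "real^2"
  assumes "p \<noteq> 0" "d \<noteq> 0"
  shows "\<exists>x. det2 x p \<noteq> 0 \<and> x \<bullet> d \<noteq> 0"
proof -
  have Jp: "det2 (rotJ p) p = - (p \<bullet> p)" by (simp add: det2_def inner_2)
  show ?thesis
  proof (cases "rotJ p \<bullet> d = 0")
    case False
    then show ?thesis using Jp assms(1) by (intro exI[of _ "rotJ p"]) simp
  next
    case True
    then have "det2 d p = 0" by (simp add: det2_def inner_2 algebra_simps)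
    then have "det2 (d + rotJ p) p \<noteq> 0" using Jp assms(1) by (simp add: det2_linear)
    moreover have "(d + rotJ p) \<bullet> d \<noteq> 0" using True assms(2) by (simp add: inner_add_left)
    ultimately show ?thesis by blast
  qed
qed

section \<open>The positions of the arms at the removed vertex\<close>

context signed_setting
begin

definition deg :: "'a sedge set \<Rightarrow> 'a \<Rightarrow> nat" where
  "deg E w = card {e \<in> E. w \<in> ends e}"

text \<open>Distinct arms with the same far vertex are parallel edges of opposite sign and end at
  \<open>q\<close> and \<open>-q\<close>. A loop ends at the origin, where no other arm ends as
  \<open>Z\<close> is then empty. All other pairs are separated by general position.\<close>

lemma arm_pos_distinct:
  assumes E: "sgsparse A Z E" and g: "g \<in> E" "w \<in> ends g" and h: "h \<in> E" "w \<in> ends h"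
    and ne: "g \<noteq> h" and w: "w \<notin> Z" and gp: "genpos p X"
    and X: "oth w g = w \<or> oth w g \<in> X" "oth w h = w \<or> oth w h \<in> X"
  shows "arm_pos w p g \<noteq> arm_pos w p h"
proof -
  note sg = sgsparse_arm[OF E g] and sh = sgsparse_arm[OF E h]
  note par = sgsparse_parallel[OF E g h ne _ w]
  note p0 = genposD(1)[OF gp] and nz = genposD(2)[OF gp] and dt = genposD(3)[OF gp]
  consider "oth w g = w" "oth w h = w" | "oth w g = w" "oth w h \<noteq> w" | "oth w g \<noteq> w" "oth w h = w"
    | "oth w g \<noteq> w" "oth w h \<noteq> w" "oth w g = oth w h"
    | "oth w g \<noteq> w" "oth w h \<noteq> w" "oth w g \<noteq> oth w h" by blast
  then show ?thesis
  proof cases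
    case 1 then show ?thesis using par by simp
  next
    case 2 then show ?thesis using sg(2) sh(1) Z_sym nz[of "oth w h"] X(2) by (auto simp: arm_pos_def)
  next
    case 3 then show ?thesis using sh(2) sg(1) Z_sym nz[of "oth w g"] X(1) by (auto simp: arm_pos_def)
  next
    case 4
    then have "sg h = - sg g" "oth w g \<notin> Z" using par by auto
    then have "arm_pos w p h = - arm_pos w p g" "arm_pos w p g \<noteq> 0"
      using 4 sg(1) nz[of "oth w g"] X(1) by (auto simp: arm_pos_def)
    then show ?thesis by (auto simp: vec_eq_2)
  next
    case 5
    show ?thesis
    proof (cases "oth w g \<in> Z \<or> oth w h \<in> Z")
      case True
      then have "(p (oth w g) = 0 \<and> p (oth w h) \<noteq> 0) \<or> (p (oth w g) \<noteq> 0 \<and> p (oth w h) = 0)"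
      proof (elim disjE)
        assume a: "oth w g \<in> Z"
        then have "oth w h \<notin> Z" using Z_unique[of "oth w g" "oth w h"] 5(3) by blast
        then show ?thesis using p0[OF a] nz[of "oth w h"] X(2) 5(2) by simp
      next
        assume a: "oth w h \<in> Z"
        then have "oth w g \<notin> Z" using Z_unique[of "oth w g" "oth w h"] 5(3) by blast
        then show ?thesis using p0[OF a] nz[of "oth w g"] X(1) 5(1) by simp
      qed
      then show ?thesis using 5 sg(1) sh(1) by (auto simp: arm_pos_def)
    next
      case False
      then have d: "det2 (p (oth w g)) (p (oth w h)) \<noteq> 0" using dt X 5 by blast
      show ?thesis
      proof
        assume "arm_pos w p g = arm_pos w p h"
        then have "sg g *\<^sub>R p (oth w g) + (- sg h) *\<^sub>R p (oth w h) = 0" using 5 by (simp add: arm_pos_def)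
        then show False using det2_indep[OF d] sg(1) by fastforce
      qed
    qed
  qed
qed

text \<open>An arm ending at the origin is a loop or an edge to \<open>Z\<close>. Loops occur only
  when \<open>Z\<close> is empty, so two such arms would have the same far vertex, and
  \<open>sgsparse_parallel\<close> excludes this for \<open>w\<close> itself and for
  \<open>Z\<close>.\<close>

lemma arms_null_unique:
  assumes E: "sgsparse A Z E" and g: "g \<in> E" "w \<in> ends g" and h: "h \<in> E" "w \<in> ends h"
    and ne: "g \<noteq> h" and w: "w \<notin> Z"
    and null: "oth w g = w \<or> oth w g \<in> Z" "oth w h = w \<or> oth w h \<in> Z"
  shows False
proof -
  have "oth w g = oth w h"
  proof (cases "oth w g = w")
    case True
    then have "Z = {}" using sgsparse_arm(2)[OF E g] Z_sym by blast
    then show ?thesis using True null(2) by simp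
  next
    case False
    then have gZ: "oth w g \<in> Z" using null(1) by simp
    then have "oth w h \<noteq> w" using sgsparse_arm(2)[OF E h] Z_sym by blast
    then show ?thesis using Z_unique[OF gZ] null(2) by simp
  qed
  then show False using sgsparse_parallel[OF E g h ne _ w] null by auto
qed

text \<open>For parallel \<open>g1\<close> and \<open>g2\<close> the ends are \<open>q\<close>,
  \<open>-q\<close> and a point off the line through the origin and \<open>q\<close>. The third arm
  cannot share their far vertex, since three signs are never pairwise opposite.\<close>

lemma arms_det:
  assumes E: "sgsparse A Z E" and g: "g1 \<in> E" "w \<in> ends g1" "g2 \<in> E" "w \<in> ends g2" "g3 \<in> E" "w \<in> ends g3"
    and dist: "g1 \<noteq> g2" "g1 \<noteq> g3" "g2 \<noteq> g3" and w: "w \<notin> Z" and gp: "genpos p X"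
    and X: "\<And>g. g \<in> {g1, g2, g3} \<Longrightarrow> oth w g = w \<or> oth w g \<in> X"
    and nn: "oth w g1 \<noteq> w" "oth w g1 \<notin> Z" "oth w g2 \<noteq> w" "oth w g2 \<notin> Z"
    and c: "(oth w g3 = w \<or> oth w g3 \<in> Z) \<and> oth w g1 \<noteq> oth w g2 \<or>
      (oth w g3 \<noteq> w \<and> oth w g3 \<notin> Z) \<and> (oth w g1 = oth w g2 \<or>
        oth w g1 \<noteq> oth w g2 \<and> oth w g1 \<noteq> oth w g3 \<and> oth w g2 \<noteq> oth w g3)"
  shows "det2 (arm_pos w p g1 - arm_pos w p g3) (arm_pos w p g2 - arm_pos w p g3) \<noteq> 0"
proof -
  note s1 = sgsparse_arm(1)[OF E g(1,2)] and s2 = sgsparse_arm(1)[OF E g(3,4)]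
    and s3 = sgsparse_arm(1)[OF E g(5,6)]
  let ?a = "oth w g1" and ?b = "oth w g2" and ?c = "oth w g3"
  have q: "arm_pos w p g1 = sg g1 *\<^sub>R p ?a" "arm_pos w p g2 = sg g2 *\<^sub>R p ?b"
    using nn by (simp_all add: arm_pos_def)
  have aX: "?a \<in> X" "?b \<in> X" using X[of g1] X[of g2] nn by auto
  from c show ?thesis
  proof (elim disjE conjE)
    assume nul: "?c = w" and ab: "?a \<noteq> ?b"
    then have "arm_pos w p g3 = 0" by (simp add: arm_pos_def)
    then show ?thesis using genposD(3)[OF gp aX(1) nn(2) aX(2) nn(4) ab] s1 s2 unfolding q
      by (auto simp: det2_linear)
  next
    assume nul: "?c \<in> Z" and ab: "?a \<noteq> ?b"
    then have "arm_pos w p g3 = 0" using genposD(1)[OF gp nul] by (simp add: arm_pos_def)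
    then show ?thesis using genposD(3)[OF gp aX(1) nn(2) aX(2) nn(4) ab] s1 s2 unfolding q
      by (auto simp: det2_linear)
  next
    assume nc: "?c \<noteq> w" "?c \<notin> Z" and ab: "?a = ?b"
    have cX: "?c \<in> X" using X[of g3] nc by auto
    have q3: "arm_pos w p g3 = sg g3 *\<^sub>R p ?c" using nc by (simp add: arm_pos_def)
    have s21: "sg g2 = - sg g1" using sgsparse_parallel[OF E g(1-4) dist(1) ab w] by simp
    have ac: "?a \<noteq> ?c"
    proof
      assume "?a = ?c"
      then have "sg g3 = - sg g1" "sg g3 = - sg g2"
        using sgsparse_parallel[OF E g(1,2,5,6) dist(2) _ w] sgsparse_parallel[OF E g(3,4,5,6) dist(3) _ w] ab
        by auto
      then show False using s21 s1 by auto
    qed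
    have "det2 (arm_pos w p g1 - arm_pos w p g3) (arm_pos w p g2 - arm_pos w p g3) =
        - 2 * sg g1 * sg g3 * det2 (p ?a) (p ?c)"
      unfolding q q3 ab[symmetric] s21 by (simp add: det2_def algebra_simps)
    then show ?thesis using genposD(3)[OF gp aX(1) nn(2) cX nc(2) ac] s1 s3 by auto
  next
    assume nc: "?c \<noteq> w" "?c \<notin> Z" and ne: "?a \<noteq> ?b" "?a \<noteq> ?c" "?b \<noteq> ?c"
    have cX: "?c \<in> X" using X[of g3] nc by auto
    have q3: "arm_pos w p g3 = sg g3 *\<^sub>R p ?c" using nc by (simp add: arm_pos_def)
    show ?thesis unfolding q q3
      by (rule genpos_triple[OF gp]) (use aX cX nn nc ne s1 s2 s3 in auto)
  qed
qed

text \<open>The arms can be ordered so that they form a proper triangle, with one exceptional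
  pattern: two parallel edges and an arm that ends at the origin, with the collinear ends
  \<open>q\<close>, \<open>-q\<close> and 0.\<close>

lemma arms_cases:
  assumes E: "sgsparse A Z E" and D: "{e \<in> E. w \<in> ends e} = {e1, e2, e3}"
    and dist: "e1 \<noteq> e2" "e1 \<noteq> e3" "e2 \<noteq> e3" and w: "w \<notin> Z" and gp: "genpos p X"
    and X: "\<forall>g\<in>{e1, e2, e3}. oth w g = w \<or> oth w g \<in> X"
  shows "\<exists>f1 f2 f3. {e1, e2, e3} = {f1, f2, f3} \<and> f1 \<noteq> f2 \<and> f1 \<noteq> f3 \<and> f2 \<noteq> f3 \<and>
    (det2 (arm_pos w p f1 - arm_pos w p f3) (arm_pos w p f2 - arm_pos w p f3) \<noteq> 0 \<or>
     (oth w f1 = oth w f2 \<and> (oth w f3 = w \<or> oth w f3 \<in> Z)))"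
proof -
  let ?D = "{e1, e2, e3}"
  let ?null = "\<lambda>g. oth w g = w \<or> oth w g \<in> Z"
  have DE: "g \<in> E" "w \<in> ends g" if "g \<in> ?D" for g using that D by blast+
  have perm: "\<exists>f1 f2 f3. ?D = {f1, f2, f3} \<and> f1 \<noteq> f2 \<and> f1 \<noteq> f3 \<and> f2 \<noteq> f3 \<and>
      (?null f3 \<or> \<not> ?null f1 \<and> \<not> ?null f2 \<and> \<not> ?null f3 \<and>
        (oth w f1 = oth w f2 \<or> oth w f1 \<noteq> oth w f2 \<and> oth w f1 \<noteq> oth w f3 \<and> oth w f2 \<noteq> oth w f3))"
  proof -
    consider "?null e1" | "?null e2" | "?null e3" | (non) "\<not> ?null e1" "\<not> ?null e2" "\<not> ?null e3" by blast
    then show ?thesis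
    proof cases
      case 1
      then show ?thesis using dist by (intro exI[of _ e2] exI[of _ e3] exI[of _ e1]) auto
    next
      case 2
      then show ?thesis using dist by (intro exI[of _ e1] exI[of _ e3] exI[of _ e2]) auto
    next
      case 3
      then show ?thesis using dist by (intro exI[of _ e1] exI[of _ e2] exI[of _ e3]) auto
    next
      case non
      consider "oth w e1 = oth w e2" | "oth w e1 = oth w e3" | "oth w e2 = oth w e3"
        | "oth w e1 \<noteq> oth w e2" "oth w e1 \<noteq> oth w e3" "oth w e2 \<noteq> oth w e3" by blast
      then show ?thesis
      proof cases
        case 1
        then show ?thesis using dist non by (intro exI[of _ e1] exI[of _ e2] exI[of _ e3]) auto
      next
        case 2
        then show ?thesis using dist non by (intro exI[of _ e1] exI[of _ e3] exI[of _ e2]) auto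
      next
        case 3
        then show ?thesis using dist non by (intro exI[of _ e2] exI[of _ e3] exI[of _ e1]) auto
      next
        case 4
        then show ?thesis using dist non by (intro exI[of _ e1] exI[of _ e2] exI[of _ e3]) auto
      qed
    qed
  qed
  then obtain f1 f2 f3 where f: "?D = {f1, f2, f3}" "f1 \<noteq> f2" "f1 \<noteq> f3" "f2 \<noteq> f3"
    and c: "?null f3 \<or> \<not> ?null f1 \<and> \<not> ?null f2 \<and> \<not> ?null f3 \<and>
        (oth w f1 = oth w f2 \<or> oth w f1 \<noteq> oth w f2 \<and> oth w f1 \<noteq> oth w f3 \<and> oth w f2 \<noteq> oth w f3)"
    by (elim exE conjE)
  have fD: "f1 \<in> ?D" "f2 \<in> ?D" "f3 \<in> ?D" unfolding f(1) by simp_all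
  have fE: "f1 \<in> E" "w \<in> ends f1" "f2 \<in> E" "w \<in> ends f2" "f3 \<in> E" "w \<in> ends f3" using DE fD by blast+
  have n12: "\<not> ?null f1" "\<not> ?null f2"
    using c arms_null_unique[OF E fE(1,2,5,6) f(3) w] arms_null_unique[OF E fE(3,4,5,6) f(4) w] by blast+
  have X': "oth w g = w \<or> oth w g \<in> X" if "g \<in> {f1, f2, f3}" for g
    using X that unfolding f(1) by blast
  have "det2 (arm_pos w p f1 - arm_pos w p f3) (arm_pos w p f2 - arm_pos w p f3) \<noteq> 0"
    if "\<not> (oth w f1 = oth w f2 \<and> ?null f3)"
    by (rule arms_det[OF E fE f(2-4) w gp X']) (use n12 c that in auto)
  then show ?thesis using f by (intro exI[of _ f1] exI[of _ f2] exI[of _ f3]) auto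
qed

text \<open>With \<open>w\<close> halfway between the far ends of \<open>e1\<close> and
  \<open>e2\<close>, equilibrium forces the weights \<open>(l, l, 0)\<close>. Up to a factor these
  test the bar between the two far ends, which the motion \<open>m\<close> violates. This is the
  classical replacement of a bar by a vertex of degree three.\<close>

lemma extend_midpoint:
  assumes E: "sgsparse A Z E" and D: "{e \<in> E. w \<in> ends e} = {e1, e2, e3}"
    and dist: "e1 \<noteq> e2" "e1 \<noteq> e3" "e2 \<noteq> e3"
    and K: "K = {e \<in> E. w \<notin> ends e}" and ind: "indep A p K"
    and det: "det2 (arm_pos w p e1 - arm_pos w p e3) (arm_pos w p e2 - arm_pos w p e3) \<noteq> 0"
    and m: "\<forall>k\<in>K. erow A p m k = 0"
      "(arm_pos w p e1 - arm_pos w p e2) \<bullet> (arm_mot A w m e1 - arm_mot A w m e2) \<noteq> 0"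
  shows "\<exists>x. indep A (p(w := x)) E"
proof
  let ?q1 = "arm_pos w p e1" and ?q2 = "arm_pos w p e2" and ?q3 = "arm_pos w p e3"
  let ?x = "(1/2) *\<^sub>R (?q1 + ?q2)"
  show "indep A (p(w := ?x)) E"
  proof (rule indep_extend[OF sgsparse_finite[OF E] K D[symmetric] _ _ ind])
    fix e assume "e \<in> {e1, e2, e3}"
    then have e: "e \<in> E" "w \<in> ends e" using D by blast+
    show "sg e = 1 \<or> sg e = -1" by (rule sgsparse_arm(1)[OF E e])
    show "\<not> A \<and> sg e = -1" if "oth w e = w" by (rule sgsparse_arm(2)[OF E e that])
  next
    fix l assume l: "(\<Sum>e\<in>{e1, e2, e3}. l e *\<^sub>R (?x - arm_pos w p e)) = 0"
      and lm: "\<And>m. \<forall>f\<in>K. erow A p m f = 0 \<Longrightarrow>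
        (\<Sum>e\<in>{e1, e2, e3}. l e * ((?x - arm_pos w p e) \<bullet> arm_mot A w m e)) = 0"
    have "(l e2 + l e3 - l e1) *\<^sub>R (?q1 - ?q3) + (l e1 + l e3 - l e2) *\<^sub>R (?q2 - ?q3) =
        2 *\<^sub>R (\<Sum>e\<in>{e1, e2, e3}. l e *\<^sub>R (?x - arm_pos w p e))"
      using dist by (simp add: vec_eq_2 field_simps)
    then have "(l e2 + l e3 - l e1) *\<^sub>R (?q1 - ?q3) + (l e1 + l e3 - l e2) *\<^sub>R (?q2 - ?q3) = 0"
      using l by simp
    from det2_indep[OF det this] have l12: "l e2 = l e1" "l e3 = 0" by simp_all
    have "l e1 * ((?q1 - ?q2) \<bullet> (arm_mot A w m e1 - arm_mot A w m e2)) =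
        - 2 * (\<Sum>e\<in>{e1, e2, e3}. l e * ((?x - arm_pos w p e) \<bullet> arm_mot A w m e))"
      using dist l12 by (simp add: inner_2 field_simps)
    then have "l e1 = 0" using lm[OF m(1)] m(2) by simp
    then show "\<forall>e\<in>{e1, e2, e3}. l e = 0" using l12 by simp
  qed
qed

text \<open>The ends are \<open>q\<close>, \<open>-q\<close> and 0. For \<open>w\<close> off their
  line, equilibrium forces the weights \<open>(l, l, -2 l)\<close>, and what remains is
  \<open>p a\<close> against \<open>m a\<close>, the row of a loop at \<open>a\<close>.\<close>

lemma extend_parallel_sym:
  assumes E: "sgsparse A Z E" and D: "{e \<in> E. w \<in> ends e} = {e1, e2, e3}"
    and dist: "e1 \<noteq> e2" "e1 \<noteq> e3" "e2 \<noteq> e3"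
    and K: "K = {e \<in> E. w \<notin> ends e}" and ind: "indep A p K"
    and o: "oth w e1 = a" "oth w e2 = a" "a \<noteq> w" "oth w e3 = w" and s: "sg e2 = - sg e1"
    and m: "\<forall>k\<in>K. erow A p m k = 0" "p a \<bullet> m a \<noteq> 0"
  shows "\<exists>x. indep A (p(w := x)) E"
proof
  have DE: "g \<in> E" "w \<in> ends g" if "g \<in> {e1, e2, e3}" for g using that D by blast+
  have nA: "\<not> A" using sgsparse_arm(2)[OF E DE[of e3]] o by simp
  have s1: "sg e1 = 1 \<or> sg e1 = -1" using sgsparse_arm(1)[OF E DE[of e1]] by simp
  let ?q = "sg e1 *\<^sub>R p a"
  have q: "arm_pos w p e1 = ?q" "arm_pos w p e2 = - ?q" "arm_pos w p e3 = 0"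
    using o s by (simp_all add: arm_pos_def)
  have am: "arm_mot A w m e1 = sg e1 *\<^sub>R m a" "arm_mot A w m e2 = - (sg e1 *\<^sub>R m a)" "arm_mot A w m e3 = 0"
    for m using o s nA by (simp_all add: arm_mot_def chi_def)
  let ?x = "rotJ (p a)"
  have pa: "p a \<noteq> 0" using m(2) by auto
  have "det2 ?x (p a) = - (p a \<bullet> p a)" by (simp add: det2_def inner_2)
  then have det: "det2 ?x (p a) \<noteq> 0" using pa by simp
  show "indep A (p(w := ?x)) E"
  proof (rule indep_extend[OF sgsparse_finite[OF E] K D[symmetric] _ _ ind])
    fix e assume "e \<in> {e1, e2, e3}"
    then have e: "e \<in> E" "w \<in> ends e" using DE by blast+
    show "sg e = 1 \<or> sg e = -1" by (rule sgsparse_arm(1)[OF E e])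
    show "\<not> A \<and> sg e = -1" if "oth w e = w" by (rule sgsparse_arm(2)[OF E e that])
  next
    fix l assume l: "(\<Sum>e\<in>{e1, e2, e3}. l e *\<^sub>R (?x - arm_pos w p e)) = 0"
      and lm: "\<And>m. \<forall>f\<in>K. erow A p m f = 0 \<Longrightarrow>
        (\<Sum>e\<in>{e1, e2, e3}. l e * ((?x - arm_pos w p e) \<bullet> arm_mot A w m e)) = 0"
    have "(l e1 + l e2 + l e3) *\<^sub>R ?x + (sg e1 * (l e2 - l e1)) *\<^sub>R p a =
        (\<Sum>e\<in>{e1, e2, e3}. l e *\<^sub>R (?x - arm_pos w p e))"
      using dist by (simp add: q algebra_simps)
    then have "(l e1 + l e2 + l e3) *\<^sub>R ?x + (sg e1 * (l e2 - l e1)) *\<^sub>R p a = 0"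
      using l by simp
    from det2_indep[OF det this] have l12: "l e2 = l e1" "l e3 = - 2 * l e1" using s1 by auto
    have "(\<Sum>e\<in>{e1, e2, e3}. l e * ((?x - arm_pos w p e) \<bullet> arm_mot A w m e)) = - 2 * l e1 * (p a \<bullet> m a)"
      using dist l12 s1 by (auto simp: q am inner_2 algebra_simps)
    then have "l e1 = 0" using lm[OF m(1)] m(2) by simp
    then show "\<forall>e\<in>{e1, e2, e3}. l e = 0" using l12 by simp
  qed
qed

text \<open>Again the weights are \<open>(l, l, -2 l)\<close>, but now \<open>x\<close> is tested
  against \<open>m z - m a\<close>. Since \<open>x\<close> may still be chosen freely off the line
  of \<open>p a\<close>, any relative motion of \<open>a\<close> and \<open>z\<close> suffices,
  including one perpendicular to \<open>p a\<close>.\<close>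

lemma extend_parallel_anti:
  assumes E: "sgsparse A Z E" and D: "{e \<in> E. w \<in> ends e} = {e1, e2, e3}"
    and dist: "e1 \<noteq> e2" "e1 \<noteq> e3" "e2 \<noteq> e3"
    and K: "K = {e \<in> E. w \<notin> ends e}" and ind: "indep A p K"
    and o: "oth w e1 = a" "oth w e2 = a" "a \<noteq> w" "oth w e3 = z" "z \<noteq> w" "z \<in> Z" "p z = 0"
    and s: "sg e2 = - sg e1" and pa: "p a \<noteq> 0"
    and m: "\<forall>k\<in>K. erow A p m k = 0" "m a \<noteq> m z"
  shows "\<exists>x. indep A (p(w := x)) E"
proof -
  have A: A using Z_sym o(6) by blast
  have DE: "g \<in> E" "w \<in> ends g" if "g \<in> {e1, e2, e3}" for g using that D by blast+
  have s1: "sg e1 = 1 \<or> sg e1 = -1" using sgsparse_arm(1)[OF E DE[of e1]] by simp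
  let ?q = "sg e1 *\<^sub>R p a"
  have q: "arm_pos w p e1 = ?q" "arm_pos w p e2 = - ?q" "arm_pos w p e3 = 0"
    using o s by (simp_all add: arm_pos_def)
  have am: "arm_mot A w m e1 = m a" "arm_mot A w m e2 = m a" "arm_mot A w m e3 = m z"
    for m using o A by (simp_all add: arm_mot_def chi_def)
  have "m z - m a \<noteq> 0" using m(2) by simp
  from ex_two_directions[OF pa this] obtain x where det: "det2 x (p a) \<noteq> 0" and x: "x \<bullet> (m z - m a) \<noteq> 0"
    by (elim exE conjE)
  have "indep A (p(w := x)) E"
  proof (rule indep_extend[OF sgsparse_finite[OF E] K D[symmetric] _ _ ind])
    fix e assume "e \<in> {e1, e2, e3}"
    then have e: "e \<in> E" "w \<in> ends e" using DE by blast+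
    show "sg e = 1 \<or> sg e = -1" by (rule sgsparse_arm(1)[OF E e])
    show "\<not> A \<and> sg e = -1" if "oth w e = w" by (rule sgsparse_arm(2)[OF E e that])
  next
    fix l assume l: "(\<Sum>e\<in>{e1, e2, e3}. l e *\<^sub>R (x - arm_pos w p e)) = 0"
      and lm: "\<And>m. \<forall>f\<in>K. erow A p m f = 0 \<Longrightarrow>
        (\<Sum>e\<in>{e1, e2, e3}. l e * ((x - arm_pos w p e) \<bullet> arm_mot A w m e)) = 0"
    have "(l e1 + l e2 + l e3) *\<^sub>R x + (sg e1 * (l e2 - l e1)) *\<^sub>R p a =
        (\<Sum>e\<in>{e1, e2, e3}. l e *\<^sub>R (x - arm_pos w p e))"
      using dist by (simp add: q algebra_simps)
    then have "(l e1 + l e2 + l e3) *\<^sub>R x + (sg e1 * (l e2 - l e1)) *\<^sub>R p a = 0"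
      using l by simp
    from det2_indep[OF det this] have l12: "l e2 = l e1" "l e3 = - 2 * l e1" using s1 by auto
    have "(\<Sum>e\<in>{e1, e2, e3}. l e * ((x - arm_pos w p e) \<bullet> arm_mot A w m e)) = - 2 * l e1 * (x \<bullet> (m z - m a))"
      using dist l12 by (simp add: q am inner_2 algebra_simps)
    then have "l e1 = 0" using lm[OF m(1)] x by simp
    then show "\<forall>e\<in>{e1, e2, e3}. l e = 0" using l12 by simp
  qed
  then show ?thesis by (intro exI)
qed

text \<open>With at most two arms, equilibrium at \<open>w\<close> alone forces zero weights as soon
  as \<open>w\<close> lies off the line through their far ends, or, for a single arm, away from its
  end.\<close>

lemma extend_low_degree:
  assumes E: "sgsparse A Z E" and K: "K = {e \<in> E. w \<notin> ends e}" and ind: "indep A p K"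
    and d: "deg E w \<le> 2"
    and q: "\<And>g h. g \<in> E \<Longrightarrow> w \<in> ends g \<Longrightarrow> h \<in> E \<Longrightarrow> w \<in> ends h \<Longrightarrow> g \<noteq> h \<Longrightarrow>
      arm_pos w p g \<noteq> arm_pos w p h"
  shows "\<exists>x. indep A (p(w := x)) E"
proof -
  define D where "D = {e \<in> E. w \<in> ends e}"
  have finD: "finite D" using sgsparse_finite[OF E] by (simp add: D_def)
  have "\<exists>x. \<forall>l. (\<Sum>e\<in>D. l e *\<^sub>R (x - arm_pos w p e)) = 0 \<longrightarrow> (\<forall>e\<in>D. l e = 0)"
  proof -
    have "card D = 0 \<or> card D = 1 \<or> card D = 2" using d unfolding deg_def D_def[symmetric] by arith
    then consider "card D = 0" | "card D = 1" | "card D = 2" by (elim disjE)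
    then show ?thesis
    proof cases
      case 1
      then show ?thesis using finD by simp
    next
      case 2
      then obtain g where g: "D = {g}" by (auto simp: card_1_singleton_iff)
      show ?thesis by (rule exI[of _ "arm_pos w p g + axis 1 1"]) (simp add: g)
    next
      case 3
      then obtain g h where gh: "D = {g, h}" "g \<noteq> h" by (auto simp: card_2_iff)
      let ?d = "arm_pos w p g - arm_pos w p h"
      have "g \<in> D" "h \<in> D" using gh by simp_all
      then have "arm_pos w p g \<noteq> arm_pos w p h" using q[of g h] gh(2) by (simp add: D_def)
      then have d: "?d \<noteq> 0" by simp
      have "det2 (rotJ ?d) (rotJ ?d + ?d) = - (?d \<bullet> ?d)" by (simp add: det2_def inner_2 algebra_simps)
      then have det: "det2 (rotJ ?d) (rotJ ?d + ?d) \<noteq> 0" using d by (metis inner_eq_zero_iff neg_equal_0_iff_equal)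
      show ?thesis
      proof (intro exI[of _ "arm_pos w p g + rotJ ?d"] allI impI)
        fix l assume "(\<Sum>e\<in>D. l e *\<^sub>R (arm_pos w p g + rotJ ?d - arm_pos w p e)) = 0"
        then have "l g *\<^sub>R rotJ ?d + l h *\<^sub>R (rotJ ?d + ?d) = 0" using gh by (simp add: algebra_simps)
        from det2_indep[OF det this] show "\<forall>e\<in>D. l e = 0" using gh by simp
      qed
    qed
  qed
  then obtain x where x: "\<forall>l. (\<Sum>e\<in>D. l e *\<^sub>R (x - arm_pos w p e)) = 0 \<longrightarrow> (\<forall>e\<in>D. l e = 0)" by (elim exE)
  have "indep A (p(w := x)) E"
  proof (rule indep_extend[OF sgsparse_finite[OF E] K D_def _ _ ind])
    fix e assume "e \<in> D"
    then have e: "e \<in> E" "w \<in> ends e" by (simp_all add: D_def)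
    show "sg e = 1 \<or> sg e = -1" by (rule sgsparse_arm(1)[OF E e])
    show "\<not> A \<and> sg e = -1" if "oth w e = w" by (rule sgsparse_arm(2)[OF E e that])
  qed (use x in simp)
  then show ?thesis by (intro exI)
qed

text \<open>Restoring three arms adds three edges and one vertex. A subgraph that attains the global
  bound on a vertex set containing all their far ends would thus push the count one too
  high.\<close>

lemma tight_no_arms:
  assumes E: "sgsparse A Z E" and D: "{e \<in> E. w \<in> ends e} = {e1, e2, e3}"
    and dist: "e1 \<noteq> e2" "e1 \<noteq> e3" "e2 \<noteq> e3"
    and F: "F \<subseteq> {e \<in> E. w \<notin> ends e}" and Y: "finite Y" "VF F \<subseteq> Y" "w \<notin> Y"
    and oY: "\<forall>g\<in>{e1, e2, e3}. oth w g = w \<or> oth w g \<in> Y"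
  shows "card F + lam A < 2 * card Y"
proof -
  let ?D = "{e1, e2, e3}"
  have DE: "g \<in> E" "w \<in> ends g" if "g \<in> ?D" for g using that D by blast+
  have finF: "finite F" using sgsparse_finite[OF E] F finite_subset by fastforce
  have FDE: "F \<union> ?D \<subseteq> E" using F DE(1) by auto
  have dj: "F \<inter> ?D = {}" using F DE(2) by blast
  have cD: "card (F \<union> ?D) = card F + 3" using dj finF dist by (subst card_Un_disjoint) auto
  have VD: "VF (F \<union> ?D) \<subseteq> insert w Y"
    using Y(2) ends_oth[OF DE(2)] oY by (auto simp: VF_def)
  have cV: "card (VF (F \<union> ?D)) \<le> Suc (card Y)"
    using card_mono[OF _ VD] Y by simp
  show ?thesis using sgsparse_lam[OF E FDE] cD cV by simp
qed

lemma signed_sub: "sgsparse A Z E \<Longrightarrow> F \<subseteq> E \<Longrightarrow> signed F"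
  using sgsparse_subset unfolding sgsparse_def by blast

text \<open>If \<open>a\<close> and \<open>z\<close> never moved apart, the subgraph blocking the edge \<open>az\<close> would be balanced and move
  by translations.  Then the negative of one of its edges would be blocked as well, and the union of
  both blocking subgraphs would be too dense.\<close>

lemma anti_motion:
  assumes E: "sgsparse A Z E" and D: "{e \<in> E. w \<in> ends e} = {e1, e2, e3}"
    and dist: "e1 \<noteq> e2" "e1 \<noteq> e3" "e2 \<noteq> e3"
    and K: "K = {e \<in> E. w \<notin> ends e}" "VF K \<subseteq> X" and p: "good p X" and wX: "w \<notin> X"
    and o: "oth w e1 = a" "oth w e2 = a" "a \<noteq> w" "a \<notin> Z" "a \<in> X" "oth w e3 = z" "z \<in> Z" "z \<in> X"
    and noz: "\<And>f. f \<in> K \<Longrightarrow> a \<in> ends f \<Longrightarrow> oth a f \<notin> Z"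
  shows "\<exists>m. (\<forall>k\<in>K. erow A p m k = 0) \<and> m a \<noteq> m z"
proof (rule ccontr)
  assume neg: "\<not> (\<exists>m. (\<forall>k\<in>K. erow A p m k = 0) \<and> m a \<noteq> m z)"
  have eq: "m a = m z" if "\<forall>k\<in>K. erow A p m k = 0" for m using neg that by blast
  have A: A using Z_sym o(7) by blast
  have Kp: "sgsparse A Z K" using sgsparse_subset[OF E] K by simp
  have finK: "finite K" by (rule sgsparse_finite[OF Kp])
  note gp = goodD(1)[OF p]
  have p0: "\<forall>z\<in>Z. p z = 0" using genposD(1)[OF gp] by blast
  have az: "a \<noteq> z" using o by blast
  have pz: "p z = 0" "p a \<noteq> 0" using p0 o genposD(2)[OF gp] by simp_all
  have sub: "finite F" "indep A p F" "signed F" "VF F \<subseteq> X" if "F \<subseteq> K" for F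
  proof -
    show "finite F" using that finK finite_subset by blast
    show V: "VF F \<subseteq> X" using VF_mono[OF that] K(2) by blast
    show "indep A p F" by (rule goodD(2)[OF p sgsparse_subset[OF Kp that] V])
    show "signed F" by (rule signed_sub[OF Kp that])
  qed
  have chi1: "chi A s = 1" for s using A by (simp add: chi_def)
  have van1: "erow A p m (a, z, 1) = 0" if "\<forall>k\<in>K. erow A p m k = 0" for m
    using eq[OF that] by (simp add: chi1)
  have "\<exists>F\<subseteq>K. card F + lam A = 2 * card (VF (insert (a, z, 1) F)) \<or>
      (bal Z (insert (a, z, 1) F) \<and> card F + 3 = 2 * card (VF (insert (a, z, 1) F)))"
    by (rule blocked[OF Kp K(2) p _ _ o(5) o(8) _ van1, of 1]) (use az in simp_all)
  then obtain F where F: "F \<subseteq> K" "card F + lam A = 2 * card (VF (insert (a, z, 1) F)) \<or>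
      (bal Z (insert (a, z, 1) F) \<and> card F + 3 = 2 * card (VF (insert (a, z, 1) F)))"
    by (elim exE conjE)
  define Y where "Y = VF (insert (a, z, 1 :: real) F)"
  note sF = sub[OF F(1)]
  have Y: "finite Y" "VF F \<subseteq> Y" "Y \<subseteq> X" "a \<in> Y" "z \<in> Y" using sF o by (auto simp: Y_def)
  have oY: "\<forall>g\<in>{e1, e2, e3}. oth w g = w \<or> oth w g \<in> Y" using o Y by simp
  have FKE: "F \<subseteq> {e \<in> E. w \<notin> ends e}" using F(1) K(1) by simp
  have "w \<notin> Y" using Y(3) wX by blast
  \<comment> \<open>\<open>Y\<close> contains the far ends of all arms at \<open>w\<close>, which
    rules out global tightness and leaves the balanced alternative.\<close>
  then have "card F + lam A < 2 * card Y" by (rule tight_no_arms[OF E D dist FKE Y(1,2) _ oY])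
  then have b: "bal Z (insert (a, z, 1) F)" "card F + 3 = 2 * card Y" using F(2) by (auto simp: Y_def)
  then obtain \<sigma> where s0: "potential Z \<sigma> (insert (a, z, 1) F)" unfolding bal_def by (elim exE)
  have pot: "potential Z \<sigma> F" by (rule potential_subset[OF s0]) blast
  note pm = potential_pm[OF pot]
  have dist_az: "\<sigma> a *\<^sub>R p a \<noteq> \<sigma> z *\<^sub>R p z" using pz pm[of a] by auto
  have motF: "\<exists>t c. \<forall>u\<in>Y. m u = tmot A \<sigma> p t c u" if "\<forall>k\<in>F. erow A p m k = 0" for m
    by (rule tight_motions_bal[OF sF(1-3) Y(1,2) b(2) that pot p0 Y(4,5) dist_az])
  have tA: "tmot A \<sigma>' p t c u = t + (c * \<sigma>' u) *\<^sub>R rotJ (p u)" for \<sigma>' t c u by (simp add: tmot_def chi1)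
  \<comment> \<open>Otherwise \<open>F\<close> would be a star at \<open>z\<close> without parallel
    edges and, by \<open>noz\<close>, without the leaf \<open>a\<close>. It would have at most
    \<open>card Y - 2\<close> edges, fewer than the \<open>2 * card Y - 3\<close> that it
    has.\<close>
  have "\<exists>f\<in>F. ends f \<inter> Z = {}"
  proof (rule ccontr)
    assume "\<not> (\<exists>f\<in>F. ends f \<inter> Z = {})"
    then have none: "\<forall>f\<in>F. ends f \<inter> Z \<noteq> {}" by simp
    have zf: "z \<in> ends f" if fF: "f \<in> F" for f
    proof -
      obtain z' where "z' \<in> ends f" "z' \<in> Z" using bspec[OF none fF] by blast
      then show ?thesis using Z_unique[OF o(7), of z'] by simp
    qed
    have FE: "f \<in> E" if "f \<in> F" for f using that FKE by blast
    have oz: "oth z f \<noteq> z" "oth z f \<notin> Z" "oth z f \<in> ends f" "oth (oth z f) f = z" if "f \<in> F" for f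
    proof -
      show 1: "oth z f \<noteq> z" using sgsparse_arm(2)[OF E FE[OF that] zf[OF that]] A by blast
      then show "oth z f \<notin> Z" using Z_unique[OF o(7), of "oth z f"] by auto
      show "oth z f \<in> ends f" by (rule oth_in_ends[OF zf[OF that]])
      show "oth (oth z f) f = z" using 1 zf[OF that] by (cases f) (auto simp: oth_simps)
    qed
    have inj: "inj_on (oth z) F"
    proof (rule inj_onI, rule ccontr)
      fix f g assume fg: "f \<in> F" "g \<in> F" "oth z f = oth z g" "f \<noteq> g"
      have "oth (oth z f) f \<notin> Z"
        using sgsparse_parallel[OF E FE[OF fg(1)] oz(3)[OF fg(1)] FE[OF fg(2)] _ fg(4) _ oz(2)[OF fg(1)]]
          oz(3,4)[OF fg(2)] oz(4)[OF fg(1)] fg(3) by simp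
      then show False using oz(4)[OF fg(1)] o(7) by simp
    qed
    have "oth z ` F \<subseteq> Y - {z, a}"
    proof
      fix u assume "u \<in> oth z ` F"
      then obtain f where f: "f \<in> F" "u = oth z f" by blast
      have "u \<noteq> a"
      proof
        assume "u = a"
        then have "a \<in> ends f" "oth a f \<in> Z" using oz(3,4)[OF f(1)] f(2) o(7) by simp_all
        then show False using noz[of f] f(1) F(1) by blast
      qed
      moreover have "u \<in> Y" using oz(3)[OF f(1)] f ends_subset_VF[OF f(1)] Y(2) by blast
      ultimately show "u \<in> Y - {z, a}" using oz(1)[OF f(1)] f(2) by simp
    qed
    then have "card F \<le> card (Y - {z, a})" by (rule card_inj_on_le[OF inj]) (use Y in simp)
    also have "card (Y - {z, a}) = card Y - 2" using Y az by (simp add: card_Diff_subset)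
    finally have "card F \<le> card Y - 2" .
    moreover have "card {z, a} \<le> card Y" using Y by (intro card_mono) auto
    ultimately show False using b(2) az by simp
  qed
  then obtain f where f: "f \<in> F" "ends f \<inter> Z = {}" by blast
  obtain y y' s where f': "f = (y, y', s)" by (cases f)
  have yZ: "y \<notin> Z" "y' \<notin> Z" using f f' by auto
  have yY: "y \<in> Y" "y' \<in> Y" using ends_subset_VF[OF f(1)] Y(2) f' by auto
  have fE: "(y, y', s) \<in> E" using f f' FKE by blast
  have yy: "y \<noteq> y'" using sgsparse_loop[OF E, of y s] fE A by blast
  have ss: "s = \<sigma> y * \<sigma> y'" by (rule potential_edge[OF pot _ yZ]) (use f f' in simp)
  have s1: "s = 1 \<or> s = -1" by (rule sgsparse_signed[OF E fE])
  have det: "det2 (p y) (p y') \<noteq> 0" by (rule genposD(3)[OF gp]) (use yY yZ Y yy in auto)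
  \<comment> \<open>As \<open>a\<close> and \<open>z\<close> move alike, the rotation part on
    \<open>Y\<close> is zero. Translations respect edges of either sign in the anti-symmetric
    case.\<close>
  have van2: "erow A p m (y, y', - s) = 0" if m: "\<forall>k\<in>K. erow A p m k = 0" for m
  proof -
    have "\<forall>k\<in>F. erow A p m k = 0" using m F(1) by blast
    from motF[OF this] obtain t c where tc: "\<forall>u\<in>Y. m u = tmot A \<sigma> p t c u" by (elim exE)
    have "(c * \<sigma> a) *\<^sub>R rotJ (p a) = 0" using eq[OF m] tc Y(4,5) pz by (simp add: tA rotJ_linear)
    then have "c = 0" using pz pm[of a] by auto
    then show ?thesis using tc yY by (simp add: tA chi1)
  qed
  have "\<exists>F2\<subseteq>K. card F2 + lam A = 2 * card (VF (insert (y, y', - s) F2)) \<or>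
      (bal Z (insert (y, y', - s) F2) \<and> card F2 + 3 = 2 * card (VF (insert (y, y', - s) F2)))"
    by (rule blocked[OF Kp K(2) p _ _ _ _ _ van2, where a = y and b = y' and s = "- s"]) (use yy s1 yY Y in auto)
  then obtain F2 where F2: "F2 \<subseteq> K" "card F2 + lam A = 2 * card (VF (insert (y, y', - s) F2)) \<or>
      (bal Z (insert (y, y', - s) F2) \<and> card F2 + 3 = 2 * card (VF (insert (y, y', - s) F2)))"
    by (elim exE conjE)
  define Y2 where "Y2 = VF (insert (y, y', - s) F2)"
  note sF2 = sub[OF F2(1)]
  have Y2: "finite Y2" "VF F2 \<subseteq> Y2" "Y2 \<subseteq> X" "y \<in> Y2" "y' \<in> Y2" using sF2 yY Y by (auto simp: Y2_def)
  \<comment> \<open>Either \<open>F2\<close> is balanced together with the edge of the wrong sign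
    \<open>- s\<close>, or its motions are translations.\<close>
  have mot2: "\<exists>\<sigma>' t c. (\<forall>x. \<sigma>' x = 1 \<or> \<sigma>' x = -1) \<and> (\<forall>u\<in>Y2. m u = tmot A \<sigma>' p t c u) \<and>
      (\<sigma>' y * \<sigma>' y' = - s \<or> c = 0)" if m: "\<forall>k\<in>F2. erow A p m k = 0" for m
  proof (cases "card F2 + lam A = 2 * card Y2")
    case True
    have "\<exists>t c. glob A t c \<and> (\<forall>u\<in>Y2. m u = tmot A (\<lambda>_. 1) p t c u)"
      by (rule tight_motions_glob[OF sF2(1-3) Y2(1,2) True m _ Y2(4)]) (use A in simp_all)
    then obtain t c where tc: "glob A t c" "\<forall>u\<in>Y2. m u = tmot A (\<lambda>_. 1) p t c u" by (elim exE conjE)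
    have "c = 0" using tc(1) A by (simp add: glob_def)
    then show ?thesis
      using tc(2) by (intro exI[of _ "\<lambda>_. 1 :: real"] exI[of _ t] exI[of _ c]) simp
  next
    case False
    then have b2: "bal Z (insert (y, y', - s) F2)" "card F2 + 3 = 2 * card Y2" using F2(2) by (auto simp: Y2_def)
    then obtain \<sigma>' where s2: "potential Z \<sigma>' (insert (y, y', - s) F2)" unfolding bal_def by (elim exE)
    note pm2 = potential_pm[OF s2]
    have s2': "- s = \<sigma>' y * \<sigma>' y'" by (rule potential_edge[OF s2 _ yZ]) simp
    have pot2: "potential Z \<sigma>' F2" by (rule potential_subset[OF s2]) blast
    have "\<sigma>' y *\<^sub>R p y \<noteq> \<sigma>' y' *\<^sub>R p y'"
    proof
      assume "\<sigma>' y *\<^sub>R p y = \<sigma>' y' *\<^sub>R p y'"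
      then have "\<sigma>' y *\<^sub>R p y + (- \<sigma>' y') *\<^sub>R p y' = 0" by simp
      then show False using det2_indep[OF det] pm2[of y] by fastforce
    qed
    then have "\<exists>t c. \<forall>u\<in>Y2. m u = tmot A \<sigma>' p t c u"
      by (rule tight_motions_bal[OF sF2(1-3) Y2(1,2) b2(2) m pot2 p0 Y2(4,5)])
    then show ?thesis using s2' pm2 by (elim exE, intro exI[of _ \<sigma>'] exI conjI) auto
  qed
  define U where "U = F \<union> F2"
  define W where "W = Y \<union> Y2"
  have UW: "finite U" "finite W" "VF U \<subseteq> W" "y \<in> W" using sF(1) sF2(1) Y Y2 by (auto simp: U_def W_def)
  have UE: "U \<subseteq> {e \<in> E. w \<notin> ends e}" using F(1) F2(1) K(1) by (simp add: U_def)
  have "w \<notin> W" using Y(3) Y2(3) wX by (auto simp: W_def)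
  moreover have "\<forall>g\<in>{e1, e2, e3}. oth w g = w \<or> oth w g \<in> W" using o Y by (simp add: W_def)
  ultimately have "card U + lam A < 2 * card W" by (rule tight_no_arms[OF E D dist UE UW(2,3)])
  \<comment> \<open>Two pins at \<open>y\<close> remove the translations; the rotations will be
    removed by the conflict of signs on the edge between \<open>y\<close> and
    \<open>y'\<close>.\<close>
  then have "length [(y, axis 1 1 :: real^2), (y, axis 2 1)] + card U < 2 * card W" using A by (simp add: lam_def)
  then have "\<exists>m. (\<exists>u\<in>W. m u \<noteq> 0) \<and> (\<forall>f\<in>U. erow A p m f = 0) \<and>
      (\<forall>(a, d)\<in>set [(y, axis 1 1 :: real^2), (y, axis 2 1)]. d \<bullet> m a = 0)"
    by (rule homogeneous_motion[OF UW(1-3)]) (use UW(4) in auto)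
  then obtain m where m: "\<exists>u\<in>W. m u \<noteq> 0" "\<forall>f\<in>U. erow A p m f = 0"
      "\<forall>(a, d)\<in>set [(y, axis 1 1 :: real^2), (y, axis 2 1)]. d \<bullet> m a = 0" by (elim exE conjE)
  have my: "m y = 0" using m(3) by (simp add: axis_inner vec_eq_2)
  have mF: "\<forall>k\<in>F. erow A p m k = 0" "\<forall>k\<in>F2. erow A p m k = 0" using m(2) by (simp_all add: U_def)
  from motF[OF mF(1)] obtain t c where tc: "\<forall>u\<in>Y. m u = tmot A \<sigma> p t c u" by (elim exE)
  from mot2[OF mF(2)] obtain \<sigma>' t' c' where pm': "\<forall>x. \<sigma>' x = 1 \<or> \<sigma>' x = -1"
    and tc': "\<forall>u\<in>Y2. m u = tmot A \<sigma>' p t' c' u" and c': "\<sigma>' y * \<sigma>' y' = - s \<or> c' = 0" by (elim exE conjE)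
  have e1: "t + (c * \<sigma> y) *\<^sub>R rotJ (p y) = t' + (c' * \<sigma>' y) *\<^sub>R rotJ (p y)"
    and e2: "t + (c * \<sigma> y') *\<^sub>R rotJ (p y') = t' + (c' * \<sigma>' y') *\<^sub>R rotJ (p y')"
    using bspec[OF tc yY(1)] bspec[OF tc yY(2)] bspec[OF tc' Y2(4)] bspec[OF tc' Y2(5)]
    by (simp_all add: tA)
  have "rotJ ((c * \<sigma> y - c' * \<sigma>' y) *\<^sub>R p y + (c' * \<sigma>' y' - c * \<sigma> y') *\<^sub>R p y') =
      (t + (c * \<sigma> y) *\<^sub>R rotJ (p y)) - (t' + (c' * \<sigma>' y) *\<^sub>R rotJ (p y)) -
      ((t + (c * \<sigma> y') *\<^sub>R rotJ (p y')) - (t' + (c' * \<sigma>' y') *\<^sub>R rotJ (p y')))"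
    by (simp add: rotJ_linear algebra_simps)
  also have "\<dots> = 0" using e1 e2 by simp
  finally have "(c * \<sigma> y - c' * \<sigma>' y) *\<^sub>R p y + (c' * \<sigma>' y' - c * \<sigma> y') *\<^sub>R p y' = 0" by simp
  from det2_indep[OF det this] have cc: "c * \<sigma> y = c' * \<sigma>' y" "c * \<sigma> y' = c' * \<sigma>' y'" by simp_all
  have c0: "c = 0 \<and> c' = 0"
    using c'
  proof
    assume "c' = 0"
    then show ?thesis using cc(1) pm[of y] by auto
  next
    assume n: "\<sigma>' y * \<sigma>' y' = - s"
    \<comment> \<open>The two potentials have opposite products on this edge. Multiplying the
      equations \<open>cc\<close> equates a multiple of \<open>s\<close> by a square with one of
      \<open>- s\<close> by a square, so both rotation parts are zero.\<close>
    have "c * c * s = (c * \<sigma> y) * (c * \<sigma> y')" by (simp add: ss)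
    also have "\<dots> = c' * c' * (\<sigma>' y * \<sigma>' y')" by (simp add: cc)
    finally have "c * c * s = - (c' * c' * s)" using n by simp
    then have sc: "c * c * s + c' * c' * s = 0" by simp
    have "c * c + c' * c' = (c * c * s + c' * c' * s) * s" using s1 by (elim disjE) simp_all
    also have "\<dots> = 0" by (simp only: sc mult_zero_left)
    finally have "c * c + c' * c' = 0" .
    then show ?thesis by (simp only: sum_squares_eq_zero_iff)
  qed
  then have "t = 0" "t' = 0" using my bspec[OF tc yY(1)] bspec[OF tc' Y2(4)] by (simp_all add: tA)
  then have "m u = 0" if "u \<in> W" for u using that tc tc' c0 by (auto simp: W_def tA)
  then show False using m(1) by blast
qed

text \<open>\<open>nb\<close> excludes the one configuration beyond the reach of
  \<open>anti_motion\<close>: an arm to the fixed vertex, two parallel arms, and a further edge from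
  their common neighbour to the fixed vertex.\<close>

lemma extend_vertex:
  assumes E: "sgsparse A Z E" and w: "w \<notin> Z" and wX: "w \<notin> X" and VE: "VF E \<subseteq> insert w X"
    and p: "good p X" and d: "deg E w \<le> 3"
    and nb: "\<And>e f f' g. \<lbrakk>deg E w = 3; e \<in> E; w \<in> ends e; oth w e \<in> Z; f \<in> E; w \<in> ends f;
      f' \<in> E; w \<in> ends f'; f \<noteq> f'; oth w f' = oth w f; g \<in> E;
      w \<notin> ends g; oth w f \<in> ends g\<rbrakk> \<Longrightarrow> oth (oth w f) g \<notin> Z"
  shows "\<exists>x. indep A (p(w := x)) E"
proof -
  define K where "K = {e \<in> E. w \<notin> ends e}"
  have VK: "VF K \<subseteq> X" using VE by (auto simp: K_def VF_def)
  have Kp: "sgsparse A Z K" using sgsparse_subset[OF E] by (simp add: K_def)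
  have ind: "indep A p K" by (rule goodD(2)[OF p Kp VK])
  note gp = goodD(1)[OF p]
  have oX: "oth w g = w \<or> oth w g \<in> X" if "g \<in> E" "w \<in> ends g" for g
    using that VE oth_in_ends[OF that(2)] ends_subset_VF[OF that(1)] by blast
  show ?thesis
  proof (cases "deg E w \<le> 2")
    case True
    show ?thesis
    proof (rule extend_low_degree[OF E K_def ind True])
      fix g h assume gh: "g \<in> E" "w \<in> ends g" "h \<in> E" "w \<in> ends h" "g \<noteq> h"
      show "arm_pos w p g \<noteq> arm_pos w p h"
        by (rule arm_pos_distinct[OF E gh w gp oX[OF gh(1,2)] oX[OF gh(3,4)]])
    qed
  next
    case False
    then have d3: "deg E w = 3" using d by simp
    then obtain e1 e2 e3 where D0: "{e \<in> E. w \<in> ends e} = {e1, e2, e3}" "e1 \<noteq> e2" "e1 \<noteq> e3" "e2 \<noteq> e3"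
      unfolding deg_def card_3_iff by (elim exE conjE)
    have oX0: "\<forall>g\<in>{e1, e2, e3}. oth w g = w \<or> oth w g \<in> X"
      using oX D0(1) by blast
    from arms_cases[OF E D0 w gp oX0] obtain f1 f2 f3 where f: "{e1, e2, e3} = {f1, f2, f3}"
      "f1 \<noteq> f2" "f1 \<noteq> f3" "f2 \<noteq> f3"
      and c: "det2 (arm_pos w p f1 - arm_pos w p f3) (arm_pos w p f2 - arm_pos w p f3) \<noteq> 0 \<or>
       (oth w f1 = oth w f2 \<and> (oth w f3 = w \<or> oth w f3 \<in> Z))" by (elim exE conjE)
    have D: "{e \<in> E. w \<in> ends e} = {f1, f2, f3}" using D0(1) f(1) by simp
    have fE: "f1 \<in> E" "w \<in> ends f1" "f2 \<in> E" "w \<in> ends f2" "f3 \<in> E" "w \<in> ends f3" using D by blast+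
    note par = sgsparse_parallel[OF E fE(1-4) f(2) _ w]
    from c show ?thesis
    proof
      assume det: "det2 (arm_pos w p f1 - arm_pos w p f3) (arm_pos w p f2 - arm_pos w p f3) \<noteq> 0"
      show ?thesis
      proof (rule ccontr)
        assume no: "\<not> ?thesis"
        \<comment> \<open>Since no placement works, the midpoint placement fails for each of the
          three pairs of arms, so each of the three bars is respected by all motions of
          \<open>K\<close>.\<close>
        have D': "{e \<in> E. w \<in> ends e} = {f2, f3, f1}" "{e \<in> E. w \<in> ends e} = {f1, f3, f2}" using D by auto
        have det': "det2 (arm_pos w p f2 - arm_pos w p f1) (arm_pos w p f3 - arm_pos w p f1) \<noteq> 0"
          "det2 (arm_pos w p f1 - arm_pos w p f2) (arm_pos w p f3 - arm_pos w p f2) \<noteq> 0"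
          using det by (simp_all add: det2_def algebra_simps)
        have v12: "(arm_pos w p f1 - arm_pos w p f2) \<bullet> (arm_mot A w m f1 - arm_mot A w m f2) = 0"
          if "\<forall>k\<in>K. erow A p m k = 0" for m
          using extend_midpoint[OF E D f(2-4) K_def ind det that] no by blast
        have v23: "(arm_pos w p f2 - arm_pos w p f3) \<bullet> (arm_mot A w m f2 - arm_mot A w m f3) = 0"
          if "\<forall>k\<in>K. erow A p m k = 0" for m
          using extend_midpoint[OF E D'(1) f(4) f(2)[symmetric] f(3)[symmetric] K_def ind det'(1) that] no by blast
        have v13: "(arm_pos w p f1 - arm_pos w p f3) \<bullet> (arm_mot A w m f1 - arm_mot A w m f3) = 0"
          if "\<forall>k\<in>K. erow A p m k = 0" for m
          using extend_midpoint[OF E D'(2) f(3) f(2) f(4)[symmetric] K_def ind det'(2) that] no by blast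
        have "\<exists>F \<sigma> Y. is_block p w K X f1 f2 F \<sigma> Y"
          by (rule ex_block[OF E fE(1-4) f(2) w K_def VK p oX[OF fE(1,2)] oX[OF fE(3,4)] v12])
        then obtain F12 \<sigma>12 Y12 where B12: "is_block p w K X f1 f2 F12 \<sigma>12 Y12" by (elim exE)
        have "\<exists>F \<sigma> Y. is_block p w K X f2 f3 F \<sigma> Y"
          by (rule ex_block[OF E fE(3-6) f(4) w K_def VK p oX[OF fE(3,4)] oX[OF fE(5,6)] v23])
        then obtain F23 \<sigma>23 Y23 where B23: "is_block p w K X f2 f3 F23 \<sigma>23 Y23" by (elim exE)
        have "\<exists>F \<sigma> Y. is_block p w K X f1 f3 F \<sigma> Y"
          by (rule ex_block[OF E fE(1,2,5,6) f(3) w K_def VK p oX[OF fE(1,2)] oX[OF fE(5,6)] v13])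
        then obtain F13 \<sigma>13 Y13 where B13: "is_block p w K X f1 f3 F13 \<sigma>13 Y13" by (elim exE)
        show False by (rule three_blocks[OF E w D f(2-4) K_def p wX B12 B23 B13 det])
      qed
    next
      assume s: "oth w f1 = oth w f2 \<and> (oth w f3 = w \<or> oth w f3 \<in> Z)"
      then have o12: "oth w f2 = oth w f1" by simp
      let ?a = "oth w f1"
      have a: "?a \<noteq> w" "?a \<notin> Z" "sg f2 = - sg f1" using par s by auto
      have aX: "?a \<in> X" using oX[OF fE(1,2)] a by simp
      show ?thesis
      proof (cases "oth w f3 = w")
        case True
        have nA: "\<not> A" using sgsparse_arm(2)[OF E fE(5,6) True] by simp
        have "\<exists>m. (\<forall>k\<in>K. erow A p m k = 0) \<and> p ?a \<bullet> m ?a \<noteq> 0"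
        proof (rule ccontr)
          assume neg: "\<not> ?thesis"
          \<comment> \<open>If \<open>p ?a\<close> were always orthogonal to \<open>m ?a\<close>, a
            negative loop at \<open>?a\<close> would be blocked. Such a loop is unbalanced, so the
            blocking subgraph is globally tight, although it is incident with the only far end off
            \<open>w\<close>.\<close>
          have van: "erow A p m (?a, ?a, -1) = 0" if "\<forall>k\<in>K. erow A p m k = 0" for m
          proof -
            have "p ?a \<bullet> m ?a = 0" using neg that by blast
            then show ?thesis using nA by (simp add: chi_def inner_2 algebra_simps)
          qed
          have "\<exists>F\<subseteq>K. card F + lam A = 2 * card (VF (insert (?a, ?a, -1) F)) \<or>
            (bal Z (insert (?a, ?a, -1) F) \<and> card F + 3 = 2 * card (VF (insert (?a, ?a, -1) F)))"
            by (rule blocked[OF Kp VK p _ _ aX aX _ van, of "-1"]) (use a in simp_all)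
          then obtain F where F: "F \<subseteq> K" "card F + lam A = 2 * card (VF (insert (?a, ?a, -1) F)) \<or>
            (bal Z (insert (?a, ?a, -1) F) \<and> card F + 3 = 2 * card (VF (insert (?a, ?a, -1) F)))"
            by (elim exE conjE)
          have nbal: "\<not> bal Z (insert (?a, ?a, -1) F)"
          proof
            assume "bal Z (insert (?a, ?a, -1) F)"
            then obtain \<sigma> where s0: "potential Z \<sigma> (insert (?a, ?a, -1) F)" unfolding bal_def by (elim exE)
            have "-1 = \<sigma> ?a * \<sigma> ?a" by (rule potential_edge[OF s0 _ a(2) a(2)]) simp
            then show False using potential_pm[OF s0, of ?a] by auto
          qed
          define Y where "Y = VF (insert (?a, ?a, -1 :: real) F)"
          have finF: "finite F" using F(1) sgsparse_finite[OF Kp] finite_subset by blast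
          have Y: "finite Y" "VF F \<subseteq> Y" "?a \<in> Y" "Y \<subseteq> X"
            using finF aX VF_mono[OF F(1)] VK by (auto simp: Y_def)
          have wY: "w \<notin> Y" using Y wX by blast
          have "card F + lam A < 2 * card Y"
            by (rule tight_no_arms[OF E D f(2-4) _ Y(1,2) wY]) (use F(1) K_def True o12 Y(3) in auto)
          then show False using F(2) nbal by (simp add: Y_def)
        qed
        then obtain m where "\<forall>k\<in>K. erow A p m k = 0" "p ?a \<bullet> m ?a \<noteq> 0" by (elim exE conjE)
        then show ?thesis
          by (rule extend_parallel_sym[OF E D f(2-4) K_def ind refl o12 a(1) True a(3)])
      next
        case False
        then have z: "oth w f3 \<in> Z" using s by simp
        let ?z = "oth w f3"
        have zX: "?z \<in> X" using oX[OF fE(5,6)] False by simp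
        have "oth ?a g \<notin> Z" if "g \<in> K" "?a \<in> ends g" for g
          by (rule nb[OF d3 fE(5,6) z fE(1-4) f(2) o12]) (use that in \<open>simp_all add: K_def\<close>)
        then have "\<exists>m. (\<forall>k\<in>K. erow A p m k = 0) \<and> m ?a \<noteq> m ?z"
          by (rule anti_motion[OF E D f(2-4) K_def VK p wX refl o12 a(1,2) aX refl z zX])
        then obtain m where m: "\<forall>k\<in>K. erow A p m k = 0" "m ?a \<noteq> m ?z" by (elim exE conjE)
        have "p ?z = 0" "p ?a \<noteq> 0" using genposD(1)[OF gp z] genposD(2)[OF gp aX a(2)] by simp_all
        then show ?thesis
          by (intro extend_parallel_anti[OF E D f(2-4) K_def ind refl o12 a(1) refl False z _ a(3) _ m])
      qed
    qed
  qed
qed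

end

section \<open>The choice of the removed vertices and the induction\<close>

lemma card_filter_eq_sum:
  "finite S \<Longrightarrow> card {x \<in> S. P x} = (\<Sum>x\<in>S. if P x then 1 else 0)"
  by (simp only: card_eq_sum sum.inter_filter)

context signed_setting
begin

text \<open>The second clause serves the twin configuration: if the chosen vertex has degree 3 and
  is joined to the fixed vertex, then so is every other neighbour of the fixed vertex of degree 3.
  Otherwise all degrees are at least 4 except on a set \<open>T\<close> properly inside the set
  \<open>R\<close> of these neighbours, or empty, and the degree sum contradicts sparsity.\<close>

lemma ex_low_degree:
  assumes E: "sgsparse A Z E" and ne: "E \<noteq> {}"
  shows "\<exists>w\<in>VF E - Z. deg E w \<le> 3 \<and> (deg E w = 3 \<longrightarrow> (\<exists>e\<in>E. w \<in> ends e \<and> oth w e \<in> Z) \<longrightarrow>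
    (\<forall>a\<in>VF E - Z. (\<exists>e\<in>E. a \<in> ends e \<and> oth a e \<in> Z) \<longrightarrow> deg E a = 3))"
proof (rule ccontr)
  assume neg: "\<not> ?thesis"
  have finE: "finite E" by (rule sgsparse_finite[OF E])
  define W where "W = VF E - Z"
  define R where "R = {w \<in> W. \<exists>e\<in>E. w \<in> ends e \<and> oth w e \<in> Z}"
  define T where "T = {w \<in> W. deg E w = 3}"
  define N where "N = {e \<in> E. ends e \<inter> Z \<noteq> {}}"
  have fin: "finite W" "finite R" "finite T" "finite N" using finE by (simp_all add: W_def R_def T_def N_def)
  have no: "\<not> (deg E w \<le> 3 \<and> (deg E w = 3 \<longrightarrow> (\<exists>e\<in>E. w \<in> ends e \<and> oth w e \<in> Z) \<longrightarrow>
    (\<forall>a\<in>W. (\<exists>e\<in>E. a \<in> ends e \<and> oth a e \<in> Z) \<longrightarrow> deg E a = 3)))" if "w \<in> W" for w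
    using neg that unfolding W_def by blast
  have ge: "3 \<le> deg E w" if "w \<in> W" for w
  proof (rule ccontr)
    assume "\<not> 3 \<le> deg E w"
    then have "deg E w \<le> 3" "deg E w \<noteq> 3" by simp_all
    then show False using no[OF that] by simp
  qed
  have TR: "T \<subseteq> R"
  proof
    fix w assume "w \<in> T"
    then have w: "w \<in> W" "deg E w = 3" by (simp_all add: T_def)
    then show "w \<in> R" using no[OF w(1)] unfolding R_def by force
  qed
  have TneR: "T \<noteq> R" if "T \<noteq> {}"
  proof
    assume TR: "T = R"
    from that obtain w where w: "w \<in> T" by blast
    then have w': "w \<in> W" "deg E w = 3" by (simp_all add: T_def)
    have "deg E a = 3" if "a \<in> W" "\<exists>e\<in>E. a \<in> ends e \<and> oth a e \<in> Z" for a
    proof -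
      have "a \<in> R" using that by (simp add: R_def)
      then have "a \<in> T" using TR by simp
      then show ?thesis by (simp add: T_def)
    qed
    then show False using no[OF w'(1)] w'(2) by simp
  qed
  have cTR: "card T < card R" if "T \<noteq> {}"
    using psubset_card_mono[OF fin(2)] TR TneR[OF that] by blast
  have RN: "card R \<le> card N"
  proof -
    have "\<forall>w\<in>R. \<exists>e. e \<in> E \<and> w \<in> ends e \<and> oth w e \<in> Z" unfolding R_def by blast
    from bchoice[OF this] obtain h where h: "\<forall>w\<in>R. h w \<in> E \<and> w \<in> ends (h w) \<and> oth w (h w) \<in> Z" by (elim exE)
    have "inj_on h R"
    proof (rule inj_onI)
      fix u v assume uv: "u \<in> R" "v \<in> R" "h u = h v"
      have "ends (h u) = {u, oth u (h u)}" "ends (h v) = {v, oth v (h v)}"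
        using ends_oth[of u "h u"] ends_oth[of v "h v"] bspec[OF h uv(1)] bspec[OF h uv(2)] by simp_all
      moreover have "oth u (h u) \<in> Z" "oth v (h v) \<in> Z" "u \<notin> Z" "v \<notin> Z"
        using bspec[OF h uv(1)] bspec[OF h uv(2)] uv(1,2) by (simp_all add: R_def W_def)
      ultimately show "u = v" using uv(3) by (metis doubleton_eq_iff)
    qed
    moreover have "h ` R \<subseteq> N"
    proof
      fix e assume "e \<in> h ` R"
      then obtain w where w: "w \<in> R" "e = h w" by blast
      have "oth w (h w) \<in> ends (h w)" using oth_in_ends[of w "h w"] bspec[OF h w(1)] by simp
      then show "e \<in> N" using bspec[OF h w(1)] w(2) by (auto simp: N_def)
    qed
    ultimately show ?thesis using fin(4) by (rule card_inj_on_le)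
  qed
  \<comment> \<open>Degrees are summed over free vertices, so an edge at the fixed vertex is counted
    at most once; this gains \<open>card N\<close> over the usual bound.\<close>
  have degsum: "(\<Sum>w\<in>W. deg E w) + card N \<le> 2 * card E"
  proof -
    have "(\<Sum>w\<in>W. deg E w) = (\<Sum>w\<in>W. \<Sum>e\<in>E. if w \<in> ends e then 1 else 0)"
      by (simp only: deg_def card_filter_eq_sum[OF finE])
    also have "\<dots> = (\<Sum>e\<in>E. \<Sum>w\<in>W. if w \<in> ends e then 1 else 0)" by (rule sum.swap)
    also have "\<dots> = (\<Sum>e\<in>E. card (W \<inter> ends e))"
      by (simp only: Int_def card_filter_eq_sum[OF fin(1), symmetric])
    finally have 1: "(\<Sum>w\<in>W. deg E w) = (\<Sum>e\<in>E. card (W \<inter> ends e))" .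
    have 2: "card N = (\<Sum>e\<in>E. if ends e \<inter> Z \<noteq> {} then 1 else 0)"
      by (simp only: N_def card_filter_eq_sum[OF finE])
    have "card (W \<inter> ends e) + (if ends e \<inter> Z \<noteq> {} then 1 else 0) \<le> 2" for e
    proof -
      obtain u v s where e: "e = (u, v, s)" by (cases e)
      have "card (W \<inter> ends e) \<le> card {u, v}" by (rule card_mono) (auto simp: e)
      also have "\<dots> \<le> 2" by (simp add: card_insert_if)
      finally have a: "card (W \<inter> ends e) \<le> 2" .
      have "card (W \<inter> ends e) \<le> 1" if "ends e \<inter> Z \<noteq> {}"
      proof -
        have "W \<inter> ends e \<subseteq> {u} \<or> W \<inter> ends e \<subseteq> {v}" using that by (auto simp: e W_def)
        then obtain x where "W \<inter> ends e \<subseteq> {x}" by blast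
        then have "card (W \<inter> ends e) \<le> card {x}" by (intro card_mono) auto
        then show ?thesis by simp
      qed
      then show ?thesis using a by simp
    qed
    then have "(\<Sum>e\<in>E. card (W \<inter> ends e) + (if ends e \<inter> Z \<noteq> {} then 1 else 0)) \<le> (\<Sum>e\<in>E. 2)"
      by (intro sum_mono)
    then show ?thesis by (simp add: 1 2 sum.distrib)
  qed
  have "(\<Sum>w\<in>W. 4) \<le> (\<Sum>w\<in>W. deg E w + (if w \<in> T then 1 else 0))"
    using ge by (intro sum_mono) (force simp: T_def)
  also have "\<dots> = (\<Sum>w\<in>W. deg E w) + card T"
  proof -
    have "W \<inter> T = T" by (auto simp: T_def)
    then show ?thesis using fin by (simp add: sum.distrib sum.If_cases Int_def)
  qed
  finally have four: "4 * card W \<le> (\<Sum>w\<in>W. deg E w) + card T" by simp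
  have sp: "card E + lam A \<le> 2 * card (VF E)" by (rule sgsparse_lam[OF E order_refl ne])
  show False
  proof (cases "VF E \<inter> Z = {}")
    case True
    then have "VF E = W" by (auto simp: W_def)
    have "R = {}"
    proof (rule ccontr)
      assume "R \<noteq> {}"
      then obtain w e where e: "e \<in> E" "w \<in> ends e" "oth w e \<in> Z" unfolding R_def by blast
      have "oth w e \<in> VF E" using oth_in_ends[OF e(2)] ends_subset_VF[OF e(1)] by blast
      then show False using True e(3) by blast
    qed
    then have "T = {}" using TR by simp
    then have "4 * card W \<le> 2 * card E" using four degsum by simp
    then show False using sp \<open>VF E = W\<close> by (auto simp: lam_def split: if_splits)
  next
    case False
    then obtain z where z: "z \<in> Z" "z \<in> VF E" by blast
    have A using Z_sym z by blast
    have "VF E = insert z W"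
    proof
      show "VF E \<subseteq> insert z W" using Z_unique[OF z(1)] by (auto simp: W_def)
      show "insert z W \<subseteq> VF E" using z by (simp add: W_def)
    qed
    moreover have "z \<notin> W" using z by (simp add: W_def)
    ultimately have "card (VF E) = Suc (card W)" using fin by simp
    \<comment> \<open>The fixed vertex adds 2 to the sparsity bound and \<open>lam A\<close> takes 2
      away, so \<open>E\<close> has at most twice as many edges as \<open>W\<close> has vertices,
      and the degree sum bounds \<open>card N\<close> by \<open>card T\<close>.\<close>
    then have RT: "card R \<le> card T" using sp \<open>A\<close> four degsum RN by (simp add: lam_def)
    then have "T = {}" using cTR by fastforce
    then have "R = {}" using RT fin by simp
    obtain e where e: "e \<in> E" "z \<in> ends e" using z by (auto simp: VF_def)
    have "oth z e \<noteq> z" using sgsparse_arm(2)[OF E e] \<open>A\<close> by blast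
    then have "oth z e \<notin> Z" using Z_unique[OF z(1), of "oth z e"] by auto
    moreover have "oth z e \<in> ends e" by (rule oth_in_ends[OF e(2)])
    moreover have "oth (oth z e) e = z" using \<open>oth z e \<noteq> z\<close> e(2) by (cases e) (auto simp: oth_simps)
    ultimately have "oth z e \<in> R" using e z ends_subset_VF[OF e(1)] by (auto simp: R_def W_def)
    then show False using \<open>R = {}\<close> by simp
  qed
qed

text \<open>Both vertices have degree 3 and share two edges, so each has one edge left, to the fixed
  vertex. Once \<open>w\<close> is gone, \<open>a\<close> hangs on \<open>g\<close> alone: it is
  easy to put back and can swing about the origin. This is the relative motion that
  \<open>extend_parallel_anti\<close> asks for when \<open>w\<close> is restored.\<close>

lemma extend_twin:
  assumes E: "sgsparse A Z E" and w: "w \<notin> Z" and wX: "w \<notin> X" and aX: "a \<notin> X" and VE: "VF E \<subseteq> X \<union> {w, a}"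
    and p: "good p X" and d: "deg E w = 3" "deg E a = 3"
    and e: "e \<in> E" "w \<in> ends e" "oth w e = z" "z \<in> Z"
    and f: "f \<in> E" "w \<in> ends f" "oth w f = a" and f': "f' \<in> E" "w \<in> ends f'" "oth w f' = a" "f \<noteq> f'"
    and g: "g \<in> E" "w \<notin> ends g" "a \<in> ends g" "oth a g = z"
  shows "\<exists>x y. indep A (p(a := y, w := x)) E"
proof -
  have A: A using Z_sym e(4) by blast
  have pz: "p z = 0" by (rule genposD(1)[OF goodD(1)[OF p] e(4)])
  have par: "a \<noteq> w" "a \<notin> Z" "sg f' = - sg f"
    using sgsparse_parallel[OF E f(1,2) f'(1,2) f'(4) _ w] f(3) f'(3) by auto
  have zw: "z \<noteq> w" "z \<noteq> a" using w e(4) par(2) by auto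
  have dist: "f \<noteq> f'" "f \<noteq> e" "f' \<noteq> e" using f'(4) f(3) f'(3) e(3) zw by auto
  have finE: "finite E" by (rule sgsparse_finite[OF E])
  have D: "{e \<in> E. w \<in> ends e} = {f, f', e}"
    by (rule card_subset_eq[symmetric]) (use finE dist d(1) f f' e in \<open>auto simp: deg_def\<close>)
  have aen: "a \<in> ends f" "a \<in> ends f'" using oth_in_ends[OF f(2)] oth_in_ends[OF f'(2)] f(3) f'(3) by simp_all
  have gne: "f \<noteq> g" "f' \<noteq> g" using f(2) f'(2) g(2) by auto
  have Da: "{e \<in> E. a \<in> ends e} = {f, f', g}"
    by (rule card_subset_eq[symmetric]) (use finE dist gne d(2) f f' g aen in \<open>auto simp: deg_def\<close>)
  define K where "K = {e \<in> E. w \<notin> ends e}"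
  define K2 where "K2 = {e \<in> K. a \<notin> ends e}"
  have Kp: "sgsparse A Z K" using sgsparse_subset[OF E] by (simp add: K_def)
  have K2p: "sgsparse A Z K2" using sgsparse_subset[OF Kp] by (simp add: K2_def)
  have VK2: "VF K2 \<subseteq> X" using VE by (auto simp: K_def K2_def VF_def)
  have ind2: "indep A p K2" by (rule goodD(2)[OF p K2p VK2])
  have Ka: "{e \<in> K. a \<in> ends e} = {g}"
  proof -
    have "k = g" if "k \<in> K" "a \<in> ends k" for k
    proof -
      have "k \<in> {e \<in> E. a \<in> ends e}" using that by (simp add: K_def)
      then have "k = f \<or> k = f' \<or> k = g" unfolding Da by simp
      then show ?thesis using that(1) f(2) f'(2) by (auto simp: K_def)
    qed
    moreover have "g \<in> K" using g by (simp add: K_def)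
    ultimately show ?thesis using g(3) by blast
  qed
  have "\<exists>y. indep A (p(a := y)) K"
  proof (rule extend_low_degree[OF Kp K2_def ind2])
    show "deg K a \<le> 2" using Ka by (simp add: deg_def)
    fix g' h assume "g' \<in> K" "a \<in> ends g'" "h \<in> K" "a \<in> ends h" "g' \<noteq> h"
    then have "g' \<in> {g}" "h \<in> {g}" using Ka by blast+
    then show "arm_pos a p g' \<noteq> arm_pos a p h" using \<open>g' \<noteq> h\<close> by simp
  qed
  then obtain y where ind: "indep A (p(a := y)) K" by (elim exE)
  let ?p = "p(a := y)"
  have pz': "?p z = 0" using pz zw by simp
  have gK: "g \<in> K" using g by (simp add: K_def)
  have g': "\<exists>s. g = (a, z, s) \<or> g = (z, a, s)" using g(3,4) by (cases g) (auto simp: oth_simps split: if_splits)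
  have row_g: "erow A ?p m g = 0" if "?p a \<bullet> (m a - m z) = 0" for m
    using g' that pz' A by (auto simp: chi_def inner_diff_right)
  \<comment> \<open>At the origin the row of \<open>g\<close> would be zero, against
    independence.\<close>
  have pa: "?p a \<noteq> 0"
  proof
    assume "?p a = 0"
    then have r0: "erow A ?p m g = 0" for m by (intro row_g) simp
    have "indep A ?p {g}" by (rule indep_subset[OF ind]) (use gK sgsparse_finite[OF Kp] in simp_all)
    from indepD[OF this, of "\<lambda>_. 1" g] r0 show False by simp
  qed
  \<comment> \<open>Only \<open>g\<close> holds \<open>a\<close> in \<open>K\<close>, so
    \<open>a\<close> may move perpendicularly to its position while everything else rests.\<close>
  define m where "m = (\<lambda>u. if u = a then rotJ (?p a) else 0)"
  have mK: "\<forall>k\<in>K. erow A ?p m k = 0"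
  proof
    fix k assume k: "k \<in> K"
    show "erow A ?p m k = 0"
    proof (cases "a \<in> ends k")
      case True
      then have "k = g" using k Ka by blast
      then show ?thesis using row_g[of m] zw by (simp add: m_def rotJ_inner)
    next
      case False
      then have "erow A ?p m k = erow A ?p (\<lambda>_. 0) k" by (intro erow_cong) (auto simp: m_def)
      then show ?thesis by simp
    qed
  qed
  have mne: "m a \<noteq> m z" using pa zw by (simp add: m_def)
  have "\<exists>x. indep A (?p(w := x)) E"
    by (rule extend_parallel_anti[OF E D dist K_def ind f(3) f'(3) par(1) e(3) zw(1) e(4) pz' par(3) pa mK mne])
  then obtain x where "indep A (?p(w := x)) E" by (elim exE)
  then show ?thesis by (intro exI[of _ x] exI[of _ y])
qed

text \<open>The induction runs over vertex sets, not over edges: a good placement of a smaller set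
  asks for realisations of all sparse graphs on it.\<close>

theorem sgsparse_realisation:
  assumes "finite X" "sgsparse A Z E" "VF E \<subseteq> X"
  shows "\<exists>p. (\<forall>z\<in>Z. p z = 0) \<and> indep A p E"
  using assms
proof (induction X arbitrary: E rule: finite_psubset_induct)
  case (psubset X)
  note E = psubset.prems(1)
  have ex: "\<exists>p. good p Y" if "Y \<subset> X" for Y
  proof (rule ex_good)
    show "finite Y" using that psubset.hyps finite_subset by blast
    show "\<exists>p. (\<forall>z\<in>Z. p z = 0) \<and> indep A p F" if "sgsparse A Z F" "VF F \<subseteq> Y" for F
      by (rule psubset.IH[OF \<open>Y \<subset> X\<close> that])
  qed
  show ?case
  proof (cases "E = {}")
    case True
    then show ?thesis by (intro exI[of _ "\<lambda>_. 0"]) simp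
  next
    case False
    from ex_low_degree[OF E False] obtain w where w: "w \<in> VF E - Z" "deg E w \<le> 3"
      and low: "deg E w = 3 \<longrightarrow> (\<exists>e\<in>E. w \<in> ends e \<and> oth w e \<in> Z) \<longrightarrow>
        (\<forall>a\<in>VF E - Z. (\<exists>e\<in>E. a \<in> ends e \<and> oth a e \<in> Z) \<longrightarrow> deg E a = 3)" by (elim bexE conjE)
    have wX: "w \<in> X" "w \<notin> Z" using w psubset.prems(2) by auto
    show ?thesis
    proof (cases "\<exists>e f f' g. deg E w = 3 \<and> e \<in> E \<and> w \<in> ends e \<and> oth w e \<in> Z \<and> f \<in> E \<and> w \<in> ends f \<and>
        f' \<in> E \<and> w \<in> ends f' \<and> f \<noteq> f' \<and> oth w f' = oth w f \<and> g \<in> E \<and> w \<notin> ends g \<and> oth w f \<in> ends g \<and>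
        oth (oth w f) g \<in> Z")
      case False
      have "X - {w} \<subset> X" using wX by blast
      from ex[OF this] obtain p where p: "good p (X - {w})" by (elim exE)
      have "\<exists>x. indep A (p(w := x)) E"
      proof (rule extend_vertex[OF E wX(2) _ _ p w(2)])
        show "VF E \<subseteq> insert w (X - {w})" using psubset.prems(2) by blast
        fix e f f' g assume "deg E w = 3" "e \<in> E" "w \<in> ends e" "oth w e \<in> Z" "f \<in> E" "w \<in> ends f"
          "f' \<in> E" "w \<in> ends f'" "f \<noteq> f'" "oth w f' = oth w f" "g \<in> E" "w \<notin> ends g" "oth w f \<in> ends g"
        then show "oth (oth w f) g \<notin> Z" using False by metis
      qed simp
      then obtain x where "indep A (p(w := x)) E" by (elim exE)
      moreover have "\<forall>z\<in>Z. (p(w := x)) z = 0" using genposD(1)[OF goodD(1)[OF p]] wX(2) by auto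
      ultimately show ?thesis by (intro exI[of _ "p(w := x)"] conjI)
    next
      case True
      then obtain e f f' g where d: "deg E w = 3" and e: "e \<in> E" "w \<in> ends e" "oth w e \<in> Z"
        and f: "f \<in> E" "w \<in> ends f" "f' \<in> E" "w \<in> ends f'" "f \<noteq> f'" "oth w f' = oth w f"
        and g: "g \<in> E" "w \<notin> ends g" "oth w f \<in> ends g" "oth (oth w f) g \<in> Z" by (elim exE conjE)
      let ?a = "oth w f"
      have a: "?a \<noteq> w" "?a \<notin> Z" using sgsparse_parallel[OF E f(1-5) f(6)[symmetric] wX(2)] by auto
      have aV: "?a \<in> VF E - Z" using subsetD[OF ends_subset_VF[OF g(1)] g(3)] a(2) by simp
      have "\<exists>e\<in>E. w \<in> ends e \<and> oth w e \<in> Z" using e by (intro bexI[of _ e] conjI)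
      with low d have "\<forall>a\<in>VF E - Z. (\<exists>e\<in>E. a \<in> ends e \<and> oth a e \<in> Z) \<longrightarrow> deg E a = 3" by simp
      moreover have "\<exists>e\<in>E. ?a \<in> ends e \<and> oth ?a e \<in> Z" using g by (intro bexI[of _ g] conjI)
      ultimately have da: "deg E ?a = 3" using aV by simp
      have "X - {w, ?a} \<subset> X" using wX by blast
      from ex[OF this] obtain p where p: "good p (X - {w, ?a})" by (elim exE)
      have zz: "oth ?a g = oth w e" by (rule Z_unique[OF g(4) e(3)])
      have "\<exists>x y. indep A (p(?a := y, w := x)) E"
        by (rule extend_twin[OF E wX(2) _ _ _ p d da e(1,2) refl e(3) f(1,2) refl f(3,4,6,5) g(1-3) zz])
          (use psubset.prems(2) in auto)
      then obtain x y where "indep A (p(?a := y, w := x)) E" by (elim exE)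
      moreover have "\<forall>z\<in>Z. (p(?a := y, w := x)) z = 0"
        using genposD(1)[OF goodD(1)[OF p]] wX(2) a(2) by auto
      ultimately show ?thesis by (intro exI[of _ "p(?a := y, w := x)"] conjI)
    qed
  qed
qed

text \<open>\<open>nz\<close> and \<open>ne\<close> keep the trivial motions linearly independent on
  the vertices of a subgraph: a point off the origin for the rotation about it, two points that stay
  distinct under every switching for the balanced case. \<open>loop\<close> guarantees that a
  balanced subgraph has two vertices.\<close>

lemma indep_imp_sgsparse:
  assumes F: "finite E" "signed E" "indep A p E" and Z: "\<forall>z\<in>Z. p z = 0"
    and nz: "\<And>u. u \<in> VF E \<Longrightarrow> u \<notin> Z \<Longrightarrow> p u \<noteq> 0"
    and ne: "\<And>u v. u \<in> VF E \<Longrightarrow> v \<in> VF E \<Longrightarrow> u \<noteq> v \<Longrightarrow> p u \<noteq> p v \<and> p u \<noteq> - p v"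
    and loop: "\<And>u s. (u, u, s) \<in> E \<Longrightarrow> u \<notin> Z \<and> s = -1"
  shows "sgsparse A Z E"
  unfolding sgsparse_def
proof (intro conjI allI impI)
  show "finite E" "signed E" by (fact F)+
next
  fix F assume FE: "F \<subseteq> E" and Fne: "F \<noteq> {}"
  have finF: "finite F" using FE F(1) finite_subset by blast
  have sgF: "signed F" using FE F(2) unfolding signed_def by blast
  have ind: "indep A p F" by (rule indep_subset[OF F(3) FE F(1)])
  have finV: "finite (VF F)" using finF by simp
  have VFE: "VF F \<subseteq> VF E" by (rule VF_mono[OF FE])
  obtain u v s where e: "(u, v, s) \<in> F" using Fne by (metis ex_in_conv prod_cases3)
  have uV: "u \<in> VF F" "v \<in> VF F" using ends_subset_VF[OF e] by auto
  show "card F + lam A \<le> 2 * card (VF F)"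
  proof (rule ccontr)
    assume "\<not> ?thesis"
    then have lt: "2 * card (VF F) < card F + lam A" by simp
    show False
    proof (cases A)
      case True
      define \<mu> where "\<mu> = (\<lambda>j::nat. tmot A (\<lambda>_ :: 'a. 1) p (if j = 0 then axis 1 1 else axis 2 1) 0)"
      have mu0: "erow A p (\<mu> j) f = 0" if "f \<in> F" for j f
        unfolding \<mu>_def by (rule tmot_row_glob[OF sgF that]) (use True in \<open>simp_all add: glob_def\<close>)
      have "\<exists>y. (\<exists>j<2. y j \<noteq> 0) \<and> (\<forall>u\<in>VF F. (\<Sum>j<2. y j *\<^sub>R \<mu> j u) = 0)"
        by (rule motions_dependent[OF finF ind finV order_refl mu0]) (use lt True in \<open>simp_all add: lam_def\<close>)
      then obtain y where y: "\<exists>j<2. y j \<noteq> 0" "\<forall>u\<in>VF F. (\<Sum>j<2. y j *\<^sub>R \<mu> j u) = 0" by metis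
      have "y 0 = 0" "y 1 = 0" using bspec[OF y(2) uV(1)] True
        by (simp_all add: \<mu>_def tmot_def chi_def eval_nat_numeral vec_eq_2 axis_def)
      then show False using y(1) by (auto simp: less_2_cases_iff)
    next
      case False
      then have Z0: "Z = {}" by (rule Z_sym)
      define \<mu> where "\<mu> = (\<lambda>j::nat. tmot A (\<lambda>_ :: 'a. 1) p 0 1)"
      have mu0: "erow A p (\<mu> j) f = 0" if "f \<in> F" for j f
        unfolding \<mu>_def by (rule tmot_row_glob[OF sgF that]) (use False in \<open>simp_all add: glob_def\<close>)
      have "\<exists>y. (\<exists>j<1. y j \<noteq> 0) \<and> (\<forall>u\<in>VF F. (\<Sum>j<1. y j *\<^sub>R \<mu> j u) = 0)"
        by (rule motions_dependent[OF finF ind finV order_refl mu0]) (use lt False in \<open>simp_all add: lam_def\<close>)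
      then obtain y :: "nat \<Rightarrow> real" where y: "\<exists>j<1. y j \<noteq> 0" "\<forall>u\<in>VF F. (\<Sum>j<1. y j *\<^sub>R \<mu> j u) = 0" by metis
      have "y 0 *\<^sub>R rotJ (p u) = 0" using bspec[OF y(2) uV(1)] False
        by (simp add: \<mu>_def tmot_def chi_def)
      moreover have "p u \<noteq> 0" using nz[of u] uV VFE Z0 by blast
      ultimately show False using y(1) by auto
    qed
  qed
  show "card F + 3 \<le> 2 * card (VF F)" if bl: "bal Z F"
  proof (rule ccontr)
    assume "\<not> ?thesis"
    then have lt: "2 * card (VF F) < card F + 3" by simp
    obtain \<sigma> where pot: "potential Z \<sigma> F" using bl unfolding bal_def by (elim exE)
    note pm = potential_pm[OF pot]
    have uv: "u \<noteq> v"
    proof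
      assume "u = v"
      then have "u \<notin> Z" "s = -1" using loop[of u s] e FE by auto
      then have "-1 = \<sigma> u * \<sigma> u" using potential_edge[OF pot, of u u s] e \<open>u = v\<close> by simp
      then show False using pm[of u] by auto
    qed
    have dist: "\<sigma> u *\<^sub>R p u \<noteq> \<sigma> v *\<^sub>R p v"
    proof -
      have "p u \<noteq> p v \<and> p u \<noteq> - p v"
        by (rule ne[OF subsetD[OF VFE uV(1)] subsetD[OF VFE uV(2)] uv])
      then show ?thesis using pm[of u] pm[of v] by (elim disjE) (simp_all, metis minus_minus)
    qed
    define \<mu> where "\<mu> = (\<lambda>j::nat. if j = 0 then tmot A \<sigma> p (axis 1 1) 0
      else if j = 1 then tmot A \<sigma> p (axis 2 1) 0 else tmot A \<sigma> p 0 1)"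
    have mu0: "erow A p (\<mu> j) f = 0" if "f \<in> F" for j f
      using tmot_row_bal[OF pot sgF Z that] by (simp add: \<mu>_def)
    have "\<exists>y. (\<exists>j<3. y j \<noteq> 0) \<and> (\<forall>u\<in>VF F. (\<Sum>j<3. y j *\<^sub>R \<mu> j u) = 0)"
      by (rule motions_dependent[OF finF ind finV order_refl mu0]) (use lt in simp_all)
    then obtain y where y: "\<exists>j<3. y j \<noteq> 0" "\<forall>u\<in>VF F. (\<Sum>j<3. y j *\<^sub>R \<mu> j u) = 0" by metis
    define t :: "real^2" where "t = vector [y 0, y 1]"
    have y': "tmot A \<sigma> p t (y 2) x = 0" if "x \<in> VF F" for x
      using bspec[OF y(2) that]
      by (simp add: \<mu>_def tmot_def eval_nat_numeral vec_eq_2 t_def axis_def algebra_simps)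
    have 0: "t + (y 2 * \<sigma> x) *\<^sub>R rotJ (p x) = 0" if "x \<in> VF F" for x
      using y'[OF that] pm[of x] by (auto simp: tmot_def chi_def split: if_splits)
    have "y 2 *\<^sub>R rotJ (\<sigma> u *\<^sub>R p u - \<sigma> v *\<^sub>R p v) =
        (t + (y 2 * \<sigma> u) *\<^sub>R rotJ (p u)) - (t + (y 2 * \<sigma> v) *\<^sub>R rotJ (p v))"
      by (simp add: rotJ_linear algebra_simps)
    then have "y 2 *\<^sub>R rotJ (\<sigma> u *\<^sub>R p u - \<sigma> v *\<^sub>R p v) = 0"
      using 0[OF uV(1)] 0[OF uV(2)] by simp
    then have y2: "y 2 = 0" using dist by simp
    with 0[OF uV(1)] have "y 0 = 0" "y 1 = 0" by (simp_all add: t_def vec_eq_2)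
    with y(1) y2 show False by (auto simp: eval_nat_numeral less_Suc_eq)
  qed
qed

end

section \<open>The rank of the rigidity matrix\<close>

text \<open>A plane framework is itself a signed graph with all signs 1 and \<open>A\<close> true,
  when \<open>erow\<close> is the usual rigidity row. The choice of orientation does not change that
  row.\<close>

definition edge_triple :: "'v set \<Rightarrow> 'v sedge" where
  "edge_triple e = (let (u, v) = (SOME (u, v). e = {u, v}) in (u, v, 1))"

lemma edge_triple:
  assumes "card e = 2"
  obtains u v where "edge_triple e = (u, v, 1)" "e = {u, v}" "u \<noteq> v"
proof -
  obtain a b where ab: "e = {a, b}" "a \<noteq> b" using assms by (auto simp: card_2_iff)
  define x where "x = (SOME (u, v). e = {u, v})"
  have "case x of (u, v) \<Rightarrow> e = {u, v}"
    unfolding x_def by (rule someI[of _ "(a, b)"]) (simp add: ab)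
  then have "e = {fst x, snd x}" by (simp add: split_beta)
  moreover have "edge_triple e = (fst x, snd x, 1)"
    by (simp only: edge_triple_def x_def[symmetric] Let_def split_beta)
  moreover have "fst x \<noteq> snd x" using calculation(1) assms by auto
  ultimately show ?thesis using that by blast
qed

lemma simple_graph_finite: "simple_graph V E \<Longrightarrow> finite E"
proof -
  assume g: "simple_graph V E"
  then have "E \<subseteq> Pow V" "finite V" by (auto simp: simple_graph_def)
  then show ?thesis by (meson finite_Pow_iff finite_subset)
qed

lemma edge_triple_inj:
  assumes "simple_graph V E"
  shows "inj_on edge_triple E"
proof (rule inj_onI)
  fix e f assume e: "e \<in> E" and f: "f \<in> E" and eq: "edge_triple e = edge_triple f"
  have "card e = 2" "card f = 2" using e f assms by (auto simp: simple_graph_def)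
  then show "e = f" using eq by (metis edge_triple fst_conv snd_conv)
qed

lemma erow_edge_triple:
  assumes "card e = 2" "e = {u, v}"
  shows "erow True q M (edge_triple e) = (q u - q v) \<bullet> (M u - M v)"
proof -
  obtain a b where ab: "edge_triple e = (a, b, 1)" "e = {a, b}" by (rule edge_triple[OF assms(1)])
  then have "a = u \<and> b = v \<or> a = v \<and> b = u" using assms(2) by (auto simp: doubleton_eq_iff)
  then show ?thesis using ab(1) by (auto simp: chi_def inner_diff_left inner_diff_right algebra_simps)
qed

lemma infinitesimal_motion_iff_erow:
  assumes "simple_graph V E"
  shows "infinitesimal_motion E q M \<longleftrightarrow> (\<forall>f\<in>edge_triple ` E. erow True q M f = 0)"
proof -
  have c: "card e = 2" if "e \<in> E" for e using assms that by (simp add: simple_graph_def)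
  show ?thesis
  proof
    assume m: "infinitesimal_motion E q M"
    show "\<forall>f\<in>edge_triple ` E. erow True q M f = 0"
    proof
      fix f assume "f \<in> edge_triple ` E"
      then obtain e where e: "e \<in> E" "f = edge_triple e" by blast
      obtain u v where uv: "e = {u, v}" using c[OF e(1)] by (auto simp: card_2_iff)
      show "erow True q M f = 0"
        using m e uv erow_edge_triple[OF c[OF e(1)] uv] by (simp add: infinitesimal_motion_def)
    qed
  next
    assume r: "\<forall>f\<in>edge_triple ` E. erow True q M f = 0"
    show "infinitesimal_motion E q M"
      unfolding infinitesimal_motion_def
    proof (intro allI impI)
      fix u v assume e: "{u, v} \<in> E"
      show "(q u - q v) \<bullet> (M u - M v) = 0"
        using erow_edge_triple[OF c[OF e] refl, of q M] r e by simp
    qed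
  qed
qed

lemma rigidity_matrix_erowv:
  assumes "card e = 2"
  shows "rigidity_matrix q e (w, i) = erowv True q (edge_triple e) w $ i"
proof -
  obtain a b where ab: "edge_triple e = (a, b, 1)" "e = {a, b}" "a \<noteq> b" by (rule edge_triple[OF assms])
  have "(THE x. e = {a, x}) = b" "(THE x. e = {b, x}) = a"
    using ab(2,3) by (auto intro!: the_equality simp: doubleton_eq_iff)
  then show ?thesis using ab by (auto simp: rigidity_matrix_def chi_def)
qed

text \<open>A motion that moves one vertex along one axis picks out one column, so stresses of the
  functionals are the linear relations between the matrix rows.\<close>

lemma combination_zero_iff:
  assumes E: "simple_graph V E" and B: "B \<subseteq> E"
  shows "(\<forall>m. (\<Sum>e\<in>B. w e * erow True q m (edge_triple e)) = 0) \<longleftrightarrow>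
    (\<forall>x. (\<Sum>e\<in>B. w e * rigidity_matrix q e x) = 0)"
proof -
  have finB: "finite B" using simple_graph_finite[OF E] B finite_subset by blast
  have c: "card e = 2" "e \<subseteq> V" if "e \<in> B" for e using E B that by (auto simp: simple_graph_def)
  have finV: "finite V" using E by (simp add: simple_graph_def)
  have ends: "ends (edge_triple e) \<subseteq> V" if "e \<in> B" for e
    using edge_triple[OF c(1)[OF that]] c(2)[OF that] by (metis ends.simps)
  have r: "(\<Sum>e\<in>B. w e * erow True q m (edge_triple e)) =
      (\<Sum>u\<in>V. \<Sum>i\<in>UNIV. (\<Sum>e\<in>B. w e * rigidity_matrix q e (u, i)) * m u $ i)" for m
  proof -
    have "(\<Sum>e\<in>B. w e * erow True q m (edge_triple e)) =
        (\<Sum>e\<in>B. \<Sum>u\<in>V. \<Sum>i\<in>UNIV. w e * rigidity_matrix q e (u, i) * m u $ i)"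
      by (intro sum.cong refl) (simp add: erow_eq_sum[OF finV ends] inner_vec_def
        rigidity_matrix_erowv[OF c(1)] sum_distrib_left mult.assoc)
    also have "\<dots> = (\<Sum>u\<in>V. \<Sum>e\<in>B. \<Sum>i\<in>UNIV. w e * rigidity_matrix q e (u, i) * m u $ i)"
      by (rule sum.swap)
    also have "\<dots> = (\<Sum>u\<in>V. \<Sum>i\<in>UNIV. \<Sum>e\<in>B. w e * rigidity_matrix q e (u, i) * m u $ i)"
      by (intro sum.cong refl) (rule sum.swap)
    finally show ?thesis by (simp add: sum_distrib_right)
  qed
  show ?thesis
  proof
    assume h: "\<forall>m. (\<Sum>e\<in>B. w e * erow True q m (edge_triple e)) = 0"
    show "\<forall>x. (\<Sum>e\<in>B. w e * rigidity_matrix q e x) = 0"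
    proof
      fix x :: "'a \<times> 2"
      obtain u i where x: "x = (u, i)" by (cases x)
      show "(\<Sum>e\<in>B. w e * rigidity_matrix q e x) = 0"
      proof (cases "u \<in> V")
        case True
        define S where "S = (\<lambda>v j. (\<Sum>e\<in>B. w e * rigidity_matrix q e (v, j)))"
        define m where "m = (\<lambda>v. if v = u then axis i (1 :: real) else 0)"
        have "(\<Sum>j\<in>UNIV. S v j * m v $ j) = (if v = u then S u i else 0)" for v
          by (simp add: m_def axis_def if_distrib[of "\<lambda>x. _ * x"] cong: if_cong)
        then have "(\<Sum>v\<in>V. \<Sum>j\<in>UNIV. S v j * m v $ j) = S u i"
          using finV True by simp
        then show ?thesis using h r[of m] by (simp add: S_def x)
      next
        case False
        then have "rigidity_matrix q e x = 0" if "e \<in> B" for e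
          using c(2)[OF that] by (auto simp: x rigidity_matrix_def)
        then show ?thesis by simp
      qed
    qed
  next
    assume h: "\<forall>x. (\<Sum>e\<in>B. w e * rigidity_matrix q e x) = 0"
    show "\<forall>m. (\<Sum>e\<in>B. w e * erow True q m (edge_triple e)) = 0"
    proof
      fix m show "(\<Sum>e\<in>B. w e * erow True q m (edge_triple e)) = 0" unfolding r using h by simp
    qed
  qed
qed

interpretation FS: vector_space fun_scale
  by (rule vector_space_fun_scale)

lemma sum_fun_scale: "(\<Sum>v\<in>S. fun_scale (c v) (f v)) x = (\<Sum>v\<in>S. c v * f v x)"
  by (induction S rule: infinite_finite_induct) (simp_all add: fun_scale_def)

lemma indep_triples_iff:
  assumes E: "simple_graph V E" and B: "B \<subseteq> E"
  shows "indep True q (edge_triple ` B) \<longleftrightarrow>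
    (\<forall>w. (\<forall>x. (\<Sum>e\<in>B. w e * rigidity_matrix q e x) = 0) \<longrightarrow> (\<forall>e\<in>B. w e = 0))"
proof -
  have inj: "inj_on edge_triple B" using inj_on_subset[OF edge_triple_inj[OF E] B] .
  have s: "(\<Sum>f\<in>edge_triple ` B. w f * erow True q m f) =
      (\<Sum>e\<in>B. (w \<circ> edge_triple) e * erow True q m (edge_triple e))" for w m
    by (simp add: sum.reindex[OF inj])
  show ?thesis
  proof
    assume h: "indep True q (edge_triple ` B)"
    show "\<forall>w. (\<forall>x. (\<Sum>e\<in>B. w e * rigidity_matrix q e x) = 0) \<longrightarrow> (\<forall>e\<in>B. w e = 0)"
    proof (intro allI impI ballI)
      fix w e assume w: "\<forall>x. (\<Sum>e\<in>B. w e * rigidity_matrix q e x) = 0" and e: "e \<in> B"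
      define w' where "w' = (\<lambda>f. w (the_inv_into B edge_triple f))"
      have w': "(w' \<circ> edge_triple) e = w e" if "e \<in> B" for e
        by (simp add: w'_def the_inv_into_f_f[OF inj that])
      have "(\<Sum>f\<in>edge_triple ` B. w' f * erow True q m f) = 0" for m
      proof -
        have "(\<Sum>e\<in>B. (w' \<circ> edge_triple) e * erow True q m (edge_triple e)) =
            (\<Sum>e\<in>B. w e * erow True q m (edge_triple e))"
          by (intro sum.cong refl) (simp only: w')
        also have "\<dots> = 0" using w combination_zero_iff[OF E B, of w q] by simp
        finally show ?thesis unfolding s .
      qed
      then have "w' (edge_triple e) = 0" by (rule indepD[OF h]) (use e in simp)
      then show "w e = 0" using w'[OF e] by simp
    qed
  next
    assume h: "\<forall>w. (\<forall>x. (\<Sum>e\<in>B. w e * rigidity_matrix q e x) = 0) \<longrightarrow> (\<forall>e\<in>B. w e = 0)"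
    show "indep True q (edge_triple ` B)"
    proof (rule indepI)
      fix w f assume w: "\<And>m. (\<Sum>e\<in>edge_triple ` B. w e * erow True q m e) = 0" and f: "f \<in> edge_triple ` B"
      have "\<forall>m. (\<Sum>e\<in>B. (w \<circ> edge_triple) e * erow True q m (edge_triple e)) = 0"
        using w unfolding s by simp
      then have "\<forall>x. (\<Sum>e\<in>B. (w \<circ> edge_triple) e * rigidity_matrix q e x) = 0"
        unfolding combination_zero_iff[OF E B] .
      then have "\<forall>e\<in>B. (w \<circ> edge_triple) e = 0" by (rule spec[OF h, THEN mp])
      then show "w f = 0" using f by auto
    qed
  qed
qed

lemma card_le_rigidity_rank:
  assumes E: "simple_graph V E" and B: "B \<subseteq> E" and ind: "indep True q (edge_triple ` B)"
  shows "card B \<le> rigidity_rank E q"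
proof -
  let ?R = "rigidity_matrix q"
  have finE: "finite E" by (rule simple_graph_finite[OF E])
  have finB: "finite B" using B finE finite_subset by blast
  have h: "\<forall>e\<in>B. w e = 0" if "\<forall>x. (\<Sum>e\<in>B. w e * ?R e x) = 0" for w
    using ind that unfolding indep_triples_iff[OF E B] by simp
  have inj: "inj_on ?R B"
  proof (rule inj_onI, rule ccontr)
    fix e f assume ef: "e \<in> B" "f \<in> B" "?R e = ?R f" "e \<noteq> f"
    define w where "w = (\<lambda>g. if g = e then 1 else if g = f then -1 else (0 :: real))"
    have "(\<Sum>g\<in>B. w g * ?R g x) = 0" for x
    proof -
      have "(\<Sum>g\<in>B. w g * ?R g x) = (\<Sum>g\<in>{e, f}. w g * ?R g x)"
        by (rule sum.mono_neutral_right) (use ef finB in \<open>auto simp: w_def\<close>)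
      then show ?thesis using ef by (simp add: w_def)
    qed
    then have "w e = 0" using h ef(1) by blast
    then show False by (simp add: w_def)
  qed
  have "FS.independent (?R ` B)"
  proof
    assume "FS.dependent (?R ` B)"
    then obtain u where u: "\<exists>v\<in>?R ` B. u v \<noteq> 0" "(\<Sum>v\<in>?R ` B. fun_scale (u v) v) = 0"
      using finB by (auto simp: FS.dependent_finite)
    have "(\<Sum>e\<in>B. (u \<circ> ?R) e * ?R e x) = 0" for x
    proof -
      have "(\<Sum>v\<in>?R ` B. fun_scale (u v) v) x = 0" using u(2) by simp
      then show ?thesis unfolding sum_fun_scale by (simp add: sum.reindex[OF inj])
    qed
    then have "\<forall>e\<in>B. (u \<circ> ?R) e = 0" using h by blast
    then show False using u(1) by auto
  qed
  moreover obtain C where C: "C \<subseteq> ?R ` E" "FS.independent C" "?R ` E \<subseteq> FS.span C"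
    "card C = FS.dim (?R ` E)" by (rule FS.basis_exists)
  moreover have "?R ` B \<subseteq> FS.span C" using C(3) B by blast
  moreover have "finite C" using C(1) finE finite_subset by blast
  ultimately have "card (?R ` B) \<le> card C" using FS.independent_span_bound by blast
  then show ?thesis using C(4) card_image[OF inj] by (simp add: rigidity_rank_def)
qed

lemma ex_indep_rigidity_rank:
  assumes E: "simple_graph V E"
  shows "\<exists>B\<subseteq>E. card B = rigidity_rank E q \<and> indep True q (edge_triple ` B)"
proof -
  let ?R = "rigidity_matrix q"
  have finE: "finite E" by (rule simple_graph_finite[OF E])
  obtain C where C: "C \<subseteq> ?R ` E" "FS.independent C" "?R ` E \<subseteq> FS.span C"
    "card C = FS.dim (?R ` E)" by (rule FS.basis_exists)
  obtain B where B: "B \<subseteq> E" "inj_on ?R B" "C = ?R ` B" using C(1) by (meson subset_image_inj)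
  have finB: "finite B" using B finE finite_subset by blast
  have "indep True q (edge_triple ` B)"
    unfolding indep_triples_iff[OF E B(1)]
  proof (intro allI impI)
    fix w assume w: "\<forall>x. (\<Sum>e\<in>B. w e * ?R e x) = 0"
    define u where "u = (\<lambda>v. w (the_inv_into B ?R v))"
    have u: "u (?R e) = w e" if "e \<in> B" for e by (simp add: u_def the_inv_into_f_f[OF B(2) that])
    have "(\<Sum>v\<in>C. fun_scale (u v) v) = 0"
    proof
      fix x
      have "(\<Sum>v\<in>C. fun_scale (u v) v) x = (\<Sum>e\<in>B. u (?R e) * ?R e x)"
        unfolding sum_fun_scale B(3) by (simp add: sum.reindex[OF B(2)])
      also have "\<dots> = (\<Sum>e\<in>B. w e * ?R e x)" by (intro sum.cong refl) (simp only: u)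
      finally show "(\<Sum>v\<in>C. fun_scale (u v) v) x = 0 x" using w by simp
    qed
    then have "\<forall>v\<in>C. u v = 0" using C(2) finB B(3) by (auto simp: FS.dependent_finite)
    then show "\<forall>e\<in>B. w e = 0" using B(3) u by simp
  qed
  then show ?thesis using B(1) C(4) card_image[OF B(2)] B(3) by (auto simp: rigidity_rank_def)
qed

section \<open>Rigidity as a condition on the rank\<close>

lemma skew_2:
  fixes M :: "real^2^2"
  assumes "transpose M = - M"
  shows "M *v x = (M $ 2 $ 1) *\<^sub>R rotJ x"
proof -
  have m: "M $ i $ j = - M $ j $ i" for i j
    using arg_cong[OF assms, of "\<lambda>A. A $ j $ i"] by (simp add: transpose_def)
  then have "M $ 1 $ 1 = 0" "M $ 2 $ 2 = 0" "M $ 1 $ 2 = - M $ 2 $ 1" by (metis equal_neg_zero)+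
  then show ?thesis by (simp add: vec_eq_2 matrix_vector_mult_def sum_2)
qed

lemma trivial_motion_iff:
  "trivial_motion V p m \<longleftrightarrow> (\<exists>c t. \<forall>u\<in>V. m u = c *\<^sub>R rotJ (p u) + t)"
proof
  assume "trivial_motion V p m"
  then obtain M t where M: "transpose M = - M" "\<forall>u\<in>V. m u = M *v p u + t"
    unfolding trivial_motion_def by (elim exE conjE)
  then show "\<exists>c t. \<forall>u\<in>V. m u = c *\<^sub>R rotJ (p u) + t"
    using skew_2[OF M(1)] by (intro exI[of _ "M $ 2 $ 1"] exI[of _ t]) simp
next
  assume "\<exists>c t. \<forall>u\<in>V. m u = c *\<^sub>R rotJ (p u) + t"
  then obtain c t where c: "\<forall>u\<in>V. m u = c *\<^sub>R rotJ (p u) + t" by (elim exE)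
  define M :: "real^2^2" where "M = vector [vector [0, - c], vector [c, 0]]"
  have "transpose M = - M" by (simp add: M_def transpose_def vec_eq_iff forall_2)
  moreover have "M *v x = c *\<^sub>R rotJ x" for x by (simp add: M_def vec_eq_2 matrix_vector_mult_def sum_2)
  ultimately show "trivial_motion V p m" unfolding trivial_motion_def using c by (intro exI[of _ M] exI[of _ t]) simp
qed

text \<open>With fewer than \<open>2 * card V - 3\<close> independent rows there would be a nonzero
  motion that fixes \<open>a\<close> and keeps \<open>b\<close> from rotating about it. Rigidity
  makes this motion trivial, hence zero.\<close>

lemma rigid_imp_rank:
  assumes fr: "framework V E q" and rig: "infinitesimally_rigid V E q" and V: "2 \<le> card V"
  shows "2 * card V \<le> rigidity_rank E q + 3"
proof -
  have E: "simple_graph V E" and inj: "inj_on q V" using fr by (simp_all add: framework_def)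
  have finE: "finite E" by (rule simple_graph_finite[OF E])
  have finV: "finite V" using E by (simp add: simple_graph_def)
  obtain a b where ab: "a \<in> V" "b \<in> V" "a \<noteq> b" using V by (metis card_2_iff' obtain_subset_with_card_n subsetD)
  have nab: "q b - q a \<noteq> 0" using inj ab by (auto dest: inj_onD)
  from ex_maximal_indep[OF finite_imageI[OF finE], of edge_triple True q]
  obtain T where T: "T \<subseteq> edge_triple ` E" "indep True q T"
    "\<forall>m. (\<forall>f\<in>T. erow True q m f = 0) \<longrightarrow> (\<forall>f\<in>edge_triple ` E. erow True q m f = 0)" by (elim exE conjE)
  obtain B where B: "B \<subseteq> E" "inj_on edge_triple B" "T = edge_triple ` B" using T(1) by (meson subset_image_inj)
  have finT: "finite T" using T(1) finE finite_subset by blast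
  have VT: "VF T \<subseteq> V"
  proof
    fix x assume "x \<in> VF T"
    then obtain e where e: "e \<in> E" "x \<in> ends (edge_triple e)" using T(1) by (auto simp: VF_def)
    then have "card e = 2" "e \<subseteq> V" using E by (auto simp: simple_graph_def)
    then show "x \<in> V" using e(2) edge_triple[of e] by (metis ends.simps subsetD)
  qed
  have "2 * card V \<le> card T + 3"
  proof (rule ccontr)
    assume "\<not> ?thesis"
    then have lt: "length [(a, axis 1 1 :: real^2), (a, axis 2 1), (b, rotJ (q b - q a))] + card T < 2 * card V" by simp
    have "\<exists>m. (\<exists>u\<in>V. m u \<noteq> 0) \<and> (\<forall>f\<in>T. erow True q m f = 0) \<and>
        (\<forall>(x, d)\<in>set [(a, axis 1 1 :: real^2), (a, axis 2 1), (b, rotJ (q b - q a))]. d \<bullet> m x = 0)"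
      by (rule homogeneous_motion[OF finT finV VT lt]) (use ab in auto)
    then obtain m where m: "\<exists>u\<in>V. m u \<noteq> 0" "\<forall>f\<in>T. erow True q m f = 0"
      "\<forall>(x, d)\<in>set [(a, axis 1 1 :: real^2), (a, axis 2 1), (b, rotJ (q b - q a))]. d \<bullet> m x = 0" by (elim exE conjE)
    have "infinitesimal_motion E q m" using T(3) m(2) infinitesimal_motion_iff_erow[OF E] by simp
    then have "trivial_motion V q m" using rig by (simp add: infinitesimally_rigid_def)
    then obtain c t where c: "\<forall>u\<in>V. m u = c *\<^sub>R rotJ (q u) + t" unfolding trivial_motion_iff by (elim exE)
    have ma: "c *\<^sub>R rotJ (q a) + t = 0" using m(3) c ab(1) by (simp add: axis_inner vec_eq_2)
    have "rotJ (q b - q a) \<bullet> (c *\<^sub>R rotJ (q b) + t) = 0" using m(3) c ab(2) by simp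
    moreover have "c *\<^sub>R rotJ (q b) + t = c *\<^sub>R rotJ (q b - q a) + (c *\<^sub>R rotJ (q a) + t)"
      by (simp add: rotJ_linear algebra_simps)
    ultimately have "c * (rotJ (q b - q a) \<bullet> rotJ (q b - q a)) = 0" using ma by simp
    then have "c = 0" using nab by simp
    then have "t = 0" using ma by simp
    then show False using m(1) c \<open>c = 0\<close> by simp
  qed
  also have "card T = card B" using card_image[OF B(2)] B(3) by simp
  also have "card B \<le> rigidity_rank E q" by (rule card_le_rigidity_rank[OF E B(1)]) (use T(2) B(3) in simp)
  finally show ?thesis by simp
qed

lemma rank_imp_rigid:
  assumes fr: "framework V E q" and rk: "2 * card V \<le> rigidity_rank E q + 3" and V: "2 \<le> card V"
  shows "infinitesimally_rigid V E q"
  unfolding infinitesimally_rigid_def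
proof (intro allI impI)
  fix m assume mot: "infinitesimal_motion E q m"
  \<comment> \<open>The framework is regarded as a balanced signed graph without fixed vertices;
    \<open>2 * card V - 3\<close> independent edges are then tight, and the constant potential gives
    the usual trivial motions.\<close>
  interpret signed_setting True "{} :: 'a set" by unfold_locales auto
  have E: "simple_graph V E" and inj: "inj_on q V" using fr by (simp_all add: framework_def)
  have finE: "finite E" by (rule simple_graph_finite[OF E])
  have finV: "finite V" using E by (simp add: simple_graph_def)
  obtain a b where ab: "a \<in> V" "b \<in> V" "a \<noteq> b" using V by (metis card_2_iff' obtain_subset_with_card_n subsetD)
  obtain B0 where B0: "B0 \<subseteq> E" "card B0 = rigidity_rank E q" "indep True q (edge_triple ` B0)"
    using ex_indep_rigidity_rank[OF E, of q] by (elim exE conjE)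
  have "2 * card V - 3 \<le> card B0" using rk B0(2) by simp
  then obtain B where B: "B \<subseteq> B0" "card B = 2 * card V - 3" by (meson obtain_subset_with_card_n)
  let ?T = "edge_triple ` B"
  have BE: "B \<subseteq> E" using B(1) B0(1) by blast
  have finT: "finite ?T" using BE finE finite_subset by blast
  have cT: "card ?T + 3 = 2 * card V"
    using card_image[OF inj_on_subset[OF edge_triple_inj[OF E] BE]] B(2) V by simp
  have "finite B0" using B0(1) finE finite_subset by blast
  then have ind: "indep True q ?T" by (intro indep_subset[OF B0(3)] image_mono B(1) finite_imageI)
  have tri: "\<exists>u v. f = (u, v, 1) \<and> u \<in> V \<and> v \<in> V" if fT: "f \<in> ?T" for f
  proof -
    obtain e where e: "e \<in> E" "f = edge_triple e" using fT BE by blast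
    then have "card e = 2" "e \<subseteq> V" using E by (auto simp: simple_graph_def)
    then show ?thesis using e(2) edge_triple[of e] by (metis insert_subset)
  qed
  have VT: "VF ?T \<subseteq> V"
  proof
    fix x assume "x \<in> VF ?T"
    then obtain f where f: "f \<in> ?T" "x \<in> ends f" unfolding VF_def by blast
    then show "x \<in> V" using tri[OF f(1)] by auto
  qed
  have sT: "signed ?T" unfolding signed_def using tri by fastforce
  have pot: "potential {} (\<lambda>_. 1) ?T" unfolding potential_def using tri by fastforce
  have mT: "\<forall>f\<in>?T. erow True q m f = 0"
    using mot BE infinitesimal_motion_iff_erow[OF E] by blast
  have "\<exists>t c. \<forall>u\<in>V. m u = tmot True (\<lambda>_. 1) q t c u"
    by (rule tight_motions_bal[OF finT ind sT finV VT cT mT pot _ ab(1,2)])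
      (use inj ab in \<open>auto dest: inj_onD\<close>)
  then show "trivial_motion V q m"
    unfolding trivial_motion_iff by (elim exE) (auto simp: tmot_def chi_def add.commute)
qed

section \<open>Balanced gain graphs\<close>

text \<open>The direction of a step is irrelevant here, as signs are their own inverses.\<close>

definition walk_sign :: "('b \<Rightarrow> real) \<Rightarrow> ('b \<times> bool) list \<Rightarrow> real" where
  "walk_sign s w = (\<Prod>x\<leftarrow>w. s (fst x))"

lemma walk_sign_simps [simp]:
  "walk_sign s [] = 1" "walk_sign s (x # w) = s (fst x) * walk_sign s w"
  "walk_sign s (v @ w) = walk_sign s v * walk_sign s w"
  by (simp_all add: walk_sign_def)

lemma gain_walk_append:
  "gain_walk D u (v @ w) x \<longleftrightarrow> (\<exists>y. gain_walk D u v y \<and> gain_walk D y w x)"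
  if "wf_digraph D"
proof (induction v arbitrary: u)
  case Nil
  have "u \<in> verts D" if "gain_walk D u w x"
  proof (cases w)
    case (Cons s w')
    obtain e d where s: "s = (e, d)" by (cases s)
    have "e \<in> arcs D" "step_start D (e, d) = u" using that Cons s by simp_all
    then show ?thesis using \<open>wf_digraph D\<close> by (auto simp: wf_digraph_def split: if_splits)
  qed (use that in auto)
  then show ?case by auto
qed auto

definition reverse_walk :: "('b \<times> bool) list \<Rightarrow> ('b \<times> bool) list" where
  "reverse_walk w = rev (map (\<lambda>(e, d). (e, \<not> d)) w)"

lemma walk_sign_reverse: "walk_sign s (reverse_walk w) = walk_sign s w"
  by (induction w) (auto simp: reverse_walk_def)

lemma gain_walk_reverse:
  assumes "wf_digraph D" "gain_walk D u w v"
  shows "gain_walk D v (reverse_walk w) u"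
  using assms(2)
proof (induction w arbitrary: u)
  case Nil
  then show ?case by (auto simp: reverse_walk_def)
next
  case (Cons s w)
  obtain e d where s: "s = (e, d)" by (cases s)
  have e: "e \<in> arcs D" "step_start D (e, d) = u" "gain_walk D (step_end D (e, d)) w v"
    using Cons.prems s by simp_all
  have "u \<in> verts D" using e assms(1) by (auto simp: wf_digraph_def split: if_splits)
  then have "gain_walk D (step_end D (e, d)) [(e, \<not> d)] u" using e by auto
  moreover have "reverse_walk (s # w) = reverse_walk w @ [(e, \<not> d)]" by (simp add: reverse_walk_def s)
  ultimately show ?case using Cons.IH[OF e(3)] gain_walk_append[OF assms(1)] by auto
qed

text \<open>A closed walk that is no cycle repeats a starting vertex or an arc. In the first case it
  splits into two shorter closed walks; an arc repeated in the same direction is an instance of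
  this.\<close>

lemma closed_walk_sign:
  assumes wf: "wf_digraph D" and s: "\<And>e. e \<in> arcs D \<Longrightarrow> s e = 1 \<or> s e = -1"
    and cyc: "\<And>w. gain_cycle D w \<Longrightarrow> walk_sign s w = 1"
    and w: "gain_walk D u w u"
  shows "walk_sign s w = 1"
  using w
proof (induction w arbitrary: u rule: length_induct)
  case (1 w)
  have IH: "walk_sign s w' = 1" if "length w' < length w" "gain_walk D u' w' u'" for w' u'
    using 1(1) that by blast
  have split: ?case if sp: "w = a @ x # b @ y # c" and eq: "step_start D x = step_start D y" for a x b y c
  proof -
    obtain p where p: "gain_walk D u a p" "gain_walk D p (x # b @ y # c) u"
      using 1(2) unfolding sp gain_walk_append[OF wf] by (elim exE conjE)
    have p': "gain_walk D p ((x # b) @ (y # c)) u" using p(2) by simp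
    then obtain q where q: "gain_walk D p (x # b) q" "gain_walk D q (y # c) u"
      unfolding gain_walk_append[OF wf] by (elim exE conjE)
    have "p = q" using p(2) q(2) eq by simp
    then have "walk_sign s (x # b) = 1" by (intro IH[of _ p]) (use q in \<open>simp_all add: sp\<close>)
    moreover have "gain_walk D u (a @ y # c) u"
      unfolding gain_walk_append[OF wf] using p(1) q(2) \<open>p = q\<close> by (intro exI[of _ p]) simp
    then have "walk_sign s (a @ y # c) = 1" by (intro IH[of _ u]) (simp_all add: sp)
    moreover have "walk_sign s w = walk_sign s (x # b) * walk_sign s (a @ y # c)"
      by (simp add: sp mult_ac)
    ultimately show ?thesis by (simp only: mult_1_right)
  qed
  show ?case
  proof (cases "w = []")
    case False
    show ?thesis
    proof (cases "distinct (map (step_start D) w)")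
      case False
      then obtain a b c z where "map (step_start D) w = a @ [z] @ b @ [z] @ c"
        using not_distinct_decomp by blast
      then obtain a' x b' y c' where "w = a' @ x # b' @ y # c'" "step_start D x = z" "step_start D y = z"
        by (auto simp: map_eq_append_conv map_eq_Cons_conv Cons_eq_map_conv append_eq_map_conv)
      then show ?thesis by (intro split[of a' x b' y c']) simp_all
    next
      case ds: True
      show ?thesis
      proof (cases "distinct (map fst w)")
        case True
        then have "gain_cycle D w" using ds False 1(2) unfolding gain_cycle_def by blast
        then show ?thesis by (rule cyc)
      next
        case nd: False
        then obtain a b c z where "map fst w = a @ [z] @ b @ [z] @ c"
          using not_distinct_decomp by blast
        then obtain a' x b' y c' where sp: "w = a' @ x # b' @ y # c'" and xy: "fst x = z" "fst y = z"
          by (auto simp: map_eq_append_conv map_eq_Cons_conv Cons_eq_map_conv append_eq_map_conv)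
        obtain d d' where x: "x = (z, d)" and y: "y = (z, d')" using xy by (cases x; cases y) simp
        show ?thesis
        proof (cases "d = d'")
          case True
          then show ?thesis by (intro split[OF sp]) (simp add: x y)
        next
          \<comment> \<open>The arc is traversed back and forth. Its two signs cancel, the part
            between the traversals is closed, and so is the rest.\<close>
          case dd: False
          obtain p where p: "gain_walk D u a' p" "gain_walk D p (x # b' @ y # c') u"
            using 1(2) unfolding sp gain_walk_append[OF wf] by (elim exE conjE)
          have zD: "z \<in> arcs D" and px: "step_start D x = p"
            and "gain_walk D (step_end D x) (b' @ y # c') u" using p(2) by (simp_all add: x)
          then obtain q where q: "gain_walk D (step_end D x) b' q" "gain_walk D q (y # c') u"
            unfolding gain_walk_append[OF wf] by (elim exE conjE)
          have "q = step_start D y" using q(2) by simp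
          also have "\<dots> = step_end D x" using dd by (simp add: x y)
          finally have "walk_sign s b' = 1" by (intro IH[of _ q]) (use q in \<open>simp_all add: sp\<close>)
          moreover have "step_end D y = p" using px dd by (auto simp: x y)
          then have "gain_walk D p c' u" using q(2) by simp
          then have "gain_walk D u (a' @ c') u"
            unfolding gain_walk_append[OF wf] using p(1) by (intro exI[of _ p]) simp
          then have "walk_sign s (a' @ c') = 1" by (intro IH[of _ u]) (simp_all add: sp)
          moreover have "walk_sign s w = (s z * s z) * (walk_sign s b' * walk_sign s (a' @ c'))"
            by (simp add: sp x y mult_ac)
          moreover have "s z * s z = 1" using s[OF zD] by auto
          ultimately show ?thesis by simp
        qed
      qed
    qed
  qed simp
qed

text \<open>Harary's theorem: sign a vertex by a walk from a base point of its component.\<close>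

lemma ex_potential_digraph:
  assumes wf: "wf_digraph D" and s: "\<And>e. e \<in> arcs D \<Longrightarrow> s e = 1 \<or> s e = -1"
    and cyc: "\<And>w. gain_cycle D w \<Longrightarrow> walk_sign s w = 1"
  shows "\<exists>\<sigma> :: 'a \<Rightarrow> real. (\<forall>x. \<sigma> x = 1 \<or> \<sigma> x = -1) \<and>
    (\<forall>e\<in>arcs D. s e = \<sigma> (tail D e) * \<sigma> (head D e))"
proof -
  define comp where "comp = (\<lambda>v. {u. \<exists>w. gain_walk D v w u})"
  \<comment> \<open>The choice depends on the set \<open>comp v\<close> only, so all vertices of a
    component obtain the same base point.\<close>
  define base where "base = (\<lambda>v. SOME u. u \<in> comp v)"
  define wlk where "wlk = (\<lambda>v. SOME w. gain_walk D v w (base v))"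
  define \<sigma> where "\<sigma> = (\<lambda>v. if walk_sign s (wlk v) = 1 then 1 else (-1 :: real))"
  have pm: "walk_sign s w = 1 \<or> walk_sign s w = -1" if "gain_walk D u w v" for u w v
    using that
  proof (induction w arbitrary: u)
    case (Cons x w)
    then have "walk_sign s w = 1 \<or> walk_sign s w = -1" "s (fst x) = 1 \<or> s (fst x) = -1"
      using s by auto
    then show ?case by auto
  qed simp
  have wlk: "gain_walk D v (wlk v) (base v)" if "v \<in> verts D" for v
  proof -
    have "gain_walk D v [] v" using that by simp
    then have "v \<in> comp v" unfolding comp_def by blast
    then have "base v \<in> comp v" unfolding base_def by (rule someI)
    then have "\<exists>w. gain_walk D v w (base v)" by (simp add: comp_def)
    then show ?thesis unfolding wlk_def by (rule someI_ex)
  qed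
  have sub: "comp v \<subseteq> comp u" if "gain_walk D u w v" for u w v
  proof
    fix x assume "x \<in> comp v"
    then obtain w' where "gain_walk D v w' x" by (auto simp: comp_def)
    then have "gain_walk D u (w @ w') x" using that gain_walk_append[OF wf] by blast
    then show "x \<in> comp u" unfolding comp_def by blast
  qed
  have "s e = \<sigma> (tail D e) * \<sigma> (head D e)" if e: "e \<in> arcs D" for e
  proof -
    let ?t = "tail D e" and ?h = "head D e"
    have th: "?t \<in> verts D" "?h \<in> verts D" using wf e by (simp_all add: wf_digraph_def)
    have st: "gain_walk D ?h [(e, False)] ?t" using e th by simp
    have "comp ?t = comp ?h"
      using sub[OF st] sub[OF gain_walk_reverse[OF wf st]] by blast
    then have b: "base ?t = base ?h" by (simp add: base_def)
    \<comment> \<open>The arc backwards from head to tail, on to the base point, and back to the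
      head: a closed walk of sign 1.\<close>
    have gw: "gain_walk D ?h ([(e, False)] @ wlk ?t @ reverse_walk (wlk ?h)) ?h"
      unfolding gain_walk_append[OF wf]
      using st wlk[OF th(1)] gain_walk_reverse[OF wf wlk[OF th(2)]] b by metis
    have "walk_sign s ([(e, False)] @ wlk ?t @ reverse_walk (wlk ?h)) = 1"
      by (rule closed_walk_sign[OF wf s cyc gw])
    then have "s e * (walk_sign s (wlk ?t) * walk_sign s (wlk ?h)) = 1" by (simp add: walk_sign_reverse)
    then show ?thesis using pm[OF wlk[OF th(1)]] pm[OF wlk[OF th(2)]] s[OF e] by (auto simp: \<sigma>_def)
  qed
  then show ?thesis by (intro exI[of _ \<sigma>]) (simp add: \<sigma>_def)
qed

lemma potential_walk_sign:
  assumes "gain_walk D u w v" and "\<And>x. \<sigma> x = 1 \<or> \<sigma> x = (-1 :: real)"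
    and "\<And>e. e \<in> arcs D \<Longrightarrow> s e = \<sigma> (tail D e) * \<sigma> (head D e)"
  shows "walk_sign s w = \<sigma> u * \<sigma> v"
  using assms(1)
proof (induction w arbitrary: u)
  case Nil
  then show ?case using assms(2)[of u] by auto
next
  case (Cons x w)
  obtain e d where x: "x = (e, d)" by (cases x)
  have "s e = \<sigma> u * \<sigma> (step_end D x)" using Cons.prems assms(3)[of e] by (auto simp: x)
  moreover have "walk_sign s w = \<sigma> (step_end D x) * \<sigma> v" using Cons by simp
  ultimately show ?case using assms(2)[of "step_end D x"] by (auto simp: x)
qed

section \<open>The quotient of a plane framework by a half-turn\<close>

text \<open>The involution \<open>\<iota>\<close> is the action of the generator; orbits have the
  form \<open>orb v\<close>. The defining equations of \<open>orb\<close>, \<open>FX\<close> and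
  \<open>FR\<close> are assumptions so that the orbit sets of the group action can be substituted
  for them. \<open>fixed_unique\<close> reflects that fixed vertices lie at the origin.\<close>

locale c2_quotient =
  fixes \<Gamma> :: "'g monoid" and \<gamma> :: 'g and V :: "'v set" and E :: "'v set set"
    and \<iota> :: "'v \<Rightarrow> 'v" and G :: "('v set, 'v set set) pre_digraph" and \<psi> :: "'v set set \<Rightarrow> 'g"
    and r :: "'v set \<Rightarrow> 'v" and orb :: "'v \<Rightarrow> 'v set" and FX FR :: "'v set set"
  assumes orb_def: "orb = (\<lambda>v. {v, \<iota> v})"
    and FX_def: "FX = orb ` {v \<in> V. \<iota> v = v}" and FR_def: "FR = orb ` {v \<in> V. \<iota> v \<noteq> v}"
    and graph: "simple_graph V E"
    and iota_V: "\<And>v. v \<in> V \<Longrightarrow> \<iota> v \<in> V" and iota_iota: "\<And>v. v \<in> V \<Longrightarrow> \<iota> (\<iota> v) = v"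
    and iota_E: "\<And>u v. {u, v} \<in> E \<Longrightarrow> {\<iota> u, \<iota> v} \<in> E"
    and fixed_unique: "\<And>u v. u \<in> V \<Longrightarrow> v \<in> V \<Longrightarrow> \<iota> u = u \<Longrightarrow> \<iota> v = v \<Longrightarrow> u = v"
    and vertsG: "verts G = orb ` V" and arcsG: "arcs G = (\<lambda>e. {e, \<iota> ` e}) ` E"
    and endsG: "\<And>e. e \<in> arcs G \<Longrightarrow> \<exists>u v. {u, v} \<in> e \<and> tail G e = orb u \<and> head G e = orb v"
    and rep: "\<And>x. x \<in> verts G \<Longrightarrow> r x \<in> x"
    and group: "group \<Gamma>" and carrier: "carrier \<Gamma> = {\<one>\<^bsub>\<Gamma>\<^esub>, \<gamma>}" and gamma: "\<gamma> \<noteq> \<one>\<^bsub>\<Gamma>\<^esub>"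
    and gain_carrier: "\<And>e. e \<in> arcs G \<Longrightarrow> \<psi> e \<in> carrier \<Gamma>"
    and gain: "\<And>e. e \<in> arcs G \<Longrightarrow> tail G e \<in> FR \<Longrightarrow> head G e \<in> FR \<Longrightarrow>
      {r (tail G e), if \<psi> e = \<one>\<^bsub>\<Gamma>\<^esub> then r (head G e) else \<iota> (r (head G e))} \<in> e"
begin

definition sn :: "'v set set \<Rightarrow> real" where
  "sn e = (if \<psi> e = \<one>\<^bsub>\<Gamma>\<^esub> then 1 else -1)"

text \<open>The equivariant extension from representatives to all vertices.
  \<open>\<epsilon>\<close> is -1 for positions and symmetric motions, on which the half-turn acts
  as -1, and 1 for anti-symmetric motions.\<close>

definition lift :: "real \<Rightarrow> ('v set \<Rightarrow> real^2) \<Rightarrow> 'v \<Rightarrow> real^2" where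
  "lift \<epsilon> x v = (if v = r (orb v) then x (orb v) else \<epsilon> *\<^sub>R x (orb v))"

text \<open>The fixed vertex does not move symmetrically, so an edge at it acts on its free end \<open>u\<close> like the
  loop at \<open>u\<close>: both prescribe \<open>p u \<bullet> m u = 0\<close>.\<close>

definition trip :: "bool \<Rightarrow> 'v set set \<Rightarrow> 'v set sedge" where
  "trip A e = (if A \<or> (tail G e \<in> FR \<and> head G e \<in> FR) then (tail G e, head G e, sn e)
     else if tail G e \<in> FX then (head G e, head G e, -1) else (tail G e, tail G e, -1))"

text \<open>The member of the edge orbit that can be read off from representatives and gain. At a
  fixed vertex the gain is arbitrary and therefore ignored.\<close>

definition core :: "'v set set \<Rightarrow> 'v set" where
  "core e = {r (tail G e), if tail G e \<in> FR \<and> head G e \<in> FR \<and> \<psi> e \<noteq> \<one>\<^bsub>\<Gamma>\<^esub> then \<iota> (r (head G e)) else r (head G e)}"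

lemma sn_pm: "sn e = 1 \<or> sn e = -1"
  by (simp add: sn_def)

section \<open>Orbits, representatives and lifted motions\<close>

lemma finite_V: "finite V" and edge_V: "{u, v} \<in> E \<Longrightarrow> u \<in> V \<and> v \<in> V \<and> u \<noteq> v"
  using graph by (auto simp: simple_graph_def card_2_iff doubleton_eq_iff)

lemma finite_arcs: "finite (arcs G)"
  using simple_graph_finite[OF graph] by (simp add: arcsG)

lemma finite_verts: "finite (verts G)"
  using finite_V by (simp add: vertsG)

lemma orb_mem: "v \<in> orb v" "\<iota> v \<in> orb v"
  by (simp_all add: orb_def)

lemma orb_iota: "v \<in> V \<Longrightarrow> orb (\<iota> v) = orb v"
  by (auto simp: orb_def iota_iota)

lemma orb_eq: "v \<in> V \<Longrightarrow> u \<in> orb v \<Longrightarrow> orb u = orb v \<and> u \<in> V"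
proof -
  assume v: "v \<in> V" and "u \<in> orb v"
  then have "u = v \<or> u = \<iota> v" by (simp add: orb_def)
  then show ?thesis using v iota_V[OF v] orb_iota[OF v] by auto
qed

lemma verts_cases: "x \<in> verts G \<longleftrightarrow> x \<in> FX \<or> x \<in> FR"
  by (auto simp: vertsG FX_def FR_def)

lemma orb_FX: "v \<in> V \<Longrightarrow> orb v \<in> FX \<longleftrightarrow> \<iota> v = v"
proof
  assume v: "v \<in> V" "orb v \<in> FX"
  then obtain u where u: "u \<in> V" "\<iota> u = u" "orb v = orb u" by (auto simp: FX_def)
  then show "\<iota> v = v" using orb_mem[of v] by (auto simp: orb_def)
qed (simp add: FX_def)

lemma orb_FR: "v \<in> V \<Longrightarrow> orb v \<in> FR \<longleftrightarrow> \<iota> v \<noteq> v"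
proof
  assume v: "v \<in> V" "orb v \<in> FR"
  then obtain u where u: "u \<in> V" "\<iota> u \<noteq> u" "orb v = orb u" by (auto simp: FR_def)
  then have "v = u \<or> v = \<iota> u" using orb_mem(1)[of v] by (auto simp: orb_def)
  then show "\<iota> v \<noteq> v" using u iota_iota[OF u(1)] by auto
qed (simp add: FR_def)

lemma FX_FR: "x \<in> FX \<Longrightarrow> x \<notin> FR"
proof -
  assume "x \<in> FX"
  then obtain v where "v \<in> V" "\<iota> v = v" "x = orb v" unfolding FX_def by blast
  then show ?thesis using orb_FR[of v] by simp
qed

lemma FX_unique: "x \<in> FX \<Longrightarrow> y \<in> FX \<Longrightarrow> x = y"
proof -
  assume "x \<in> FX" "y \<in> FX"
  then obtain u v where "u \<in> V" "\<iota> u = u" "x = orb u" "v \<in> V" "\<iota> v = v" "y = orb v"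
    unfolding FX_def by blast
  then show ?thesis using fixed_unique[of u v] by simp
qed

lemma rep_orb: "x \<in> verts G \<Longrightarrow> orb (r x) = x \<and> r x \<in> V"
proof -
  assume x: "x \<in> verts G"
  then obtain v where v: "v \<in> V" "x = orb v" unfolding vertsG by blast
  then show ?thesis using orb_eq[OF v(1), of "r x"] rep[OF x] by simp
qed

lemma rep_FR: "x \<in> FR \<Longrightarrow> \<iota> (r x) \<noteq> r x"
  using rep_orb[of x] orb_FR[of "r x"] verts_cases by simp

lemma rep_FX: "x \<in> FX \<Longrightarrow> \<iota> (r x) = r x"
  using rep_orb[of x] orb_FX[of "r x"] verts_cases by simp

lemma rep_cases: "v \<in> V \<Longrightarrow> v = r (orb v) \<or> v = \<iota> (r (orb v))"
proof -
  assume v: "v \<in> V"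
  then have "orb (r (orb v)) = orb v" using rep_orb[of "orb v"] by (simp add: vertsG)
  then have "v \<in> orb (r (orb v))" using orb_mem by simp
  then show ?thesis by (simp add: orb_def)
qed

lemma rep_cases': "v \<in> V \<Longrightarrow> v = r (orb v) \<or> \<iota> v = r (orb v)"
proof -
  assume v: "v \<in> V"
  then have "r (orb v) \<in> V" using rep_orb[of "orb v"] by (simp add: vertsG)
  then show ?thesis using rep_cases[OF v] iota_iota[of "r (orb v)"] by auto
qed

lemma lift_rep: "x \<in> verts G \<Longrightarrow> lift \<epsilon> m (r x) = m x"
  using rep_orb[of x] by (simp add: lift_def)

lemma lift_iota_rep: "x \<in> FR \<Longrightarrow> lift \<epsilon> m (\<iota> (r x)) = \<epsilon> *\<^sub>R m x"
  using rep_orb[of x] rep_FR[of x] orb_iota[of "r x"] verts_cases by (simp add: lift_def)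

lemma lift_iota:
  assumes v: "v \<in> V" and e: "\<epsilon> = 1 \<or> \<epsilon> = -1 \<and> (\<forall>x\<in>FX. m x = 0)"
  shows "lift \<epsilon> m (\<iota> v) = \<epsilon> *\<^sub>R lift \<epsilon> m v"
proof (cases "\<iota> v = v")
  case True
  then have "lift \<epsilon> m v = m (orb v)" "orb v \<in> FX" using rep_cases[OF v] orb_FX[OF v] rep_FX[of "orb v"]
    by (auto simp: lift_def)
  then show ?thesis using e True by auto
next
  case False
  let ?x = "orb v"
  have x: "?x \<in> FR" "?x \<in> verts G" using orb_FR[OF v] False v by (auto simp: vertsG)
  show ?thesis using rep_cases[OF v]
  proof
    assume "v = r ?x"
    then show ?thesis using lift_rep[OF x(2), of \<epsilon> m] lift_iota_rep[OF x(1), of \<epsilon> m] by simp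
  next
    assume vi: "v = \<iota> (r ?x)"
    then have "\<iota> v = r ?x" using iota_iota rep_orb[OF x(2)] by metis
    moreover have "lift \<epsilon> m v = \<epsilon> *\<^sub>R m ?x" using lift_iota_rep[OF x(1), of \<epsilon> m] vi by simp
    ultimately show ?thesis using lift_rep[OF x(2), of \<epsilon> m] e by auto
  qed
qed

lemma iota_image_twice: "f \<in> E \<Longrightarrow> \<iota> ` \<iota> ` f = f"
proof -
  assume "f \<in> E"
  then have "f \<subseteq> V" using graph by (simp add: simple_graph_def)
  then have "\<iota> ` \<iota> ` f = id ` f" unfolding image_image by (intro image_cong) (auto simp: iota_iota)
  then show ?thesis by simp
qed

lemma arc_eq: "e \<in> arcs G \<Longrightarrow> f \<in> e \<Longrightarrow> e = {f, \<iota> ` f}"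
proof -
  assume "e \<in> arcs G" and f: "f \<in> e"
  then obtain f0 where f0: "f0 \<in> E" "e = {f0, \<iota> ` f0}" by (auto simp: arcsG)
  then show ?thesis using f iota_image_twice[OF f0(1)] by auto
qed

lemma arc_E: "e \<in> arcs G \<Longrightarrow> f \<in> e \<Longrightarrow> f \<in> E"
proof -
  assume "e \<in> arcs G" and f: "f \<in> e"
  then obtain f0 where f0: "f0 \<in> E" "e = {f0, \<iota> ` f0}" by (auto simp: arcsG)
  obtain u v where "f0 = {u, v}" using f0(1) graph by (auto simp: simple_graph_def card_2_iff)
  then have "\<iota> ` f0 \<in> E" using iota_E[of u v] f0(1) by simp
  then show ?thesis using f f0 by auto
qed

lemma arc_iota: "e \<in> arcs G \<Longrightarrow> {u, v} \<in> e \<Longrightarrow> {\<iota> u, \<iota> v} \<in> e"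
  using arc_eq[of e "{u, v}"] by auto

lemma arc_ends:
  assumes e: "e \<in> arcs G"
  shows "tail G e \<in> verts G" "head G e \<in> verts G" "\<not> (tail G e \<in> FX \<and> head G e \<in> FX)"
proof -
  obtain u v where uv: "{u, v} \<in> e" "tail G e = orb u" "head G e = orb v" using endsG[OF e] by (elim exE conjE)
  have V: "u \<in> V" "v \<in> V" "u \<noteq> v" using edge_V[OF arc_E[OF e uv(1)]] by simp_all
  then show "tail G e \<in> verts G" "head G e \<in> verts G" using uv by (auto simp: vertsG)
  show "\<not> (tail G e \<in> FX \<and> head G e \<in> FX)"
    using orb_FX[OF V(1)] orb_FX[OF V(2)] fixed_unique[OF V(1,2)] V(3) uv by auto
qed

lemma wfG: "wf_digraph G"
  unfolding wf_digraph_def using arc_ends by blast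

text \<open>For two free ends this is the definition of the gain. At a fixed vertex
  \<open>\<iota>\<close> moves the other end only, so the pair of representatives is one of the two
  edges of the orbit.\<close>

lemma core_in: "e \<in> arcs G \<Longrightarrow> core e \<in> e"
proof -
  assume e: "e \<in> arcs G"
  obtain u v where uv: "{u, v} \<in> e" "tail G e = orb u" "head G e = orb v" using endsG[OF e] by (elim exE conjE)
  have V: "u \<in> V" "v \<in> V" "u \<noteq> v" using edge_V[OF arc_E[OF e uv(1)]] by simp_all
  note iv = arc_iota[OF e uv(1)]
  show "core e \<in> e"
  proof (cases "tail G e \<in> FR \<and> head G e \<in> FR")
    case True
    then show ?thesis using gain[OF e] by (simp add: core_def split: if_splits)
  next
    case False
    then have c: "core e = {r (orb u), r (orb v)}" using False by (auto simp: core_def uv)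
    have "tail G e \<in> FX \<or> head G e \<in> FX" using False arc_ends[OF e] verts_cases by blast
    then have "\<iota> u = u \<or> \<iota> v = v" using uv orb_FX V by auto
    moreover have "u = r (orb u) \<or> \<iota> u = r (orb u)" "v = r (orb v) \<or> \<iota> v = r (orb v)"
      by (rule rep_cases'[OF V(1)], rule rep_cases'[OF V(2)])
    ultimately have "core e = {u, v} \<or> core e = {\<iota> u, \<iota> v}" unfolding c by metis
    then show ?thesis using uv(1) iv by auto
  qed
qed

lemma core_determines: "e \<in> arcs G \<Longrightarrow> e' \<in> arcs G \<Longrightarrow> core e = core e' \<Longrightarrow> e = e'"
proof -
  assume e: "e \<in> arcs G" "e' \<in> arcs G" and c: "core e = core e'"
  have "e = {core e, \<iota> ` core e}" by (rule arc_eq[OF e(1) core_in[OF e(1)]])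
  moreover have "e' = {core e', \<iota> ` core e'}" by (rule arc_eq[OF e(2) core_in[OF e(2)]])
  ultimately show "e = e'" using c by simp
qed

lemma core_erow:
  assumes e: "e \<in> arcs G" and x: "\<forall>z\<in>FX. x z = 0" and m: "\<not> A \<longrightarrow> (\<forall>z\<in>FX. m z = 0)"
  shows "\<exists>u v. core e = {u, v} \<and> ((lift (-1) x u - lift (-1) x v) \<bullet>
    (lift (if A then 1 else -1) m u - lift (if A then 1 else -1) m v) = 0 \<longleftrightarrow> erow A x m (trip A e) = 0)"
proof -
  let ?t = "tail G e" and ?h = "head G e" and ?\<epsilon> = "if A then 1 else -1 :: real"
  let ?v = "if ?t \<in> FR \<and> ?h \<in> FR \<and> \<psi> e \<noteq> \<one>\<^bsub>\<Gamma>\<^esub> then \<iota> (r ?h) else r ?h"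
  note th = arc_ends[OF e]
  have loop: "erow False x m (u, u, -1) = 4 * (x u \<bullet> m u)" for u
    by (simp add: chi_def inner_2 algebra_simps)
  have lt: "lift \<epsilon> y (r ?t) = y ?t" for \<epsilon> y by (rule lift_rep[OF th(1)])
  have lh: "lift \<epsilon> y (r ?h) = y ?h" for \<epsilon> y by (rule lift_rep[OF th(2)])
  have lhi: "lift \<epsilon> y (\<iota> (r ?h)) = \<epsilon> *\<^sub>R y ?h" if "?h \<in> FR" for \<epsilon> y by (rule lift_iota_rep[OF that])
  have "(lift (-1) x (r ?t) - lift (-1) x ?v) \<bullet> (lift ?\<epsilon> m (r ?t) - lift ?\<epsilon> m ?v) = 0 \<longleftrightarrow>
      erow A x m (trip A e) = 0"
  proof -
    consider "?t \<in> FR" "?h \<in> FR" | "?t \<in> FX" "?h \<in> FR" | "?t \<in> FR" "?h \<in> FX"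
      using th verts_cases by blast
    then show ?thesis
    proof cases
      case 1
      then show ?thesis by (simp add: trip_def lt lh lhi[OF 1(2)] sn_def chi_def)
    next
      case 2
      then have t: "?t \<notin> FR" "x ?t = 0" using FX_FR x by auto
      show ?thesis
      proof (cases A)
        case True
        then show ?thesis using t sn_pm[of e] by (auto simp: trip_def lt lh chi_def inner_diff_right)
      next
        case False
        then have "m ?t = 0" using m 2 by simp
        then show ?thesis using t 2 False by (simp add: trip_def lt lh loop del: erow.simps)
      qed
    next
      case 3
      then have t: "?h \<notin> FR" "?t \<notin> FX" "x ?h = 0" using FX_FR x by auto
      show ?thesis
      proof (cases A)
        case True
        then show ?thesis using t by (simp add: trip_def lt lh chi_def)
      next
        case False
        then have "m ?h = 0" using m 3 by simp
        then show ?thesis using t False by (simp add: trip_def lt lh loop del: erow.simps)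
      qed
    qed
  qed
  then show ?thesis by (intro exI[of _ "r ?t"] exI[of _ ?v]) (simp add: core_def)
qed

text \<open>The condition is known for the core edge. Applying \<open>\<iota>\<close> multiplies its
  left-hand side by -1 or 1, so the condition is the same on both edges of the orbit.\<close>

lemma arc_erow:
  assumes e: "e \<in> arcs G" and x: "\<forall>z\<in>FX. x z = 0" and m: "\<not> A \<longrightarrow> (\<forall>z\<in>FX. m z = 0)" and uv: "{u, v} \<in> e"
  shows "(lift (-1) x u - lift (-1) x v) \<bullet>
    (lift (if A then 1 else -1) m u - lift (if A then 1 else -1) m v) = 0 \<longleftrightarrow> erow A x m (trip A e) = 0"
proof -
  let ?\<epsilon> = "if A then 1 else -1 :: real"
  define val where "val = (\<lambda>u v. (lift (-1) x u - lift (-1) x v) \<bullet> (lift ?\<epsilon> m u - lift ?\<epsilon> m v))"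
  obtain a b where ab: "core e = {a, b}" "val a b = 0 \<longleftrightarrow> erow A x m (trip A e) = 0"
    using core_erow[OF e x m] unfolding val_def by (elim exE conjE)
  have V: "u \<in> V" "v \<in> V" using edge_V[OF arc_E[OF e uv]] by simp_all
  have sym: "val u v = val v u" for u v by (simp add: val_def inner_2 algebra_simps)
  have li: "lift (-1) x (\<iota> u) = (-1) *\<^sub>R lift (-1) x u" "lift ?\<epsilon> m (\<iota> u) = ?\<epsilon> *\<^sub>R lift ?\<epsilon> m u" if "u \<in> V" for u
    using lift_iota[OF that, of "-1" x] lift_iota[OF that, of ?\<epsilon> m] x m by auto
  have "val (\<iota> u) (\<iota> v) = (if A then -1 else 1) * val u v"
    unfolding val_def li[OF V(1)] li[OF V(2)] by (cases A) (simp_all add: inner_2 algebra_simps)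
  then have vi: "val (\<iota> u) (\<iota> v) = 0 \<longleftrightarrow> val u v = 0" by (cases A) simp_all
  have "e = {{u, v}, \<iota> ` {u, v}}" by (rule arc_eq[OF e uv])
  then have "{a, b} = {u, v} \<or> {a, b} = {\<iota> u, \<iota> v}" using core_in[OF e] ab(1) by auto
  then have "val a b = 0 \<longleftrightarrow> val u v = 0"
    using sym[of u v] sym[of "\<iota> u" "\<iota> v"] vi by (auto simp: doubleton_eq_iff)
  then show ?thesis using ab(2) by (simp add: val_def)
qed

lemma lifted_motion_iff:
  assumes x: "\<forall>z\<in>FX. x z = 0" and m: "\<not> A \<longrightarrow> (\<forall>z\<in>FX. m z = 0)"
  shows "infinitesimal_motion E (lift (-1) x) (lift (if A then 1 else -1) m) \<longleftrightarrow>
    (\<forall>f\<in>trip A ` arcs G. erow A x m f = 0)"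
proof
  assume mot: "infinitesimal_motion E (lift (-1) x) (lift (if A then 1 else -1) m)"
  show "\<forall>f\<in>trip A ` arcs G. erow A x m f = 0"
  proof
    fix f assume "f \<in> trip A ` arcs G"
    then obtain e where e: "e \<in> arcs G" "f = trip A e" by blast
    obtain u v where uv: "{u, v} \<in> e" using endsG[OF e(1)] by blast
    have "{u, v} \<in> E" by (rule arc_E[OF e(1) uv])
    then show "erow A x m f = 0"
      using mot arc_erow[OF e(1) x m uv] e(2) by (simp add: infinitesimal_motion_def)
  qed
next
  assume h: "\<forall>f\<in>trip A ` arcs G. erow A x m f = 0"
  show "infinitesimal_motion E (lift (-1) x) (lift (if A then 1 else -1) m)"
    unfolding infinitesimal_motion_def
  proof (intro allI impI)
    fix u v assume uv: "{u, v} \<in> E"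
    let ?e = "{{u, v}, \<iota> ` {u, v}}"
    have e: "?e \<in> arcs G" using uv by (auto simp: arcsG)
    show "(lift (-1) x u - lift (-1) x v) \<bullet>
      (lift (if A then 1 else -1) m u - lift (if A then 1 else -1) m v) = 0"
      using arc_erow[OF e x m, of u v] h e by simp
  qed
qed

section \<open>Rigidity as triviality of two kernels\<close>

lemma infinitesimal_motion_cong:
  assumes "\<And>v. v \<in> V \<Longrightarrow> q v = q' v" "\<And>v. v \<in> V \<Longrightarrow> M v = M' v"
  shows "infinitesimal_motion E q M \<longleftrightarrow> infinitesimal_motion E q' M'"
proof -
  have "(q u - q v) \<bullet> (M u - M v) = (q' u - q' v) \<bullet> (M' u - M' v)" if "{u, v} \<in> E" for u v
    using edge_V[OF that] by (simp add: assms)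
  then show ?thesis unfolding infinitesimal_motion_def by simp
qed

text \<open>The vertices with unknown velocities; the fixed vertex cannot move
  symmetrically.\<close>

definition XA :: "bool \<Rightarrow> 'v set set" where
  "XA A = (if A then verts G else FR)"

definition ZA :: "bool \<Rightarrow> 'v set set" where
  "ZA A = (if A then FX else {})"

text \<open>Rigidity for motions of one symmetry type: only rotations about the origin or only
  translations are left.\<close>

definition kernel_trivial :: "bool \<Rightarrow> ('v set \<Rightarrow> real^2) \<Rightarrow> bool" where
  "kernel_trivial A x \<longleftrightarrow> (\<forall>m. (\<not> A \<longrightarrow> (\<forall>z\<in>FX. m z = 0)) \<longrightarrow> (\<forall>f\<in>trip A ` arcs G. erow A x m f = 0) \<longrightarrow>
     (\<exists>t c. glob A t c \<and> (\<forall>y\<in>XA A. m y = tmot A (\<lambda>_. 1) x t c y)))"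

lemma signed_setting_ZA: "signed_setting A (ZA A)"
proof unfold_locales
  fix x y assume "x \<in> ZA A" "y \<in> ZA A"
  then show "x = y" using FX_unique[of x y] by (simp add: ZA_def split: if_splits)
qed (simp add: ZA_def)

lemma finite_XA: "finite (XA A)"
  using finite_verts verts_cases by (auto simp: XA_def intro: finite_subset[of _ "verts G"])

lemma FR_XA: "FR \<subseteq> XA A"
  using verts_cases by (auto simp: XA_def)

lemma lift_restrict:
  assumes "\<And>v. v \<in> V \<Longrightarrow> q (\<iota> v) = \<epsilon> *\<^sub>R q v" "v \<in> V"
  shows "lift \<epsilon> (\<lambda>y. q (r y)) v = q v"
proof (cases "v = r (orb v)")
  case True
  then show ?thesis by (simp add: lift_def)
next
  case False
  then have "v = \<iota> (r (orb v))" using rep_cases[OF assms(2)] by simp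
  moreover have "r (orb v) \<in> V" using rep_orb[of "orb v"] assms(2) by (simp add: vertsG)
  ultimately have "q v = \<epsilon> *\<^sub>R q (r (orb v))" using assms(1)[of "r (orb v)"] by simp
  then show ?thesis using False by (simp add: lift_def)
qed

lemma framework_FR:
  assumes "framework V E q"
  shows "FR \<noteq> {}"
proof
  assume "FR = {}"
  then have "\<forall>v\<in>V. \<iota> v = v" unfolding FR_def by blast
  then have "\<forall>u\<in>V. \<forall>v\<in>V. u = v" using fixed_unique by simp
  then have "\<exists>a. V \<subseteq> {a}" by blast
  then obtain a where "V \<subseteq> {a}" by (elim exE)
  then have "q ` V \<subseteq> {q a}" by auto
  then have "affine hull (q ` V) \<subseteq> affine hull {q a}" by (rule hull_mono)
  then have "(UNIV :: (real^2) set) \<subseteq> {q a}" using assms by (simp add: framework_def)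
  then have "q a + axis 1 1 = q a" using subsetD[of UNIV "{q a}" "q a + axis 1 1"] by simp
  then show False by (simp add: axis_eq_0_iff)
qed

lemma framework_rep:
  assumes fr: "framework V E q" and anti: "\<forall>v\<in>V. q (\<iota> v) = - q v"
  shows "z \<in> FX \<Longrightarrow> q (r z) = 0" "y \<in> FR \<Longrightarrow> q (r y) \<noteq> 0"
    "y \<in> verts G \<Longrightarrow> y' \<in> verts G \<Longrightarrow> y \<noteq> y' \<Longrightarrow> q (r y) \<noteq> q (r y') \<and> q (r y) \<noteq> - q (r y')"
proof -
  have inj: "inj_on q V" using fr by (simp add: framework_def)
  show "q (r z) = 0" if z: "z \<in> FX"
  proof -
    have "r z \<in> V" using rep_orb z verts_cases by blast
    then have "q (r z) = - q (r z)" using bspec[OF anti, of "r z"] rep_FX[OF z] by simp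
    then show ?thesis by (simp add: vec_eq_2)
  qed
  show "q (r y) \<noteq> 0" if y: "y \<in> FR"
  proof
    assume "q (r y) = 0"
    moreover have V: "r y \<in> V" using rep_orb y verts_cases by blast
    ultimately have "q (\<iota> (r y)) = q (r y)" using bspec[OF anti, of "r y"] by simp
    then have "\<iota> (r y) = r y" by (rule inj_onD[OF inj _ iota_V[OF V] V])
    then show False using rep_FR[OF y] by simp
  qed
  show "q (r y) \<noteq> q (r y') \<and> q (r y) \<noteq> - q (r y')" if y: "y \<in> verts G" "y' \<in> verts G" "y \<noteq> y'"
  proof -
    have V: "r y \<in> V" "r y' \<in> V" "orb (r y) = y" "orb (r y') = y'" using rep_orb y by blast+
    have 1: "q (r y) \<noteq> q (r y')"
    proof
      assume "q (r y) = q (r y')"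
      then have "r y = r y'" by (rule inj_onD[OF inj _ V(1,2)])
      then show False using V y by simp
    qed
    have 2: "q (r y) \<noteq> - q (r y')"
    proof
      assume "q (r y) = - q (r y')"
      then have "q (r y) = q (\<iota> (r y'))" using bspec[OF anti V(2)] by simp
      then have "r y = \<iota> (r y')" by (rule inj_onD[OF inj _ V(1) iota_V[OF V(2)]])
      then show False using V y orb_iota[OF V(2)] by simp
    qed
    from 1 2 show ?thesis by blast
  qed
qed

lemma rigid_iff_kernels:
  assumes fr: "framework V E q" and anti: "\<forall>v\<in>V. q (\<iota> v) = - q v"
    and x: "x = (\<lambda>y. q (r y))"
  shows "infinitesimally_rigid V E q \<longleftrightarrow> (\<forall>A. kernel_trivial A x)"
proof -
  note fx = framework_rep[OF fr anti]
  have xFX: "\<forall>z\<in>FX. x z = 0" using fx(1) x by simp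
  have qx: "lift (-1) x v = q v" if "v \<in> V" for v
    unfolding x by (rule lift_restrict) (use anti that in simp_all)
  obtain y0 where y0: "y0 \<in> FR" using framework_FR[OF fr] by blast
  have y0': "y0 \<in> verts G" using y0 verts_cases by blast
  note r0 = rep_orb[OF y0', THEN conjunct2]
  have qr0: "q (r y0) \<noteq> 0" using fx(2)[OF y0] .
  have ind: "infinitesimal_motion E q M \<longleftrightarrow> (\<forall>f\<in>trip A ` arcs G. erow A x m f = 0)"
    if "\<And>v. v \<in> V \<Longrightarrow> M v = lift (if A then 1 else -1) m v" "\<not> A \<longrightarrow> (\<forall>z\<in>FX. m z = 0)" for M m A
  proof -
    have "infinitesimal_motion E q M \<longleftrightarrow> infinitesimal_motion E (lift (-1) x) (lift (if A then 1 else -1) m)"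
      by (rule infinitesimal_motion_cong) (simp_all add: qx that(1))
    then show ?thesis using lifted_motion_iff[OF xFX that(2)] by simp
  qed
  show ?thesis
  proof
    assume rig: "infinitesimally_rigid V E q"
    show "\<forall>A. kernel_trivial A x"
      unfolding kernel_trivial_def
    proof (intro allI impI)
      fix A and m :: "'v set \<Rightarrow> real^2"
      assume m: "\<not> A \<longrightarrow> (\<forall>z\<in>FX. m z = 0)" and k: "\<forall>f\<in>trip A ` arcs G. erow A x m f = 0"
      let ?M = "lift (if A then 1 else -1) m"
      have "infinitesimal_motion E q ?M" using ind[of ?M A m] m k by simp
      then have "trivial_motion V q ?M" using rig by (simp add: infinitesimally_rigid_def)
      then obtain c t where ct: "\<forall>u\<in>V. ?M u = c *\<^sub>R rotJ (q u) + t" unfolding trivial_motion_iff by (elim exE)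
      have my: "m y = c *\<^sub>R rotJ (x y) + t" if "y \<in> verts G" for y
        using bspec[OF ct, of "r y"] rep_orb[OF that] lift_rep[OF that, of "if A then 1 else -1" m] by (simp add: x)
      have "?M (\<iota> (r y0)) = - (c *\<^sub>R rotJ (q (r y0))) + t"
        using bspec[OF ct iota_V[OF r0]] bspec[OF anti r0] by (simp add: rotJ_linear)
      \<comment> \<open>A free orbit has two vertices. Comparing the trivial motion on both kills
        its rotation in the anti-symmetric case and its translation in the symmetric case.\<close>
      then have e0: "(if A then 1 else -1) *\<^sub>R m y0 = - (c *\<^sub>R rotJ (x y0)) + t"
        using lift_iota_rep[OF y0, of "if A then 1 else -1" m] by (simp add: x)
      show "\<exists>t c. glob A t c \<and> (\<forall>y\<in>XA A. m y = tmot A (\<lambda>_. 1) x t c y)"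
      proof (cases A)
        case True
        then have "c *\<^sub>R rotJ (x y0) + t = - (c *\<^sub>R rotJ (x y0)) + t" using e0 my[OF y0'] by simp
        then have "c *\<^sub>R rotJ (x y0) = 0" by (simp add: vec_eq_2)
        then have "c = 0" using qr0 by (simp add: x)
        then show ?thesis using True my
          by (intro exI[of _ t] exI[of _ 0]) (simp add: glob_def tmot_def chi_def XA_def)
      next
        case False
        then have "- (c *\<^sub>R rotJ (x y0) + t) = - (c *\<^sub>R rotJ (x y0)) + t" using e0 my[OF y0'] by simp
        then have "t = 0" by (simp add: vec_eq_2)
        then show ?thesis using False my verts_cases
          by (intro exI[of _ 0] exI[of _ c]) (simp add: glob_def tmot_def chi_def XA_def)
      qed
    qed
  next
    assume ker: "\<forall>A. kernel_trivial A x"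
    show "infinitesimally_rigid V E q"
      unfolding infinitesimally_rigid_def
    proof (intro allI impI)
      fix M assume mot: "infinitesimal_motion E q M"
      \<comment> \<open>The half-turn acts on velocities as -1, hence the difference gives the
        symmetric part and the sum the anti-symmetric one.\<close>
      define Ms where "Ms = (\<lambda>v. (1/2) *\<^sub>R (M v - M (\<iota> v)))"
      define Ma where "Ma = (\<lambda>v. (1/2) *\<^sub>R (M v + M (\<iota> v)))"
      have e: "(q u - q v) \<bullet> (M u - M v) = 0" "(q u - q v) \<bullet> (M (\<iota> u) - M (\<iota> v)) = 0"
        if uv: "{u, v} \<in> E" for u v
      proof -
        show "(q u - q v) \<bullet> (M u - M v) = 0" using mot uv by (simp add: infinitesimal_motion_def)
        have V: "u \<in> V" "v \<in> V" using edge_V[OF uv] by simp_all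
        have "(q (\<iota> u) - q (\<iota> v)) \<bullet> (M (\<iota> u) - M (\<iota> v)) = 0"
          using mot iota_E[OF uv] by (simp add: infinitesimal_motion_def)
        moreover have "q (\<iota> u) - q (\<iota> v) = - (q u - q v)" using anti V by simp
        ultimately show "(q u - q v) \<bullet> (M (\<iota> u) - M (\<iota> v)) = 0" by (simp only: inner_minus_left neg_equal_0_iff_equal)
      qed
      have mots: "infinitesimal_motion E q Ms" "infinitesimal_motion E q Ma"
        unfolding infinitesimal_motion_def
      proof (intro allI impI)
        fix u v assume uv: "{u, v} \<in> E"
        have "Ms u - Ms v = (1/2) *\<^sub>R ((M u - M v) - (M (\<iota> u) - M (\<iota> v)))"
          by (simp add: Ms_def algebra_simps)
        then show "(q u - q v) \<bullet> (Ms u - Ms v) = 0"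
          using e[OF uv] by (simp only: inner_scaleR_right inner_diff_right[of _ "M u - M v"]) simp
      next
        show "\<forall>u v. {u, v} \<in> E \<longrightarrow> (q u - q v) \<bullet> (Ma u - Ma v) = 0"
        proof (intro allI impI)
          fix u v assume uv: "{u, v} \<in> E"
          have "Ma u - Ma v = (1/2) *\<^sub>R ((M u - M v) + (M (\<iota> u) - M (\<iota> v)))"
            by (simp add: Ma_def algebra_simps)
          then show "(q u - q v) \<bullet> (Ma u - Ma v) = 0"
            using e[OF uv] by (simp only: inner_scaleR_right inner_add_right) simp
        qed
      qed
      define ms where "ms = (\<lambda>y. Ms (r y))"
      define ma where "ma = (\<lambda>y. Ma (r y))"
      have Msl: "lift (-1) ms v = Ms v" if "v \<in> V" for v
        unfolding ms_def by (rule lift_restrict) (use iota_iota that in \<open>simp_all add: Ms_def algebra_simps\<close>)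
      have Mal: "lift 1 ma v = Ma v" if "v \<in> V" for v
        unfolding ma_def by (rule lift_restrict) (use iota_iota that in \<open>simp_all add: Ma_def algebra_simps\<close>)
      have msFX: "\<forall>z\<in>FX. ms z = 0" using rep_FX by (simp add: ms_def Ms_def)
      have "\<forall>f\<in>trip False ` arcs G. erow False x ms f = 0"
        using ind[of Ms False ms] mots(1) Msl msFX by simp
      then have "\<exists>t c. glob False t c \<and> (\<forall>y\<in>XA False. ms y = tmot False (\<lambda>_. 1) x t c y)"
        using spec[OF ker, of False] msFX unfolding kernel_trivial_def by simp
      then obtain t c where c: "glob False t c" "\<forall>y\<in>XA False. ms y = tmot False (\<lambda>_. 1) x t c y" by (elim exE conjE)
      have msc: "ms y = c *\<^sub>R rotJ (x y)" if "y \<in> verts G" for y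
      proof (cases "y \<in> FX")
        case True
        then show ?thesis using msFX xFX by (simp add: rotJ_linear)
      next
        case False
        then have "y \<in> FR" using that verts_cases by blast
        then show ?thesis using c by (simp add: XA_def glob_def tmot_def chi_def)
      qed
      have "\<forall>f\<in>trip True ` arcs G. erow True x ma f = 0"
        using ind[of Ma True ma] mots(2) Mal by simp
      then have "\<exists>t c. glob True t c \<and> (\<forall>y\<in>XA True. ma y = tmot True (\<lambda>_. 1) x t c y)"
        using spec[OF ker, of True] unfolding kernel_trivial_def by simp
      then obtain t' c' where t': "glob True t' c'" "\<forall>y\<in>XA True. ma y = tmot True (\<lambda>_. 1) x t' c' y" by (elim exE conjE)
      have mat: "ma y = t'" if "y \<in> verts G" for y
        using t' that by (simp add: XA_def glob_def tmot_def chi_def)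
      have "M v = c *\<^sub>R rotJ (q v) + t'" if v: "v \<in> V" for v
      proof -
        have ov: "orb v \<in> verts G" using v by (simp add: vertsG)
        have "lift (-1) ms v = c *\<^sub>R rotJ (lift (-1) x v)"
          using msc[OF ov] by (simp add: lift_def rotJ_linear)
        then have "Ms v = c *\<^sub>R rotJ (q v)" using Msl[OF v] qx[OF v] by simp
        moreover have "Ma v = t'" using Mal[OF v] mat[OF ov] by (simp add: lift_def split: if_splits)
        moreover have "M v = Ms v + Ma v" by (simp add: Ms_def Ma_def vec_eq_2 algebra_simps)
        ultimately show ?thesis by simp
      qed
      then show "trivial_motion V q M" unfolding trivial_motion_iff by (intro exI[of _ c] exI[of _ t']) simp
    qed
  qed
qed

section \<open>Arcs of the quotient as signed edges\<close>

lemma ends_trip: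
  assumes e: "e \<in> arcs G"
  shows "ends (trip A e) = {tail G e, head G e} - (if A then {} else FX)"
proof (cases A)
  case True
  then show ?thesis by (simp add: trip_def)
next
  case False
  consider "tail G e \<in> FR" "head G e \<in> FR" | "tail G e \<in> FX" "head G e \<in> FR"
    | "tail G e \<in> FR" "head G e \<in> FX"
    using arc_ends(3)[OF e] iffD1[OF verts_cases arc_ends(1)[OF e]] iffD1[OF verts_cases arc_ends(2)[OF e]]
    by satx
  then show ?thesis
  proof cases
    case 1
    then show ?thesis using FX_FR[of "tail G e"] FX_FR[of "head G e"] False by (auto simp: trip_def)
  next
    case 2
    then show ?thesis using FX_FR[of "tail G e"] FX_FR[of "head G e"] False by (auto simp: trip_def)
  next
    case 3
    then show ?thesis using FX_FR[of "tail G e"] FX_FR[of "head G e"] False by (auto simp: trip_def)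
  qed
qed

lemma VF_trip:
  assumes "F \<subseteq> arcs G"
  shows "VF (trip A ` F) = (\<Union>e\<in>F. {tail G e, head G e}) - (if A then {} else FX)"
proof -
  have "VF (trip A ` F) = (\<Union>e\<in>F. ends (trip A e))" by (simp add: VF_def)
  also have "\<dots> = (\<Union>e\<in>F. {tail G e, head G e} - (if A then {} else FX))"
    by (rule SUP_cong[OF refl], rule ends_trip, rule subsetD[OF assms])
  also have "\<dots> = (\<Union>e\<in>F. {tail G e, head G e}) - (if A then {} else FX)" by (rule UN_simps)
  finally show ?thesis .
qed

lemma VF_trip_XA:
  assumes "F \<subseteq> arcs G"
  shows "VF (trip A ` F) \<subseteq> XA A"
proof -
  have "(\<Union>e\<in>F. {tail G e, head G e}) \<subseteq> verts G" using arc_ends(1,2) assms by blast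
  moreover have "verts G - (if A then {} else FX) \<subseteq> XA A"
  proof
    fix y assume "y \<in> verts G - (if A then {} else FX)"
    then show "y \<in> XA A" using verts_cases[of y] by (auto simp: XA_def split: if_splits)
  qed
  ultimately show ?thesis unfolding VF_trip[OF assms] by (meson Diff_mono order.trans subset_refl)
qed

lemma signed_trip: "signed (trip A ` F)"
  using sn_pm by (auto simp: signed_def trip_def)

text \<open>A loop with trivial gain would have a core with a single vertex, which is not an edge of
  a simple graph. Loops that stem from edges at the fixed vertex have sign -1 by
  construction.\<close>

lemma trip_loop:
  assumes e: "e \<in> arcs G" and l: "trip A e = (u, u, s)"
  shows "u \<notin> ZA A \<and> s = -1"
proof (cases "tail G e \<in> FR \<and> head G e \<in> FR")
  case True
  then have th: "tail G e = u" "head G e = u" "s = sn e" using l by (auto simp: trip_def)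
  have "\<psi> e \<noteq> \<one>\<^bsub>\<Gamma>\<^esub>"
  proof
    assume "\<psi> e = \<one>\<^bsub>\<Gamma>\<^esub>"
    then have "core e = {r u, r u}" by (simp add: core_def th)
    then show False using arc_E[OF e core_in[OF e]] edge_V[of "r u" "r u"] by simp
  qed
  then show ?thesis using th True FX_FR[of u] by (auto simp: sn_def ZA_def)
next
  case False
  have "\<not> A"
  proof
    assume A
    then have "tail G e = u" "head G e = u" using l by (auto simp: trip_def)
    then show False using False arc_ends[OF e] verts_cases[of u] by auto
  qed
  then have "s = -1" using l False by (simp add: trip_def split: if_splits)
  then show ?thesis using \<open>\<not> A\<close> by (simp add: ZA_def)
qed

lemma trip_True_inj: "e \<in> arcs G \<Longrightarrow> e' \<in> arcs G \<Longrightarrow> trip True e = trip True e' \<Longrightarrow> e = e'"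
proof -
  assume e: "e \<in> arcs G" "e' \<in> arcs G" and t: "trip True e = trip True e'"
  then have "tail G e = tail G e'" "head G e = head G e'" "\<psi> e = \<one>\<^bsub>\<Gamma>\<^esub> \<longleftrightarrow> \<psi> e' = \<one>\<^bsub>\<Gamma>\<^esub>"
    by (simp_all add: trip_def sn_def split: if_splits)
  then have "core e = core e'" by (simp add: core_def)
  then show ?thesis by (rule core_determines[OF e])
qed

text \<open>Distinct arcs can only be merged into the same negative loop: a loop at \<open>u\<close>
  and an edge from \<open>u\<close> to the fixed vertex, for instance. Sparsity forbids such pairs,
  so injectivity of \<open>trip\<close> can be recovered from it.\<close>

lemma trip_False_collision:
  assumes e: "e \<in> arcs G" "e' \<in> arcs G" and t: "trip False e = trip False e'" and ne: "e \<noteq> e'"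
  shows "\<exists>u. {tail G e, head G e, tail G e', head G e'} \<subseteq> insert u FX"
proof (cases "tail G e \<in> FR \<and> head G e \<in> FR \<and> tail G e' \<in> FR \<and> head G e' \<in> FR")
  case True
  then have "trip True e = trip True e'" using t by (simp add: trip_def)
  then show ?thesis using trip_True_inj[OF e] ne by simp
next
  case False
  have "\<exists>u s. trip False e = (u, u, s)"
  proof (cases "tail G e \<in> FR \<and> head G e \<in> FR")
    case True
    then have "\<not> (tail G e' \<in> FR \<and> head G e' \<in> FR)" using False by satx
    then show ?thesis unfolding t by (auto simp: trip_def)
  next
    case False
    then show ?thesis by (auto simp: trip_def)
  qed
  then obtain u s where us: "trip False e = (u, u, s)" by (elim exE)
  have "ends (trip False e) = {u}" "ends (trip False e') = {u}" using us t by simp_all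
  then show ?thesis using ends_trip[OF e(1), of False] ends_trip[OF e(2), of False]
    by (intro exI[of _ u]) (simp only: if_False, blast)
qed

end

section \<open>Gain sparsity and signed sparsity\<close>

lemma gain_walk_arcs: "gain_walk D u w v \<Longrightarrow> x \<in> set w \<Longrightarrow> fst x \<in> arcs D"
  by (induction w arbitrary: u) auto

lemma gain_sparse_balanced:
  "gain_sparse \<Gamma> V0 V1 m l G \<psi> \<Longrightarrow> subgraph H G \<Longrightarrow> balanced \<Gamma> V0 \<psi> H \<Longrightarrow> arcs H \<noteq> {} \<Longrightarrow>
    int (card (arcs H)) \<le> 2 * int (card (verts H)) - 3"
  unfolding gain_sparse_def by blast

lemma gain_sparse_all:
  "gain_sparse \<Gamma> V0 V1 m l G \<psi> \<Longrightarrow> subgraph H G \<Longrightarrow> arcs H \<noteq> {} \<Longrightarrow>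
    int (card (arcs H)) \<le> 2 * int (card (verts H \<inter> V1)) + m * int (card (verts H \<inter> V0)) - l"
  unfolding gain_sparse_def by blast

context c2_quotient
begin

lemma gamma_square: "\<gamma> \<otimes>\<^bsub>\<Gamma>\<^esub> \<gamma> = \<one>\<^bsub>\<Gamma>\<^esub>" "inv\<^bsub>\<Gamma>\<^esub> \<gamma> = \<gamma>"
proof -
  interpret group \<Gamma> by (rule group)
  have g: "\<gamma> \<in> carrier \<Gamma>" by (simp add: carrier)
  have "\<gamma> \<otimes>\<^bsub>\<Gamma>\<^esub> \<gamma> \<in> carrier \<Gamma>" using g by simp
  moreover have "\<gamma> \<otimes>\<^bsub>\<Gamma>\<^esub> \<gamma> \<noteq> \<gamma>" using g gamma by simp
  ultimately show s: "\<gamma> \<otimes>\<^bsub>\<Gamma>\<^esub> \<gamma> = \<one>\<^bsub>\<Gamma>\<^esub>" by (simp add: carrier)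
  show "inv\<^bsub>\<Gamma>\<^esub> \<gamma> = \<gamma>" by (rule inv_equality[OF s g g])
qed

lemma walk_gain_sign:
  assumes "\<forall>x\<in>set w. fst x \<in> arcs G"
  shows "(walk_sign sn w = 1 \<and> walk_gain \<Gamma> \<psi> w = \<one>\<^bsub>\<Gamma>\<^esub>) \<or>
    (walk_sign sn w = -1 \<and> walk_gain \<Gamma> \<psi> w = \<gamma>)"
  using assms
proof (induction w)
  case (Cons x w)
  interpret group \<Gamma> by (rule group)
  obtain e d where x: "x = (e, d)" by (cases x)
  have "\<psi> e \<in> {\<one>\<^bsub>\<Gamma>\<^esub>, \<gamma>}" using gain_carrier[of e] Cons.prems carrier by (simp add: x)
  then have e: "(sn e = 1 \<and> \<psi> e = \<one>\<^bsub>\<Gamma>\<^esub>) \<or> (sn e = -1 \<and> \<psi> e = \<gamma>)" using gamma by (auto simp: sn_def)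
  then have st: "(if d then \<psi> e else inv\<^bsub>\<Gamma>\<^esub> (\<psi> e)) = \<psi> e" using gamma_square by auto
  have g: "\<gamma> \<in> carrier \<Gamma>" by (simp add: carrier)
  have "(walk_sign sn w = 1 \<and> walk_gain \<Gamma> \<psi> w = \<one>\<^bsub>\<Gamma>\<^esub>) \<or>
    (walk_sign sn w = -1 \<and> walk_gain \<Gamma> \<psi> w = \<gamma>)" using Cons by simp
  moreover have "walk_gain \<Gamma> \<psi> (x # w) = \<psi> e \<otimes>\<^bsub>\<Gamma>\<^esub> walk_gain \<Gamma> \<psi> w" by (simp only: x walk_gain.simps st)
  moreover have "walk_sign sn (x # w) = sn e * walk_sign sn w" by (simp add: x)
  ultimately show ?case using e g gamma_square(1) by (elim disjE conjE) simp_all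
qed simp

definition switching :: "('v set \<Rightarrow> real) \<Rightarrow> 'v set set set \<Rightarrow> bool" where
  "switching \<sigma> F \<longleftrightarrow> (\<forall>x. \<sigma> x = 1 \<or> \<sigma> x = -1) \<and>
    (\<forall>e\<in>F. tail G e \<notin> FX \<longrightarrow> head G e \<notin> FX \<longrightarrow> sn e = \<sigma> (tail G e) * \<sigma> (head G e))"

text \<open>The link between cycles and switching functions. Deleting the fixed vertices corresponds
  to leaving their arcs unconstrained in \<open>switching\<close>.\<close>

lemma balanced_iff_switching:
  assumes H: "subgraph H G"
  shows "balanced \<Gamma> FX \<psi> H \<longleftrightarrow> (\<exists>\<sigma>. switching \<sigma> (arcs H))"
proof -
  let ?D = "H \<restriction> (verts H - FX)"
  have th: "tail H = tail G" "head H = head G" "arcs H \<subseteq> arcs G" "wf_digraph H"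
    using H by (auto simp: subgraph_def compatible_def)
  have D: "tail ?D = tail G" "head ?D = head G" by (simp_all add: induce_subgraph_def th)
  have aD: "e \<in> arcs ?D \<longleftrightarrow> e \<in> arcs H \<and> tail G e \<notin> FX \<and> head G e \<notin> FX" for e
    using wf_digraph.tail_in_verts[OF th(4), of e] wf_digraph.head_in_verts[OF th(4), of e]
    by (auto simp: induce_subgraph_def th)
  have wfD: "wf_digraph ?D" unfolding wf_digraph_def by (simp add: induce_subgraph_def)
  show ?thesis
  proof
    assume b: "balanced \<Gamma> FX \<psi> H"
    have "walk_sign sn w = 1" if c: "gain_cycle ?D w" for w
    proof -
      obtain u where u: "gain_walk ?D u w u" using c by (auto simp: gain_cycle_def)
      have "\<forall>x\<in>set w. fst x \<in> arcs G" using gain_walk_arcs[OF u] aD th(3) by (meson subsetD)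
      moreover have "walk_gain \<Gamma> \<psi> w = \<one>\<^bsub>\<Gamma>\<^esub>" using b c unfolding balanced_def by simp
      ultimately show ?thesis using walk_gain_sign[of w] gamma by auto
    qed
    then have "\<exists>\<sigma> :: 'v set \<Rightarrow> real. (\<forall>x. \<sigma> x = 1 \<or> \<sigma> x = -1) \<and>
      (\<forall>e\<in>arcs ?D. sn e = \<sigma> (tail ?D e) * \<sigma> (head ?D e))"
      by (rule ex_potential_digraph[OF wfD sn_pm])
    then obtain \<sigma> where "\<forall>x. \<sigma> x = 1 \<or> \<sigma> x = (-1 :: real)"
      "\<forall>e\<in>arcs ?D. sn e = \<sigma> (tail ?D e) * \<sigma> (head ?D e)" by (elim exE conjE)
    then have "switching \<sigma> (arcs H)" unfolding switching_def D using aD by simp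
    then show "\<exists>\<sigma>. switching \<sigma> (arcs H)" by (rule exI[where x=\<sigma>])
  next
    assume "\<exists>\<sigma>. switching \<sigma> (arcs H)"
    then obtain \<sigma> where s: "\<forall>x. \<sigma> x = 1 \<or> \<sigma> x = -1"
      "\<forall>e\<in>arcs H. tail G e \<notin> FX \<longrightarrow> head G e \<notin> FX \<longrightarrow> sn e = \<sigma> (tail G e) * \<sigma> (head G e)"
      unfolding switching_def by (elim exE conjE)
    show "balanced \<Gamma> FX \<psi> H"
      unfolding balanced_def
    proof (intro allI impI)
      fix w assume "gain_cycle ?D w"
      then obtain u where u: "gain_walk ?D u w u" by (auto simp: gain_cycle_def)
      have "walk_sign sn w = \<sigma> u * \<sigma> u"
        by (rule potential_walk_sign[OF u]) (use s aD D in simp_all)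
      then have "walk_sign sn w = 1" using spec[OF s(1), of u] by auto
      moreover have "\<forall>x\<in>set w. fst x \<in> arcs G" using gain_walk_arcs[OF u] aD th(3) by (meson subsetD)
      ultimately show "walk_gain \<Gamma> \<psi> w = \<one>\<^bsub>\<Gamma>\<^esub>" using walk_gain_sign[of w] by auto
    qed
  qed
qed

lemma bal_trip:
  assumes F: "F \<subseteq> arcs G" and fr: "A \<or> (\<forall>e\<in>F. tail G e \<in> FR \<and> head G e \<in> FR)"
  shows "bal (ZA A) (trip A ` F) \<longleftrightarrow> (\<exists>\<sigma>. switching \<sigma> F)"
proof -
  have t: "trip A e = (tail G e, head G e, sn e)" if "e \<in> F" for e
    using fr that by (auto simp: trip_def)
  have im: "(\<forall>x\<in>trip A ` F. case x of (u, v, s) \<Rightarrow> P u v s) \<longleftrightarrow>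
    (\<forall>e\<in>F. P (tail G e) (head G e) (sn e))" for P
    by (simp add: t)
  have "potential (ZA A) \<sigma> (trip A ` F) \<longleftrightarrow> switching \<sigma> F" for \<sigma>
  proof (cases A)
    case True
    then show ?thesis unfolding potential_def switching_def im by (simp add: ZA_def)
  next
    case False
    then have "\<forall>e\<in>F. tail G e \<notin> FX \<and> head G e \<notin> FX" using fr FX_FR by blast
    then show ?thesis using False unfolding potential_def switching_def im by (simp add: ZA_def)
  qed
  then show ?thesis by (simp add: bal_def)
qed

text \<open>For symmetric motions an arc at the fixed vertex has become a negative loop, which no
  potential fits.\<close>

lemma bal_trip_False_FR:
  assumes F: "F \<subseteq> arcs G" and b: "bal (ZA False) (trip False ` F)" and e: "e \<in> F"
  shows "tail G e \<in> FR \<and> head G e \<in> FR"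
proof (rule ccontr)
  assume n: "\<not> (tail G e \<in> FR \<and> head G e \<in> FR)"
  have "\<exists>u. trip False e = (u, u, -1)" using n by (auto simp: trip_def)
  then obtain u where u: "trip False e = (u, u, -1)" by (elim exE)
  obtain \<sigma> where s: "potential {} \<sigma> (trip False ` F)" using b by (auto simp: bal_def ZA_def)
  have "-1 = \<sigma> u * \<sigma> u" by (rule potential_edge[OF s]) (use imageI[OF e, of "trip False"] u in simp_all)
  then show False using potential_pm[OF s, of u] by auto
qed

definition arc_graph :: "'v set set set \<Rightarrow> ('v set, 'v set set) pre_digraph" where
  "arc_graph F = \<lparr>verts = (\<Union>e\<in>F. {tail G e, head G e}), arcs = F, tail = tail G, head = head G\<rparr>"

lemma arc_graph_simps [simp]:
  "arcs (arc_graph F) = F" "verts (arc_graph F) = (\<Union>e\<in>F. {tail G e, head G e})"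
  by (simp_all add: arc_graph_def)

lemma subgraph_arc_graph:
  assumes H: "subgraph H G" and F: "F \<subseteq> arcs H"
  shows "subgraph (arc_graph F) H" "subgraph (arc_graph F) G"
proof -
  have th: "tail H = tail G" "head H = head G" "arcs H \<subseteq> arcs G" "wf_digraph H" "verts H \<subseteq> verts G"
    using H by (auto simp: subgraph_def compatible_def)
  have v: "(\<Union>e\<in>F. {tail G e, head G e}) \<subseteq> verts H"
    using wf_digraph.tail_in_verts[OF th(4)] wf_digraph.head_in_verts[OF th(4)] F th(1,2) by auto
  have w: "wf_digraph (arc_graph F)" unfolding wf_digraph_def by (auto simp: arc_graph_def)
  show "subgraph (arc_graph F) H" "subgraph (arc_graph F) G"
    unfolding subgraph_def using v w F th wfG by (auto simp: compatible_def arc_graph_def)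
qed

text \<open>Both counts become twice a number of vertices: the fixed vertex weighs 2 for
  \<open>A\<close> and is left out otherwise.\<close>

lemma card_split:
  assumes S: "S \<subseteq> verts G"
  shows "2 * int (card (S \<inter> FR)) + (if A then 2 else 0) * int (card (S \<inter> FX)) =
    2 * int (card (S - (if A then {} else FX)))"
proof -
  have d: "S - FX = S \<inter> FR" "S = S \<inter> FR \<union> S \<inter> FX" "S \<inter> FR \<inter> (S \<inter> FX) = {}"
    using S verts_cases FX_FR by blast+
  have f: "finite S" using S finite_verts finite_subset by blast
  have "card S = card (S \<inter> FR) + card (S \<inter> FX)"
    using card_Un_disjoint[of "S \<inter> FR" "S \<inter> FX"] d(2,3) f by (metis finite_Int)
  then show ?thesis using d(1) by simp
qed

lemma card_VF_trip:
  assumes "F \<subseteq> arcs G"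
  shows "2 * int (card (verts (arc_graph F) \<inter> FR)) + (if A then 2 else 0) * int (card (verts (arc_graph F) \<inter> FX)) =
    2 * int (card (VF (trip A ` F)))"
proof -
  have "verts (arc_graph F) \<subseteq> verts G" using assms arc_ends by auto
  then show ?thesis using card_split[of "verts (arc_graph F)" A] VF_trip[OF assms, of A] by simp
qed

lemma card_XA: "2 * int (card (verts G \<inter> FR)) + (if A then 2 else 0) * int (card (verts G \<inter> FX)) = 2 * int (card (XA A))"
proof -
  have "verts G - (if A then {} else FX) = XA A"
    using verts_cases FX_FR by (auto simp: XA_def)
  then show ?thesis using card_split[of "verts G" A] by simp
qed

lemma gain_sparse_imp_sgsparse:
  assumes H: "subgraph H G" and sp: "gain_sparse \<Gamma> FX FR (if A then 2 else 0) (int (lam A)) H \<psi>"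
  shows "inj_on (trip A) (arcs H) \<and> sgsparse A (ZA A) (trip A ` arcs H)"
proof -
  have aH: "arcs H \<subseteq> arcs G" using H by (simp add: subgraph_def)
  have cnt: "card F + lam A \<le> 2 * card (VF (trip A ` F))" if F: "F \<subseteq> arcs H" "F \<noteq> {}" for F
  proof -
    have FG: "F \<subseteq> arcs G" using F aH by simp
    have "int (card (arcs (arc_graph F))) \<le> 2 * int (card (verts (arc_graph F) \<inter> FR)) +
      (if A then 2 else 0) * int (card (verts (arc_graph F) \<inter> FX)) - int (lam A)"
      by (rule gain_sparse_all[OF sp subgraph_arc_graph(1)[OF H F(1)]]) (simp add: F(2))
    then show ?thesis unfolding card_VF_trip[OF FG, of A] by simp
  qed
  have balc: "card F + 3 \<le> 2 * card (VF (trip A ` F))"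
    if F: "F \<subseteq> arcs H" "F \<noteq> {}" and b: "bal (ZA A) (trip A ` F)" for F
  proof -
    have FG: "F \<subseteq> arcs G" using F aH by simp
    have fr: "A \<or> (\<forall>e\<in>F. tail G e \<in> FR \<and> head G e \<in> FR)"
      using bal_trip_False_FR[OF FG] b by (cases A) auto
    then have "\<exists>\<sigma>. switching \<sigma> F" using bal_trip[OF FG] b by simp
    then have "balanced \<Gamma> FX \<psi> (arc_graph F)"
      using balanced_iff_switching[OF subgraph_arc_graph(2)[OF H F(1)]] by simp
    then have "int (card (arcs (arc_graph F))) \<le> 2 * int (card (verts (arc_graph F))) - 3"
      by (rule gain_sparse_balanced[OF sp subgraph_arc_graph(1)[OF H F(1)]]) (simp add: F(2))
    moreover have "verts (arc_graph F) = VF (trip A ` F)"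
      using VF_trip[OF FG, of A] fr FX_FR by auto
    ultimately show ?thesis by simp
  qed
  have inj: "inj_on (trip A) (arcs H)"
  proof (rule inj_onI, rule ccontr)
    fix e e' assume e: "e \<in> arcs H" "e' \<in> arcs H" "trip A e = trip A e'" "e \<noteq> e'"
    have eG: "e \<in> arcs G" "e' \<in> arcs G" using e aH by auto
    have nA: "\<not> A" using trip_True_inj[OF eG] e(3,4) by (cases A) simp_all
    then have "\<exists>u. {tail G e, head G e, tail G e', head G e'} \<subseteq> insert u FX"
      using trip_False_collision[OF eG _ e(4)] e(3) by simp
    then obtain u where u: "{tail G e, head G e, tail G e', head G e'} \<subseteq> insert u FX" by (elim exE)
    \<comment> \<open>The two arcs span a single vertex after the translation, and
      \<open>2 + 1\<close> exceeds \<open>2 * 1\<close>.\<close>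
    have "VF (trip A ` {e, e'}) \<subseteq> {u}"
      using VF_trip[of "{e, e'}" A] eG nA u by auto
    then have "card (VF (trip A ` {e, e'})) \<le> 1" using card_mono[of "{u}"] by fastforce
    moreover have "card {e, e'} + lam A \<le> 2 * card (VF (trip A ` {e, e'}))"
      by (rule cnt) (use e in simp_all)
    ultimately show False using e(4) by (simp add: lam_def split: if_splits)
  qed
  have "sgsparse A (ZA A) (trip A ` arcs H)"
    unfolding sgsparse_def
  proof (intro conjI allI impI)
    show "finite (trip A ` arcs H)" using finite_subset[OF aH finite_arcs] by simp
    show "signed (trip A ` arcs H)" by (rule signed_trip)
    fix B assume "B \<subseteq> trip A ` arcs H" "B \<noteq> {}"
    then obtain F where F: "F \<subseteq> arcs H" "B = trip A ` F" "F \<noteq> {}" by (auto simp: subset_image_iff)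
    have c: "card B = card F" unfolding F(2) by (rule card_image[OF inj_on_subset[OF inj F(1)]])
    show "card B + lam A \<le> 2 * card (VF B)" using cnt[OF F(1,3)] c F(2) by simp
    show "card B + 3 \<le> 2 * card (VF B)" if "bal (ZA A) B" using balc[OF F(1,3)] that c F(2) by simp
  qed
  with inj show ?thesis by simp
qed

lemma sgsparse_imp_gain_sparse:
  assumes H: "subgraph H G" and inj: "inj_on (trip A) (arcs H)"
    and sp: "sgsparse A (ZA A) (trip A ` arcs H)"
  shows "gain_sparse \<Gamma> FX FR (if A then 2 else 0) (int (lam A)) H \<psi>"
proof -
  have aH: "arcs H \<subseteq> arcs G" and vH: "verts H \<subseteq> verts G" using H by (simp_all add: subgraph_def)
  have main: "card (arcs K) + lam A \<le> 2 * card (verts K - (if A then {} else FX)) \<and>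
      (balanced \<Gamma> FX \<psi> K \<longrightarrow> card (arcs K) + 3 \<le> 2 * card (verts K))"
    if K: "subgraph K H" "arcs K \<noteq> {}" for K
  proof -
    have KG: "subgraph K G" using K(1) H by (auto simp: subgraph_def compatible_def)
    have aK: "arcs K \<subseteq> arcs H" "arcs K \<subseteq> arcs G" "verts K \<subseteq> verts G"
      using K(1) KG by (simp_all add: subgraph_def)
    let ?B = "trip A ` arcs K"
    have fK: "finite (verts K)" using aK(3) finite_verts finite_subset by blast
    have B: "?B \<subseteq> trip A ` arcs H" "?B \<noteq> {}" using aK K(2) by auto
    have c: "card ?B = card (arcs K)" by (rule card_image[OF inj_on_subset[OF inj aK(1)]])
    have "verts (arc_graph (arcs K)) \<subseteq> verts K"
      using subgraph_arc_graph(1)[OF KG order.refl] unfolding subgraph_def by blast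
    then have VK: "VF ?B \<subseteq> verts K - (if A then {} else FX)" using VF_trip[OF aK(2), of A] by auto
    have cV: "card (VF ?B) \<le> card (verts K - (if A then {} else FX))"
      by (rule card_mono[OF finite_Diff[OF fK] VK])
    have l: "card (arcs K) + lam A \<le> 2 * card (verts K - (if A then {} else FX))"
      using sgsparse_lam[OF sp B] c cV by simp
    moreover have "card (arcs K) + 3 \<le> 2 * card (verts K)" if b: "balanced \<Gamma> FX \<psi> K"
    proof (cases "A \<or> (\<forall>e\<in>arcs K. tail G e \<in> FR \<and> head G e \<in> FR)")
      case True
      have "bal (ZA A) ?B" using bal_trip[OF aK(2) True] balanced_iff_switching[OF KG] b by simp
      then have "card (arcs K) + 3 \<le> 2 * card (VF ?B)" using sgsparse_bal[OF sp B] c by simp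
      moreover have "card (VF ?B) \<le> card (verts K)" using VK by (intro card_mono[OF fK]) auto
      ultimately show ?thesis by simp
    next
      case False
      then obtain e where e: "e \<in> arcs K" "\<not> (tail G e \<in> FR \<and> head G e \<in> FR)" "\<not> A" by blast
      have eG: "e \<in> arcs G" using e aK by blast
      have ev: "tail G e \<in> verts K" "head G e \<in> verts K"
        using \<open>verts (arc_graph (arcs K)) \<subseteq> verts K\<close> e(1) by auto
      have "tail G e \<in> FX \<or> head G e \<in> FX"
        using e(2) arc_ends[OF eG] verts_cases[of "tail G e"] verts_cases[of "head G e"] by satx
      then obtain z where z: "z \<in> FX" "z \<in> verts K" using ev by blast
      \<comment> \<open>The signed image is unbalanced here, so its balanced bound says nothing. But
        \<open>K\<close> contains the fixed vertex, and the global bound over free vertices only,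
        \<open>2 * (card (verts K) - 1) - 1\<close>, is the required one.\<close>
      have "verts K - FX \<subset> verts K" using z by blast
      then have "card (verts K - FX) < card (verts K)" by (rule psubset_card_mono[OF fK])
      then show ?thesis using l e(3) by (simp add: lam_def)
    qed
    ultimately show ?thesis by blast
  qed
  show ?thesis
    unfolding gain_sparse_def
  proof (intro conjI allI impI)
    fix K assume "subgraph K H \<and> balanced \<Gamma> FX \<psi> K \<and> arcs K \<noteq> {}"
    then show "int (card (arcs K)) \<le> 2 * int (card (verts K)) - 3" using main[of K] by simp
  next
    fix K assume K: "subgraph K H \<and> arcs K \<noteq> {}"
    then have v: "verts K \<subseteq> verts G" using vH by (auto simp: subgraph_def)
    show "int (card (arcs K)) \<le> 2 * int (card (verts K \<inter> FR)) +
      (if A then 2 else 0) * int (card (verts K \<inter> FX)) - int (lam A)"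
      unfolding card_split[OF v, of A] using main[of K] K by simp
  qed
qed

lemma gain_tight_iff:
  assumes H: "spanning H G"
  shows "gain_tight \<Gamma> FX FR (if A then 2 else 0) (int (lam A)) H \<psi> \<longleftrightarrow>
    inj_on (trip A) (arcs H) \<and> sgsparse A (ZA A) (trip A ` arcs H) \<and>
    card (trip A ` arcs H) + lam A = 2 * card (XA A)"
proof -
  have s: "subgraph H G" and v: "verts H = verts G" using H by (auto simp: spanning_def)
  have "gain_tight \<Gamma> FX FR (if A then 2 else 0) (int (lam A)) H \<psi> \<longleftrightarrow>
    gain_sparse \<Gamma> FX FR (if A then 2 else 0) (int (lam A)) H \<psi> \<and> card (arcs H) + lam A = 2 * card (XA A)"
    unfolding gain_tight_def v card_XA by auto
  moreover have "gain_sparse \<Gamma> FX FR (if A then 2 else 0) (int (lam A)) H \<psi> \<longleftrightarrow>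
    inj_on (trip A) (arcs H) \<and> sgsparse A (ZA A) (trip A ` arcs H)"
    using gain_sparse_imp_sgsparse[OF s, of A] sgsparse_imp_gain_sparse[OF s, of A] by argo
  ultimately show ?thesis using card_image[of "trip A" "arcs H"] by auto
qed

text \<open>A basis of the rows is sparse, which bounds its size from above. If it were smaller, a
  nonzero motion pinned at \<open>y0\<close> would exist, while the trivial motions that the kernel
  consists of vanish under these pins.\<close>

lemma kernel_trivial_imp_gain_tight:
  assumes x0: "\<forall>z\<in>FX. x z = 0" and nz: "\<forall>y\<in>FR. x y \<noteq> 0"
    and ne: "\<forall>y\<in>verts G. \<forall>y'\<in>verts G. y \<noteq> y' \<longrightarrow> x y \<noteq> x y' \<and> x y \<noteq> - x y'"
    and y0: "y0 \<in> FR" and ker: "kernel_trivial A x"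
  shows "\<exists>H. spanning H G \<and> gain_tight \<Gamma> FX FR (if A then 2 else 0) (int (lam A)) H \<psi>"
proof -
  have y0X: "y0 \<in> XA A" using FR_XA y0 by blast
  have "\<exists>B\<subseteq>trip A ` arcs G. indep A x B \<and>
    (\<forall>m. (\<forall>f\<in>B. erow A x m f = 0) \<longrightarrow> (\<forall>f\<in>trip A ` arcs G. erow A x m f = 0))"
    by (rule ex_maximal_indep) (simp add: finite_arcs)
  then obtain B where B: "B \<subseteq> trip A ` arcs G" "indep A x B"
    and k: "\<forall>m. (\<forall>f\<in>B. erow A x m f = 0) \<longrightarrow> (\<forall>f\<in>trip A ` arcs G. erow A x m f = 0)"
    by (elim exE conjE)
  obtain F where F: "F \<subseteq> arcs G" "inj_on (trip A) F" "B = trip A ` F"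
    using B(1) unfolding subset_image_inj by (elim exE conjE)
  have fB: "finite B" using finite_subset[OF F(1) finite_arcs] F(3) by simp
  have VB: "VF B \<subseteq> XA A" using VF_trip_XA[OF F(1)] F(3) by simp
  have XG: "XA A \<subseteq> verts G" using verts_cases by (auto simp: XA_def)
  have sB: "signed B" unfolding F(3) by (rule signed_trip)
  have x0': "\<forall>z\<in>ZA A. x z = 0" using x0 by (simp add: ZA_def)
  have nz': "x u \<noteq> 0" if "u \<in> VF B" "u \<notin> ZA A" for u
  proof -
    have "u \<in> FR" using that VB verts_cases[of u] by (auto simp: XA_def ZA_def split: if_splits)
    then show ?thesis using nz by simp
  qed
  have ne': "x u \<noteq> x v \<and> x u \<noteq> - x v" if "u \<in> VF B" "v \<in> VF B" "u \<noteq> v" for u v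
  proof -
    have "u \<in> verts G" "v \<in> verts G" using that VB XG by auto
    then show ?thesis using ne that(3) by simp
  qed
  have lp: "u \<notin> ZA A \<and> s = -1" if "(u, u, s) \<in> B" for u s
  proof -
    from that obtain e where "e \<in> F" "trip A e = (u, u, s)" unfolding F(3) by (elim imageE) simp
    then show ?thesis using trip_loop[of e A u s] F(1) by auto
  qed
  have sp: "sgsparse A (ZA A) B"
    by (rule signed_setting.indep_imp_sgsparse[OF signed_setting_ZA fB sB B(2) x0' nz' ne' lp])
  have "card B + lam A \<le> 2 * card (XA A)"
  proof (cases "B = {}")
    case True
    have "card (XA A) \<ge> 1" using card_mono[OF finite_XA, of "{y0}" A] y0X by simp
    then show ?thesis using True by (cases A) (simp_all add: lam_def)
  next
    case False
    then show ?thesis using sgsparse_lam[OF sp order.refl] card_mono[OF finite_XA VB] by simp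
  qed
  moreover have "\<not> card B + lam A < 2 * card (XA A)"
  proof
    assume lt: "card B + lam A < 2 * card (XA A)"
    let ?xs = "if A then [(y0, axis 1 1), (y0, axis 2 1)] else [(y0, rotJ (x y0))]"
    have "\<exists>m. (\<exists>u\<in>XA A. m u \<noteq> 0) \<and> (\<forall>f\<in>B. erow A x m f = 0) \<and> (\<forall>(a, d)\<in>set ?xs. d \<bullet> m a = 0)"
      by (rule homogeneous_motion[OF fB finite_XA VB])
        (use lt y0X in \<open>auto simp: lam_def split: if_splits\<close>)
    then obtain m where m: "\<exists>u\<in>XA A. m u \<noteq> 0" "\<forall>f\<in>B. erow A x m f = 0" "\<forall>(a, d)\<in>set ?xs. d \<bullet> m a = 0"
      by (elim exE conjE)
    \<comment> \<open>Outside \<open>XA A\<close> the values of \<open>m\<close> are arbitrary; they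
      are reset to zero, as required at the fixed vertex in the symmetric case.\<close>
    define m' where "m' = (\<lambda>y. if y \<in> XA A then m y else 0)"
    have "erow A x m' f = 0" if f: "f \<in> B" for f
    proof -
      obtain u v s where uvs: "f = (u, v, s)" by (cases f)
      have "ends f \<subseteq> XA A" using ends_subset_VF[OF f] VB by simp
      then show ?thesis using bspec[OF m(2) f] by (simp add: uvs m'_def)
    qed
    then have "\<forall>f\<in>trip A ` arcs G. erow A x m' f = 0" using spec[OF k, of m'] by simp
    moreover have "\<not> A \<longrightarrow> (\<forall>z\<in>FX. m' z = 0)" using FX_FR by (simp add: m'_def XA_def)
    ultimately have "\<exists>t c. glob A t c \<and> (\<forall>y\<in>XA A. m' y = tmot A (\<lambda>_. 1) x t c y)"
      using ker unfolding kernel_trivial_def by simp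
    then obtain t c where tc: "glob A t c" "\<forall>y\<in>XA A. m' y = tmot A (\<lambda>_. 1) x t c y" by (elim exE conjE)
    have "\<forall>y\<in>XA A. m y = 0"
    proof (cases A)
      case True
      then have my: "\<forall>y\<in>XA A. m y = t" using tc by (simp add: m'_def glob_def tmot_def chi_def)
      then have "t = 0" using m(3) True bspec[OF my y0X] by (simp add: axis_inner vec_eq_2)
      then show ?thesis using my by simp
    next
      case False
      then have my: "\<forall>y\<in>XA A. m y = c *\<^sub>R rotJ (x y)" using tc by (simp add: m'_def glob_def tmot_def chi_def)
      have "rotJ (x y0) \<bullet> m y0 = 0" using m(3) False by simp
      then have "c * (rotJ (x y0) \<bullet> rotJ (x y0)) = 0" using bspec[OF my y0X] by simp
      then have "c = 0" using nz y0 by simp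
      then show ?thesis using my by simp
    qed
    then show False using m(1) by blast
  qed
  ultimately have eq: "card B + lam A = 2 * card (XA A)" by simp
  let ?H = "\<lparr>verts = verts G, arcs = F, tail = tail G, head = head G\<rparr>"
  have "wf_digraph ?H" unfolding wf_digraph_def using arc_ends(1,2) F(1) by auto
  then have H: "spanning ?H G" unfolding spanning_def subgraph_def compatible_def using wfG F(1) by simp
  have "gain_tight \<Gamma> FX FR (if A then 2 else 0) (int (lam A)) ?H \<psi>"
    unfolding gain_tight_iff[OF H] using F sp eq by simp
  with H show ?thesis by blast
qed

lemma indep_imp_kernel_trivial:
  assumes F: "F \<subseteq> arcs G" and ind: "indep A x (trip A ` F)"
    and card: "card (trip A ` F) + lam A = 2 * card (XA A)" and y0: "y0 \<in> FR" "x y0 \<noteq> 0"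
  shows "kernel_trivial A x"
  unfolding kernel_trivial_def
proof (intro allI impI)
  fix m assume "\<forall>f\<in>trip A ` arcs G. erow A x m f = 0"
  then have m: "\<forall>f\<in>trip A ` F. erow A x m f = 0" using F by blast
  have y0X: "y0 \<in> XA A" using FR_XA y0 by blast
  have f: "finite (trip A ` F)" using finite_subset[OF F finite_arcs] by simp
  show "\<exists>t c. glob A t c \<and> (\<forall>y\<in>XA A. m y = tmot A (\<lambda>_. 1) x t c y)"
    by (rule signed_setting.tight_motions_glob[OF signed_setting_ZA f ind signed_trip finite_XA
      VF_trip_XA[OF F] card m _ y0X]) (simp_all add: y0)
qed

end

section \<open>Rigid symmetric realisations\<close>

text \<open>Otherwise all points, and hence their affine hull, would lie on the line through the
  origin in direction \<open>x\<close>.\<close>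

lemma affine_hull_det2:
  fixes q :: "'a \<Rightarrow> real^2"
  assumes "affine hull (q ` V) = UNIV" "x \<noteq> 0"
  shows "\<exists>v\<in>V. det2 x (q v) \<noteq> 0"
proof (rule ccontr)
  assume "\<not> (\<exists>v\<in>V. det2 x (q v) \<noteq> 0)"
  then have "q ` V \<subseteq> {w. det2 x w = 0}" by auto
  moreover have "subspace {w. det2 x w = 0}"
    by (simp add: subspace_def det2_def algebra_simps flip: distrib_left)
  ultimately have "affine hull (q ` V) \<subseteq> {w. det2 x w = 0}"
    by (intro hull_minimal subspace_imp_affine)
  then have "det2 x (rotJ x) = 0" using assms(1) subsetD[of UNIV "{w. det2 x w = 0}" "rotJ x"] by simp
  then have "x $ 1 * x $ 1 + x $ 2 * x $ 2 = 0" by (simp add: det2_def)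
  then have "x = 0" by (simp add: vec_eq_2 sum_squares_eq_zero_iff)
  then show False using assms(2) by simp
qed

context c2_quotient
begin

lemma framework_det2:
  assumes fr: "framework V E q" and anti: "\<forall>v\<in>V. q (\<iota> v) = - q v"
  shows "\<exists>a\<in>FR. \<exists>b\<in>FR. det2 (q (r a)) (q (r b)) \<noteq> 0"
proof -
  obtain a where a: "a \<in> FR" using framework_FR[OF fr] by blast
  have "\<exists>v\<in>V. det2 (q (r a)) (q v) \<noteq> 0"
    by (rule affine_hull_det2) (use fr framework_rep(2)[OF fr anti a] in \<open>simp_all add: framework_def\<close>)
  then obtain v where v: "v \<in> V" "det2 (q (r a)) (q v) \<noteq> 0" by blast
  let ?b = "orb v"
  have b: "?b \<in> verts G" using v by (simp add: vertsG)
  have "v = r ?b \<or> v = \<iota> (r ?b)" by (rule rep_cases[OF v(1)])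
  then have "q v = q (r ?b) \<or> q v = - q (r ?b)"
    using bspec[OF anti conjunct2[OF rep_orb[OF b]]] by metis
  then have d: "det2 (q (r a)) (q (r ?b)) \<noteq> 0" using v(2) by (auto simp: det2_def)
  have "?b \<in> FR"
  proof (rule ccontr)
    assume "?b \<notin> FR"
    then have "?b \<in> FX" using b verts_cases[of ?b] by simp
    then have "q (r ?b) = 0" by (rule framework_rep(1)[OF fr anti])
    then show False using d by (simp add: det2_def)
  qed
  then show ?thesis using a d by blast
qed

lemma framework_lift:
  assumes x0: "\<forall>z\<in>FX. x z = 0" and nz: "\<forall>y\<in>FR. x y \<noteq> 0"
    and ne: "\<forall>y\<in>verts G. \<forall>y'\<in>verts G. y \<noteq> y' \<longrightarrow> x y \<noteq> x y' \<and> x y \<noteq> - x y'"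
    and ab: "a \<in> FR" "b \<in> FR" "det2 (x a) (x b) \<noteq> 0"
  shows "framework V E (lift (-1) x)" "\<forall>v\<in>V. lift (-1) x (\<iota> v) = - lift (-1) x v"
proof -
  let ?q = "lift (-1) x"
  show anti: "\<forall>v\<in>V. ?q (\<iota> v) = - ?q v"
    using lift_iota[of _ "-1" x] x0 by simp
  have pm: "?q v = x (orb v) \<or> ?q v = - x (orb v)" for v by (simp add: lift_def)
  have inj: "inj_on ?q V"
  proof (rule inj_onI, rule ccontr)
    fix u v assume uv: "u \<in> V" "v \<in> V" "?q u = ?q v" "u \<noteq> v"
    show False
    proof (cases "orb u = orb v")
      case True
      then have v: "v = \<iota> u" using orb_mem(1)[of v] uv(4) by (auto simp: orb_def)
      then have "orb u \<in> FR" using orb_FR[OF uv(1)] uv(4) by simp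
      then have "x (orb u) \<noteq> 0" using nz by simp
      moreover have "?q u = - ?q u" using uv(3) v bspec[OF anti uv(1)] by simp
      then have "?q u = 0" by (simp add: vec_eq_2)
      ultimately show False using pm[of u] by auto
    next
      case False
      have "orb u \<in> verts G" "orb v \<in> verts G" using uv by (simp_all add: vertsG)
      then have "x (orb u) \<noteq> x (orb v) \<and> x (orb u) \<noteq> - x (orb v)" using ne False by simp
      then show False using pm[of u] pm[of v] uv(3) by auto
    qed
  qed
  have mem: "x y \<in> ?q ` V" "- x y \<in> ?q ` V" if y: "y \<in> FR" for y
  proof -
    have yG: "y \<in> verts G" using y verts_cases[of y] by simp
    have V: "r y \<in> V" using rep_orb[OF yG] by simp
    have q: "?q (r y) = x y" by (rule lift_rep[OF yG])
    show "x y \<in> ?q ` V" using imageI[OF V, of ?q] q by simp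
    have "?q (\<iota> (r y)) = - x y" using bspec[OF anti V] q by simp
    then show "- x y \<in> ?q ` V" using imageI[OF iota_V[OF V], of ?q] by simp
  qed
  \<comment> \<open>The origin is the midpoint of a point and its half-turn image, so the affine
    hull is a linear span.\<close>
  have "(1/2) *\<^sub>R x a + (1/2) *\<^sub>R (- x a) \<in> affine hull (?q ` V)"
    by (rule mem_affine[OF affine_affine_hull hull_inc[OF mem(1)[OF ab(1)]] hull_inc[OF mem(2)[OF ab(1)]]]) simp
  then have 0: "0 \<in> affine hull (?q ` V)" by simp
  have "span {x a, x b} \<subseteq> span (?q ` V)" by (rule span_mono) (use mem ab in auto)
  then have "affine hull (?q ` V) = UNIV"
    using affine_hull_span_0[OF 0] det2_span[OF ab(3)] by auto
  with graph inj show "framework V E ?q" by (simp add: framework_def)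
qed

text \<open>Independence for both symmetry types and the conditions for a framework are finitely
  many line-generic properties. The former are realisable by sparsity, the latter by
  \<open>q0\<close>, so a single placement has them all.\<close>

lemma ex_rigid_realisation:
  assumes fr: "framework V E q0" and anti: "\<forall>v\<in>V. q0 (\<iota> v) = - q0 v"
    and H: "\<And>A. \<exists>H. spanning H G \<and> gain_tight \<Gamma> FX FR (if A then 2 else 0) (int (lam A)) H \<psi>"
  shows "\<exists>q. framework V E q \<and> (\<forall>v\<in>V. q (\<iota> v) = - q v) \<and> infinitesimally_rigid V E q"
proof -
  have "\<forall>A. \<exists>F. F \<subseteq> arcs G \<and> sgsparse A (ZA A) (trip A ` F) \<and>
    card (trip A ` F) + lam A = 2 * card (XA A)"
  proof
    fix A
    obtain H where H: "spanning H G" "gain_tight \<Gamma> FX FR (if A then 2 else 0) (int (lam A)) H \<psi>"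
      using H[of A] by (elim exE conjE)
    then show "\<exists>F. F \<subseteq> arcs G \<and> sgsparse A (ZA A) (trip A ` F) \<and>
      card (trip A ` F) + lam A = 2 * card (XA A)"
      unfolding gain_tight_iff[OF H(1)]
      by (intro exI[of _ "arcs H"]) (simp add: spanning_def subgraph_def)
  qed
  then obtain F where F: "\<And>A. F A \<subseteq> arcs G" "\<And>A. sgsparse A (ZA A) (trip A ` F A)"
    "\<And>A. card (trip A ` F A) + lam A = 2 * card (XA A)" by metis
  have fin: "finite (trip A ` F A)" for A using finite_subset[OF F(1) finite_arcs] by simp
  define x0 where "x0 = (\<lambda>y. q0 (r y))"
  have x00: "\<forall>z\<in>FX. x0 z = 0" and x0nz: "\<And>y. y \<in> FR \<Longrightarrow> x0 y \<noteq> 0"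
    and x0ne: "\<And>y y'. y \<in> verts G \<Longrightarrow> y' \<in> verts G \<Longrightarrow> y \<noteq> y' \<Longrightarrow> x0 y \<noteq> x0 y' \<and> x0 y \<noteq> - x0 y'"
    using framework_rep[OF fr anti] by (simp_all add: x0_def)
  obtain a b where ab: "a \<in> FR" "b \<in> FR" "det2 (x0 a) (x0 b) \<noteq> 0"
    using framework_det2[OF fr anti] by (auto simp: x0_def)
  have real: "\<exists>p. (\<forall>z\<in>FX. p z = 0) \<and> indep A p (trip A ` F A)" for A
  proof -
    have "\<exists>p. (\<forall>z\<in>ZA A. p z = 0) \<and> indep A p (trip A ` F A)"
      by (rule signed_setting.sgsparse_realisation[OF signed_setting_ZA finite_XA F(2) VF_trip_XA[OF F(1)]])
    then obtain p where p: "\<forall>z\<in>ZA A. p z = 0" "indep A p (trip A ` F A)" by (elim exE conjE)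
    \<comment> \<open>In the symmetric case \<open>ZA A\<close> is empty and the realisation may
      place the fixed vertex anywhere. Moving it to the origin is harmless, as no signed edge is
      incident with it.\<close>
    let ?p = "\<lambda>y. if y \<in> FX then 0 else p y"
    have "indep A ?p (trip A ` F A)"
    proof (rule iffD1[OF indep_cong_pos p(2)])
      fix u assume "u \<in> VF (trip A ` F A)"
      then have "u \<in> XA A" using VF_trip_XA[OF F(1)] by blast
      then show "p u = ?p u" using p(1) FX_FR[of u] by (auto simp: XA_def ZA_def split: if_splits)
    qed
    then show ?thesis by (intro exI[of _ ?p]) simp
  qed
  \<comment> \<open>With \<open>c = 1\<close>, the value \<open>d = 0\<close> states that a point is
    not the origin, and \<open>d = 1\<close>, \<open>d = -1\<close> that two orbits do not share a
    point.\<close>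
  define P where "P = (\<lambda>(c :: real, d :: real, y :: 'v set, y' :: 'v set) x. c *\<^sub>R x y - d *\<^sub>R x y' \<noteq> (0 :: real^2))"
  define S :: "(real \<times> real \<times> 'v set \<times> 'v set) set" where "S = {1} \<times> {0} \<times> FR \<times> FR \<union> {1} \<times> {1, -1} \<times> {(y, y') \<in> verts G \<times> verts G. y \<noteq> y'}"
  have fS: "finite S"
  proof -
    have "finite FR" using finite_XA[of False] by (simp add: XA_def)
    moreover have "finite {(y, y') \<in> verts G \<times> verts G. y \<noteq> y'}"
      by (rule finite_subset[of _ "verts G \<times> verts G"]) (use finite_verts in auto)
    ultimately show ?thesis by (simp add: S_def)
  qed
  let ?I = "(\<lambda>A x. indep A x (trip A ` F A)) ` UNIV \<union> {\<lambda>x. det2 (x a) (x b) \<noteq> 0} \<union> P ` S"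
  have lg: "line_generic Q" if Q: "Q \<in> ?I" for Q
  proof -
    have 1: "line_generic (\<lambda>x. indep A x (trip A ` F A))" for A by (rule line_generic_indep[OF fin])
    have 2: "line_generic (\<lambda>x. det2 (x a) (x b) \<noteq> 0)"
      using line_generic_det2[of 1 a 0 a 1 b 0 b] by simp
    have 3: "line_generic (P i)" for i
      using line_generic_combination by (cases i) (simp add: P_def)
    show ?thesis using Q 1 2 3 by (elim UnE imageE singletonE) simp_all
  qed
  have sat: "\<exists>x. (\<forall>z\<in>FX. x z = 0) \<and> Q x" if Q: "Q \<in> ?I" for Q
  proof -
    consider A where "Q = (\<lambda>x. indep A x (trip A ` F A))" | "Q = (\<lambda>x. det2 (x a) (x b) \<noteq> 0)"
      | i where "i \<in> S" "Q = P i"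
      using Q by (elim UnE imageE singletonE) simp_all
    then show ?thesis
    proof cases
      case 1
      then show ?thesis using real[of A] by simp
    next
      case 2
      then show ?thesis using x00 ab(3) by (intro exI[of _ x0]) simp
    next
      case 3
      obtain c d y y' where i: "i = (c, d, y, y')" by (cases i)
      have "c = 1 \<and> ((d = 0 \<and> y \<in> FR) \<or>
          ((d = 1 \<or> d = -1) \<and> y \<in> verts G \<and> y' \<in> verts G \<and> y \<noteq> y'))"
        using 3(1) unfolding S_def i
        by (simp only: Un_iff mem_Sigma_iff insert_iff empty_iff mem_Collect_eq prod.case) blast
      then have "P i x0"
        using x0nz[of y] x0ne[of y y'] by (elim disjE conjE) (simp_all add: P_def i eq_neg_iff_add_eq_0[of "x0 y" "x0 y'"])
      then show ?thesis using x00 3(2) by (intro exI[of _ x0]) simp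
    qed
  qed
  have "\<exists>x. (\<forall>z\<in>FX. x z = 0) \<and> (\<forall>Q\<in>?I. Q x)"
    by (rule line_generic_common[where Q="\<lambda>Q. Q"]) (simp_all only: lg sat finite_UnI finite_imageI fS finite.intros finite_class.finite)
  then obtain x where x0: "\<forall>z\<in>FX. x z = 0" and xQ: "\<forall>Q\<in>?I. Q x" by (elim exE conjE)
  have ind: "indep A x (trip A ` F A)" for A
    by (rule bspec[OF xQ, of "\<lambda>x. indep A x (trip A ` F A)"]) simp
  have det: "det2 (x a) (x b) \<noteq> 0"
    by (rule bspec[OF xQ, of "\<lambda>x. det2 (x a) (x b) \<noteq> 0"]) simp
  have Pi: "P i x" if "i \<in> S" for i by (rule bspec[OF xQ]) (use that in simp)
  have nz: "\<forall>y\<in>FR. x y \<noteq> 0"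
  proof
    fix y assume "y \<in> FR"
    then show "x y \<noteq> 0" using Pi[of "(1, 0, y, y)"] by (simp add: S_def P_def)
  qed
  have ne: "\<forall>y\<in>verts G. \<forall>y'\<in>verts G. y \<noteq> y' \<longrightarrow> x y \<noteq> x y' \<and> x y \<noteq> - x y'"
  proof (intro ballI impI)
    fix y y' assume "y \<in> verts G" "y' \<in> verts G" "y \<noteq> y'"
    then show "x y \<noteq> x y' \<and> x y \<noteq> - x y'"
      using Pi[of "(1, 1, y, y')"] Pi[of "(1, -1, y, y')"] by (auto simp: S_def P_def)
  qed
  let ?q = "lift (-1) x"
  note fq = framework_lift[OF x0 nz ne ab(1,2) det]
  have xr: "?q (r y) = x y" if "y \<in> verts G" for y by (rule lift_rep[OF that])
  have "kernel_trivial A (\<lambda>y. ?q (r y))" for A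
  proof (rule indep_imp_kernel_trivial[OF F(1) _ F(3) ab(1)])
    show "indep A (\<lambda>y. ?q (r y)) (trip A ` F A)"
    proof (rule iffD1[OF indep_cong_pos ind])
      fix u assume "u \<in> VF (trip A ` F A)"
      then have "u \<in> verts G" using subsetD[OF VF_trip_XA[OF F(1)], of u A A] verts_cases[of u] by (auto simp: XA_def split: if_splits)
      then show "x u = ?q (r u)" by (simp add: xr)
    qed
    show "?q (r a) \<noteq> 0" using nz ab(1) xr verts_cases by simp
  qed
  then have "infinitesimally_rigid V E ?q" using rigid_iff_kernels[OF fq refl] by simp
  with fq show ?thesis by blast
qed

lemma rigid_iff_gain_tight:
  assumes fr: "framework V E q" and anti: "\<forall>v\<in>V. q (\<iota> v) = - q v"
    and gen: "\<And>q'. framework V E q' \<Longrightarrow> \<forall>v\<in>V. q' (\<iota> v) = - q' v \<Longrightarrow> rigidity_rank E q' \<le> rigidity_rank E q"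
  shows "infinitesimally_rigid V E q \<longleftrightarrow>
    (\<forall>A. \<exists>H. spanning H G \<and> gain_tight \<Gamma> FX FR (if A then 2 else 0) (int (lam A)) H \<psi>)"
proof
  assume "infinitesimally_rigid V E q"
  then have ker: "kernel_trivial A (\<lambda>y. q (r y))" for A using rigid_iff_kernels[OF fr anti refl] by simp
  obtain y0 where y0: "y0 \<in> FR" using framework_FR[OF fr] by blast
  show "\<forall>A. \<exists>H. spanning H G \<and> gain_tight \<Gamma> FX FR (if A then 2 else 0) (int (lam A)) H \<psi>"
    by (intro allI kernel_trivial_imp_gain_tight[OF _ _ _ y0 ker] ballI impI framework_rep[OF fr anti])
next
  assume H: "\<forall>A. \<exists>H. spanning H G \<and> gain_tight \<Gamma> FX FR (if A then 2 else 0) (int (lam A)) H \<psi>"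
  obtain q' where q': "framework V E q'" "\<forall>v\<in>V. q' (\<iota> v) = - q' v" "infinitesimally_rigid V E q'"
    using ex_rigid_realisation[OF fr anti spec[OF H]] by (elim exE conjE)
  obtain y0 where y0: "y0 \<in> FR" using framework_FR[OF fr] by blast
  then have "y0 \<in> verts G" using verts_cases by simp
  then have V: "r y0 \<in> V" using rep_orb[of y0] by simp
  have "card {r y0, \<iota> (r y0)} \<le> card V"
    by (rule card_mono[OF finite_V]) (use V iota_V[OF V] in simp)
  then have V2: "2 \<le> card V" using rep_FR[OF y0] by simp
  \<comment> \<open>The rigid realisation \<open>q'\<close> has rank at least
    \<open>2 * card V - 3\<close>, and a generic \<open>q\<close> has no smaller rank.\<close>
  have "2 * card V \<le> rigidity_rank E q + 3"
    using rigid_imp_rank[OF q'(1,3) V2] gen[OF q'(1,2)] by simp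
  then show "infinitesimally_rigid V E q" by (rule rank_imp_rigid[OF fr _ V2])
qed

end

lemma plane_rotation_pi: "plane_rotation pi *v x = - x"
  by (simp add: plane_rotation_def matrix_vector_mult_def vec_eq_2 sum_2)

text \<open>The image of the unit is idempotent, whereas the half-turn squares to the identity
  matrix and differs from it.\<close>

lemma C2_representation_values:
  assumes "group \<Gamma>" and C: "carrier \<Gamma> = {\<one>\<^bsub>\<Gamma>\<^esub>, \<gamma>}" and \<tau>: "C2_representation \<Gamma> \<tau>"
  shows "\<tau> \<one>\<^bsub>\<Gamma>\<^esub> = mat 1" "\<tau> \<gamma> = plane_rotation pi"
proof -
  interpret group \<Gamma> by fact
  have ne: "plane_rotation pi \<noteq> mat 1"
  proof
    assume "plane_rotation pi = mat 1"
    then have "- (axis 1 1 :: real^2) = axis 1 1" using plane_rotation_pi[of "axis 1 1"] by simp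
    then show False by (simp add: vec_eq_2 axis_def)
  qed
  have sq: "plane_rotation pi ** plane_rotation pi = mat 1"
    by (simp add: matrix_eq plane_rotation_pi flip: matrix_vector_mul_assoc)
  have im: "\<tau> ` carrier \<Gamma> = {mat 1, plane_rotation pi}" and h: "\<tau> \<in> hom \<Gamma> orthogonal_group"
    using \<tau> by (simp_all add: C2_representation_def)
  have "\<tau> (\<one>\<^bsub>\<Gamma>\<^esub> \<otimes>\<^bsub>\<Gamma>\<^esub> \<one>\<^bsub>\<Gamma>\<^esub>) = \<tau> \<one>\<^bsub>\<Gamma>\<^esub> ** \<tau> \<one>\<^bsub>\<Gamma>\<^esub>"
    using hom_mult[OF h one_closed one_closed] by (simp add: orthogonal_group_def)
  then have "\<tau> \<one>\<^bsub>\<Gamma>\<^esub> = \<tau> \<one>\<^bsub>\<Gamma>\<^esub> ** \<tau> \<one>\<^bsub>\<Gamma>\<^esub>" by simp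
  moreover have "\<tau> \<one>\<^bsub>\<Gamma>\<^esub> \<in> {mat 1, plane_rotation pi}" using im by blast
  ultimately show 1: "\<tau> \<one>\<^bsub>\<Gamma>\<^esub> = mat 1" using sq ne by auto
  have "plane_rotation pi \<in> \<tau> ` carrier \<Gamma>" using im by blast
  then show "\<tau> \<gamma> = plane_rotation pi" using 1 ne by (auto simp: C)
qed

theorem theorem7p11:
  fixes \<Gamma> :: "'g monoid"
    and V :: "'v set" and E :: "'v set set" and p' :: "'v \<Rightarrow> real^2"
    and \<phi> :: "'g \<Rightarrow> 'v \<Rightarrow> 'v" and \<tau> :: "'g \<Rightarrow> real^2^2"
    and G :: "('v set, 'v set set) pre_digraph" and \<psi> :: "'v set set \<Rightarrow> 'g"
    and p :: "'v set \<Rightarrow> real^2"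
  assumes "group \<Gamma>" and "cyclic_group \<Gamma>" and "Coset.order \<Gamma> = 2"
    and "graph_action \<Gamma> V E \<phi>"
    and "C2_representation \<Gamma> \<tau>"
    and "generic_framework \<Gamma> \<phi> \<tau> V E p'"
    and "gain_framework \<Gamma> \<phi> V E p' G \<psi> p"
  shows "infinitesimally_rigid V E p' \<longleftrightarrow>
    (\<exists>H. spanning H G \<and>
       gain_tight \<Gamma> (fixed_orbits \<Gamma> \<phi> V) (free_orbits \<Gamma> \<phi> V) 0 1 H \<psi>) \<and>
    (\<exists>H. spanning H G \<and>
       gain_tight \<Gamma> (fixed_orbits \<Gamma> \<phi> V) (free_orbits \<Gamma> \<phi> V) 2 2 H \<psi>)"
proof -
  interpret group \<Gamma> by fact
  have "card (carrier \<Gamma>) = 2" using assms(3) by (simp add: Coset.order_def)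
  then obtain a b where ab: "carrier \<Gamma> = {a, b}" "a \<noteq> b" by (auto simp: card_2_iff)
  then have "\<one>\<^bsub>\<Gamma>\<^esub> = a \<or> \<one>\<^bsub>\<Gamma>\<^esub> = b" using one_closed by simp
  then have "\<exists>\<gamma>. carrier \<Gamma> = {\<one>\<^bsub>\<Gamma>\<^esub>, \<gamma>} \<and> \<gamma> \<noteq> \<one>\<^bsub>\<Gamma>\<^esub>"
    using ab by (elim disjE) (simp_all, blast+)
  then obtain \<gamma> where C: "carrier \<Gamma> = {\<one>\<^bsub>\<Gamma>\<^esub>, \<gamma>}" and ne: "\<gamma> \<noteq> \<one>\<^bsub>\<Gamma>\<^esub>" by (elim exE conjE)
  have gC: "\<gamma> \<in> carrier \<Gamma>" by (simp add: C)
  have "\<gamma> \<otimes>\<^bsub>\<Gamma>\<^esub> \<gamma> \<in> carrier \<Gamma>" using gC by simp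
  moreover have "\<gamma> \<otimes>\<^bsub>\<Gamma>\<^esub> \<gamma> \<noteq> \<gamma>" using gC ne by simp
  ultimately have gg: "\<gamma> \<otimes>\<^bsub>\<Gamma>\<^esub> \<gamma> = \<one>\<^bsub>\<Gamma>\<^esub>" by (simp add: C)
  have ga: "group_action \<Gamma> V \<phi>" using assms(4) by (simp add: graph_action_def)
  define \<iota> where "\<iota> = \<phi> \<gamma>"
  have one: "\<phi> \<one>\<^bsub>\<Gamma>\<^esub> v = v" if "v \<in> V" for v
    using fun_cong[OF group_action.id_eq_one[OF ga], of v] that by simp
  have iV: "\<iota> v \<in> V" if "v \<in> V" for v
    using group_action.element_image[OF ga gC that refl] by (simp add: \<iota>_def)
  have ii: "\<iota> (\<iota> v) = v" if "v \<in> V" for v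
    using group_action.composition_rule[OF ga that gC gC] one[OF that] by (simp add: gg \<iota>_def)
  have sym: "symmetric_framework \<Gamma> \<phi> \<tau> V E q \<longleftrightarrow> framework V E q \<and> (\<forall>v\<in>V. q (\<iota> v) = - q v)" for q
    unfolding symmetric_framework_def C
    by (auto simp: C2_representation_values[OF assms(1) C assms(5)] plane_rotation_pi one \<iota>_def)
  have fr: "framework V E p'" and anti: "\<forall>v\<in>V. p' (\<iota> v) = - p' v"
    using assms(6) sym by (simp_all add: generic_framework_def)
  have gen: "rigidity_rank E q \<le> rigidity_rank E p'"
    if "framework V E q" "\<forall>v\<in>V. q (\<iota> v) = - q v" for q
    using assms(6) sym[of q] that by (simp add: generic_framework_def)
  have graph: "simple_graph V E" using fr by (simp add: framework_def)
  have EV: "e \<subseteq> V" if "e \<in> E" for e using graph that by (simp add: simple_graph_def)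
  define orb where "orb = (\<lambda>v. {v, \<iota> v})"
  have orbit2: "orbit \<Gamma> \<phi> v = {\<phi> \<one>\<^bsub>\<Gamma>\<^esub> v, \<phi> \<gamma> v}" for v
    by (auto simp: orbit_def C)
  have orb: "orbit \<Gamma> \<phi> v = orb v" if "v \<in> V" for v
    by (simp add: orbit2 orb_def \<iota>_def one[OF that])
  have eorb: "orbit \<Gamma> (\<lambda>g e. \<phi> g ` e) e = {e, \<iota> ` e}" if "e \<in> E" for e
  proof -
    have "\<phi> \<one>\<^bsub>\<Gamma>\<^esub> ` e = id ` e" by (rule image_cong[OF refl]) (use EV[OF that] one in auto)
    moreover have "orbit \<Gamma> (\<lambda>g e. \<phi> g ` e) e = {\<phi> \<one>\<^bsub>\<Gamma>\<^esub> ` e, \<iota> ` e}"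
      by (auto simp: orbit_def C \<iota>_def)
    ultimately show ?thesis by simp
  qed
  have stab: "stabilizer \<Gamma> \<phi> v = (if \<iota> v = v then carrier \<Gamma> else {\<one>\<^bsub>\<Gamma>\<^esub>})" if "v \<in> V" for v
    unfolding stabilizer_def C \<iota>_def using one[OF that] by auto
  have cne: "carrier \<Gamma> \<noteq> {\<one>\<^bsub>\<Gamma>\<^esub>}" using gC ne by auto
  define FX where "FX = orb ` {v \<in> V. \<iota> v = v}"
  define FR where "FR = orb ` {v \<in> V. \<iota> v \<noteq> v}"
  have "fixed_orbits \<Gamma> \<phi> V = orbit \<Gamma> \<phi> ` {v \<in> V. stabilizer \<Gamma> \<phi> v = carrier \<Gamma>}"
    by (auto simp: fixed_orbits_def)
  also have "{v \<in> V. stabilizer \<Gamma> \<phi> v = carrier \<Gamma>} = {v \<in> V. \<iota> v = v}"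
    by (intro Collect_cong conj_cong refl) (use cne in \<open>simp add: stab\<close>)
  also have "orbit \<Gamma> \<phi> ` \<dots> = FX" unfolding FX_def by (rule image_cong) (simp_all add: orb)
  finally have FX: "fixed_orbits \<Gamma> \<phi> V = FX" .
  have "free_orbits \<Gamma> \<phi> V = orbit \<Gamma> \<phi> ` {v \<in> V. stabilizer \<Gamma> \<phi> v = {\<one>\<^bsub>\<Gamma>\<^esub>}}"
    by (auto simp: free_orbits_def)
  also have "{v \<in> V. stabilizer \<Gamma> \<phi> v = {\<one>\<^bsub>\<Gamma>\<^esub>}} = {v \<in> V. \<iota> v \<noteq> v}"
    by (intro Collect_cong conj_cong refl) (use cne in \<open>simp add: stab\<close>)
  also have "orbit \<Gamma> \<phi> ` \<dots> = FR" unfolding FR_def by (rule image_cong) (simp_all add: orb)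
  finally have FR: "free_orbits \<Gamma> \<phi> V = FR" .
  obtain r where Q: "quotient_gain_graph \<Gamma> \<phi> V E r G \<psi>"
    using assms(7) by (auto simp: gain_framework_def)
  have "verts G = orbit \<Gamma> \<phi> ` V"
    using Q by (simp add: quotient_gain_graph_def orbits_def Setcompr_eq_image)
  also have "\<dots> = orb ` V" by (rule image_cong[OF refl orb])
  finally have vG: "verts G = orb ` V" .
  have "arcs G = orbit \<Gamma> (\<lambda>g e. \<phi> g ` e) ` E"
    using Q by (simp add: quotient_gain_graph_def orbits_def Setcompr_eq_image)
  also have "\<dots> = (\<lambda>e. {e, \<iota> ` e}) ` E" by (rule image_cong[OF refl eorb])
  finally have aG: "arcs G = (\<lambda>e. {e, \<iota> ` e}) ` E" .
  have rep: "r x \<in> x" if "x \<in> verts G" for x using Q that by (simp add: quotient_gain_graph_def)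
  have arcV: "f \<subseteq> V" if "e \<in> arcs G" "f \<in> e" for e f
  proof -
    obtain f0 where f0: "f0 \<in> E" "e = {f0, \<iota> ` f0}" using \<open>e \<in> arcs G\<close> by (auto simp: aG)
    then show ?thesis using EV[OF f0(1)] iV \<open>f \<in> e\<close> by auto
  qed
  interpret c2_quotient \<Gamma> \<gamma> V E \<iota> G \<psi> r orb FX FR
  proof unfold_locales
    show "{\<iota> u, \<iota> v} \<in> E" if "{u, v} \<in> E" for u v
    proof -
      have "u \<in> V" "v \<in> V" using EV[OF that] by auto
      then show ?thesis using assms(4) gC that by (auto simp: graph_action_def \<iota>_def)
    qed
    show "u = v" if "u \<in> V" "v \<in> V" "\<iota> u = u" "\<iota> v = v" for u v
    proof -
      \<comment> \<open>Fixed vertices lie at the origin, so injectivity leaves at most one.\<close>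
      have "p' u = - p' u" "p' v = - p' v" using bspec[OF anti that(1)] bspec[OF anti that(2)] that(3,4) by simp_all
      then have "p' u = p' v" by (simp add: vec_eq_2)
      moreover have "inj_on p' V" using fr by (simp add: framework_def)
      ultimately show ?thesis using that(1,2) by (simp add: inj_onD)
    qed
    show "\<exists>u v. {u, v} \<in> e \<and> tail G e = orb u \<and> head G e = orb v" if e: "e \<in> arcs G" for e
    proof -
      have "\<exists>u v. {u, v} \<in> e \<and> tail G e = orbit \<Gamma> \<phi> u \<and> head G e = orbit \<Gamma> \<phi> v"
        using Q e by (simp add: quotient_gain_graph_def)
      then obtain u v where uv: "{u, v} \<in> e" "tail G e = orbit \<Gamma> \<phi> u" "head G e = orbit \<Gamma> \<phi> v"
        by (elim exE conjE)
      have "u \<in> V" "v \<in> V" using arcV[OF e uv(1)] by auto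
      then show ?thesis using uv orb by auto
    qed
    show "\<psi> e \<in> carrier \<Gamma>" if "e \<in> arcs G" for e using Q that by (simp add: quotient_gain_graph_def)
    show "{r (tail G e), if \<psi> e = \<one>\<^bsub>\<Gamma>\<^esub> then r (head G e) else \<iota> (r (head G e))} \<in> e"
      if e: "e \<in> arcs G" and t: "tail G e \<in> FR" and h: "head G e \<in> FR" for e
    proof -
      have g: "{r (tail G e), \<phi> (\<psi> e) (r (head G e))} \<in> e" "\<psi> e \<in> carrier \<Gamma>"
        using Q e t h by (simp_all add: quotient_gain_graph_def FR)
      obtain v where v: "v \<in> V" "head G e = orb v" using h by (auto simp: FR_def)
      then have "r (head G e) \<in> orb v" using rep[of "head G e"] by (simp add: vG)
      then have "r (head G e) \<in> V" using v(1) iV[OF v(1)] by (auto simp: orb_def)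
      then have "\<phi> \<one>\<^bsub>\<Gamma>\<^esub> (r (head G e)) = r (head G e)" by (rule one)
      then show ?thesis using g by (auto simp: C \<iota>_def)
    qed
  qed (simp_all add: orb_def FX_def FR_def graph iV ii vG aG rep C ne)
  have "infinitesimally_rigid V E p' \<longleftrightarrow>
    (\<forall>A. \<exists>H. spanning H G \<and> gain_tight \<Gamma> FX FR (if A then 2 else 0) (int (lam A)) H \<psi>)"
    by (rule rigid_iff_gain_tight[OF fr anti gen])
  \<comment> \<open>\<open>A = False\<close> yields the weight 0 and \<open>lam A = 1\<close>,
    \<open>A = True\<close> the weight 2 and \<open>lam A = 2\<close>.\<close>
  then show ?thesis unfolding FX FR by (simp add: all_bool_eq lam_def conj_commute)
qed

end
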